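(* Let $\lambda$ be the security parameter, let $a=a(\lambda)=\omega(\log\lambda)$ and $B=B(\lambda)$ be polynomially bounded, and suppose $\mathcal C$ is a binary code (family), encoding blocks of $a$ bits, with constant rate $R$ and constant error-tolerance. Then the triple $(\mathsf{Gen},\mathsf{Enc},\mathsf{Dec})$ constructed from $\mathcal C$ in the context is a private $(2/R,\ \kappa,\ \delta,\ \varepsilon,\ 1)$-amortizeable LDC with $\kappa=a=\omega(\log\lambda)$, for some constants $\delta>0$ and $\varepsilon\in(0,1)$ (i.e. it is a $(2/R,\omega(\log\lambda),O(1),O(1),1)$-paLDC).
   Context: Notation: $[k]=\{1,\dots,k\}$; $\circ$ is concatenation; $\oplus$ is bitwise XOR; PPT means probabilistic polynomial time in $\lambda$. An $(n,k)$-code is an encoder from length-$k$ messages to length-$n$ codewords with a decoder; its rate is $k/n$; error-tolerance $\delta_{\mathcal C}$ means the decoder recovers the message from any word within Hamming distance $\delta_{\mathcal C}n$ of the codeword. Encoding and decoding of $\mathcal C$ are polynomial time. Private amortizeable LDC: a triple of PPT algorithms $(\mathsf{Gen},\mathsf{Enc},\mathsf{Dec})$ is a private $(\alpha,\kappa,\delta,\varepsilon,q)$-amortizeable LDC (paLDC) if (i) for all $\mathsf{sk}\in\mathrm{Range}(\mathsf{Gen}(1^\lambda))$, $(\mathsf{Enc}_{\mathsf{sk}},\mathsf{Dec}_{\mathsf{sk}})$ is an $(n,k)$-code; and (ii) for every PPT $\mathcal A$ there is a negligible $\mu$ with $\Pr[\text{paLDC-Sec-Game}(\mathcal A,\lambda,\delta,\kappa,q)=1]\le\mu(\lambda)$,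 the probability being over the randomness of $\mathcal A$, $\mathsf{Gen}$ and the game. In paLDC-Sec-Game the challenger generates $\mathsf{sk}\leftarrow\mathsf{Gen}(1^\lambda)$ and, for rounds $h=1,\dots,q$: (1) $\mathcal A$ chooses a message $x^{(h)}\in\{0,1\}^k$ and sends it to the challenger; (2) the challenger sends $y^{(h)}\leftarrow\mathsf{Enc}_{\mathsf{sk}}(x^{(h)})$ to $\mathcal A$; (3) $\mathcal A$ outputs $\tilde y^{(h)}\in\{0,1\}^n$ at Hamming distance at most $\delta n$ from $y^{(h)}$; (4) if there exist $L,M\in[k]$ with $M-L+1\ge\kappa$ and $\Pr[\mathsf{Dec}^{\tilde y^{(h)}}_{\mathsf{sk}}(L,M)\ne x^{(h)}_L\cdots x^{(h)}_M]>\varepsilon(\lambda)$, such that $\mathsf{Dec}^{\tilde y^{(h)}}_{\mathsf{sk}}(\cdot)$ makes at most $(M-L+1)\alpha$ queries to $\tilde y^{(h)}$, the experiment outputs $1$. If it did not output $1$ in any round, it outputs $0$. Construction (with $A=a/R$ the block codeword length, messages of length $k=aB$, codewords of length $n=AB$): - $\mathsf{Gen}(1^\lambda)$: the secret key is a uniformly random permutation $\pi$ of $[AB]$ and a uniformly random one-time pad $r\in\{0,1\}^{AB}$. - $\mathsf{Enc}_{\mathsf{sk}}(x)$: split $x=w_1\circ\cdots\circ w_B$ into $B$ blocks of length $a$; encode $w'_j=\mathcal C(w_j)$; let $y'=w'_1\circ\cdots\circ w'_B$; output $y=\pi(y'\oplus r)$, i.e. the string whose coordinate $\pi(i)$ equals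 $y'_i\oplus r_i$. - $\mathsf{Dec}^{\tilde y}_{\mathsf{sk}}(L,M)$: for each block $w_j$ that meets the positions $L,\dots,M$, query $\tilde y$ at $\pi(i)$ for every index $i$ of $w'_j$ in $y'$, form the word with entries $\tilde y_{\pi(i)}\oplus r_i$, and decode it with the decoder of $\mathcal C$; output the bits at positions $L,\dots,M$ of the decoded blocks.
   Formalization: The parameters a(λ) and B(λ) are additionally assumed to be computable in time polynomial in λ; being polynomially bounded alone does not make Gen a PPT algorithm (a could be uncomputable). *)

theory Defs
  imports
    "HOL-Probability.Probability_Mass_Function"
    "HOL-Combinatorics.Multiset_Permutations"
    "HOL-Computational_Algebra.Polynomial"
    "HOL-Library.Landau_Symbols"
begin

section \<open>Asymptotics\<close>

definition polynomially_bounded :: "(nat \<Rightarrow> nat) \<Rightarrow> bool" where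
  "polynomially_bounded f \<longleftrightarrow> (\<exists>P :: nat poly. \<forall>l. f l \<le> poly P l)"

definition negligible :: "(nat \<Rightarrow> real) \<Rightarrow> bool" where
  "negligible \<mu> \<longleftrightarrow> (\<forall>c :: nat. \<mu> \<in> O(\<lambda>l. 1 / real l ^ c))"


section \<open>Probabilistic polynomial time\<close>

text \<open>
  The machine model is a variant of Jones' WHILE language: programs transform binary trees, every
  operation takes unit time except that numbers, which are written in unary, are read and drawn in
  time proportional to their size.  Since one step allocates at most one cell (or the cells of one
  number paid for), polynomial time here agrees with polynomial time on probabilistic Turing
  machines that can draw uniformly below a given (unary) bound.  The latter ability, instead of
  mere coin flips, is what makes it possible to sample an exactly uniform permutation in bounded
  time.
\<close>

datatype data = Atom | Cell data data

primrec left :: "data \<Rightarrow> data" where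
  "left Atom = Atom"
| "left (Cell u v) = u"

primrec right :: "data \<Rightarrow> data" where
  "right Atom = Atom"
| "right (Cell u v) = v"

text \<open>The length of the right spine, i.e. the number that a tree stands for in unary.\<close>

primrec spine :: "data \<Rightarrow> nat" where
  "spine Atom = 0"
| "spine (Cell u v) = Suc (spine v)"

class repr =
  fixes repr :: "'a \<Rightarrow> data"
  assumes repr_inject: "repr x = repr y \<Longrightarrow> x = y"

instantiation data :: repr
begin
definition repr_data :: "data \<Rightarrow> data" where "repr_data d = d"
instance by standard (simp add: repr_data_def)
end

instantiation unit :: repr
begin
definition repr_unit :: "unit \<Rightarrow> data" where "repr_unit u = Atom"
instance by standard simp
end

instantiation bool :: repr
begin
definition repr_bool :: "bool \<Rightarrow> data" where "repr_bool b = (if b then Cell Atom Atom else Atom)"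
instance by standard (simp add: repr_bool_def split: if_splits)
end

instantiation nat :: repr
begin
primrec repr_nat :: "nat \<Rightarrow> data" where
  "repr_nat 0 = Atom"
| "repr_nat (Suc m) = Cell Atom (repr_nat m)"
instance
proof
  fix x y :: nat
  show "repr x = repr y \<Longrightarrow> x = y"
    by (induction x arbitrary: y) (case_tac y; simp)+
qed
end

instantiation prod :: (repr, repr) repr
begin
definition repr_prod :: "'a \<times> 'b \<Rightarrow> data" where "repr_prod p = Cell (repr (fst p)) (repr (snd p))"
instance by standard (auto simp: repr_prod_def prod_eq_iff dest: repr_inject)
end

instantiation list :: (repr) repr
begin
primrec repr_list :: "'a list \<Rightarrow> data" where
  "repr_list [] = Atom"
| "repr_list (x # xs) = Cell (repr x) (repr_list xs)"
instance
proof
  fix x y :: "'a list"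
  show "repr x = repr y \<Longrightarrow> x = y"
    by (induction x arbitrary: y) (case_tac y; auto dest: repr_inject)+
qed
end

datatype prog =
    Ident
  | Const_Atom
  | Make prog prog
  | Left
  | Right
  | Then prog prog
  | Cond prog prog prog
  | Loop prog
  | Rand
  | Query

text \<open>
  A computation maps the number of steps it may still take to its result, the list of oracle
  positions it has queried and the number of steps that are left, or to \<open>None\<close> when it is
  out of time.
\<close>

type_synonym 'a comp = "nat \<Rightarrow> ('a \<times> nat list \<times> nat) option pmf"

definition comp_return :: "'a \<Rightarrow> 'a comp" where
  "comp_return v = (\<lambda>t. return_pmf (Some (v, [], t)))"

definition comp_bind :: "'a comp \<Rightarrow> ('a \<Rightarrow> 'b comp) \<Rightarrow> 'b comp" where
  "comp_bind m f = (\<lambda>t. bind_pmf (m t) (\<lambda>res. case res of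
     None \<Rightarrow> return_pmf None
   | Some (v, qs, t') \<Rightarrow> map_pmf (map_option (\<lambda>(w, qs', t''). (w, qs @ qs', t''))) (f v t')))"

definition comp_tick :: "nat \<Rightarrow> 'a comp \<Rightarrow> 'a comp" where
  "comp_tick c m = (\<lambda>t. if t < c then return_pmf None else m (t - c))"

definition comp_rand :: "nat \<Rightarrow> nat comp" where
  "comp_rand m = (\<lambda>t. map_pmf (\<lambda>i. Some (i, [], t))
     (if m = 0 then return_pmf 0 else pmf_of_set {..<m}))"

definition comp_query :: "bool list \<Rightarrow> nat \<Rightarrow> bool comp" where
  "comp_query y i = (\<lambda>t. return_pmf (Some (i < length y \<and> y ! i, [i], t)))"

text \<open>A loop repeats its body as long as the left component of the current tree is not \<open>Atom\<close>.\<close>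

primrec comp_loop :: "nat \<Rightarrow> (data \<Rightarrow> data comp) \<Rightarrow> data \<Rightarrow> data comp" where
  "comp_loop 0 f v = (\<lambda>t. return_pmf None)"
| "comp_loop (Suc m) f v =
     (if left v = Atom then comp_return v else comp_tick 1 (comp_bind (f v) (comp_loop m f)))"

text \<open>
  Each iteration costs at least one step, so bounding the number of loop tests by \<open>Suc t\<close>
  when \<open>t\<close> steps are left cuts off no computation that is not out of time anyway.
\<close>

primrec exec :: "bool list \<Rightarrow> prog \<Rightarrow> data \<Rightarrow> data comp" where
  "exec y Ident v = comp_tick 1 (comp_return v)"
| "exec y Const_Atom v = comp_tick 1 (comp_return Atom)"
| "exec y (Make p q) v =
     comp_tick 1 (comp_bind (exec y p v) (\<lambda>u. comp_bind (exec y q v) (\<lambda>w. comp_return (Cell u w))))"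
| "exec y Left v = comp_tick 1 (comp_return (left v))"
| "exec y Right v = comp_tick 1 (comp_return (right v))"
| "exec y (Then p q) v = comp_tick 1 (comp_bind (exec y p v) (exec y q))"
| "exec y (Cond p q r) v =
     comp_tick 1 (comp_bind (exec y p v) (\<lambda>u. if u \<noteq> Atom then exec y q v else exec y r v))"
| "exec y (Loop p) v = comp_tick 1 (\<lambda>t. comp_loop (Suc t) (exec y p) v t)"
| "exec y Rand v =
     comp_tick (Suc (spine v)) (comp_bind (comp_rand (spine v)) (\<lambda>i. comp_return (repr i)))"
| "exec y Query v =
     comp_tick (Suc (spine v)) (comp_bind (comp_query y (spine v)) (\<lambda>b. comp_return (repr b)))"

definition outcome :: "bool list \<Rightarrow> prog \<Rightarrow> data \<Rightarrow> nat \<Rightarrow> (data \<times> nat list) option pmf" where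
  "outcome y p v t = map_pmf (map_option (\<lambda>(w, qs, _). (w, qs))) (exec y p v t)"

text \<open>
  Deterministic algorithms with query access to a bit string.  A randomized oracle algorithm is a
  distribution over these: the internal coins can be drawn before the first query.
\<close>

datatype 'r oracle_alg = Done 'r | Ask nat "bool \<Rightarrow> 'r oracle_alg"

primrec run_alg :: "bool list \<Rightarrow> 'r oracle_alg \<Rightarrow> 'r \<times> nat list" where
  "run_alg y (Done v) = (v, [])"
| "run_alg y (Ask i g) =
     (let (v, qs) = run_alg y (g (i < length y \<and> y ! i)) in (v, i # qs))"

text \<open>
  \<open>ppt_oracle D F\<close>: one program, running on \<open>1\<^sup>l\<close> and an input in \<open>D l\<close>, always halts
  within a number of steps polynomial in \<open>l\<close> and, whatever the oracle, has the same distribution of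
  result and queries as \<open>F l\<close>.
\<close>

definition ppt_oracle ::
  "(nat \<Rightarrow> ('i :: repr) set) \<Rightarrow> (nat \<Rightarrow> 'i \<Rightarrow> ('o :: repr) oracle_alg pmf) \<Rightarrow> bool" where
  "ppt_oracle D F \<longleftrightarrow> (\<exists>p T. polynomially_bounded T \<and>
     (\<forall>l. \<forall>i \<in> D l. \<forall>y. outcome y p (repr (l, i)) (T l) =
        map_pmf (\<lambda>g. case run_alg y g of (v, qs) \<Rightarrow> Some (repr v, qs)) (F l i)))"

definition ppt :: "(nat \<Rightarrow> ('i :: repr) set) \<Rightarrow> (nat \<Rightarrow> 'i \<Rightarrow> ('o :: repr) pmf) \<Rightarrow> bool" where
  "ppt D F \<longleftrightarrow> ppt_oracle D (\<lambda>l i. map_pmf Done (F l i))"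

definition poly_time :: "(nat \<Rightarrow> ('i :: repr) set) \<Rightarrow> (nat \<Rightarrow> 'i \<Rightarrow> ('o :: repr)) \<Rightarrow> bool" where
  "poly_time D f \<longleftrightarrow> ppt D (\<lambda>l i. return_pmf (f l i))"


section \<open>Codes\<close>

definition hamming :: "bool list \<Rightarrow> bool list \<Rightarrow> nat" where
  "hamming y z = card {i. i < length y \<and> y ! i \<noteq> z ! i}"

definition is_code ::
  "nat \<Rightarrow> nat \<Rightarrow> (bool list \<Rightarrow> bool list) \<Rightarrow> (bool list \<Rightarrow> bool list) \<Rightarrow> bool" where
  "is_code n k enc dec \<longleftrightarrow>
     (\<forall>x. length x = k \<longrightarrow> length (enc x) = n) \<and> (\<forall>y. length y = n \<longrightarrow> length (dec y) = k)"

definition error_tolerance ::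
  "nat \<Rightarrow> nat \<Rightarrow> real \<Rightarrow> (bool list \<Rightarrow> bool list) \<Rightarrow> (bool list \<Rightarrow> bool list) \<Rightarrow> bool" where
  "error_tolerance n k \<delta> enc dec \<longleftrightarrow>
     (\<forall>x y. length x = k \<longrightarrow> length y = n \<longrightarrow> real (hamming (enc x) y) \<le> \<delta> * real n \<longrightarrow> dec y = x)"


section \<open>Private amortizeable LDCs\<close>

text \<open>The positions \<open>L, \<dots>, M\<close> of a word, counted from 1.\<close>

definition segment :: "nat \<Rightarrow> nat \<Rightarrow> bool list \<Rightarrow> bool list" where
  "segment L M x = take (M + 1 - L) (drop (L - 1) x)"

text \<open>
  The query bound is a conjunct of the winning condition of the game and not a separate demand on the
  decoder: an interval on which the decoder exceeds the bound cannot make the adversary win.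
\<close>

definition decoding_fails ::
  "real \<Rightarrow> nat \<Rightarrow> real \<Rightarrow> nat \<Rightarrow> (nat \<Rightarrow> nat \<Rightarrow> bool list oracle_alg pmf) \<Rightarrow>
   bool list \<Rightarrow> bool list \<Rightarrow> bool" where
  "decoding_fails \<alpha> \<kappa> \<epsilon> k D x y \<longleftrightarrow> (\<exists>L M. 1 \<le> L \<and> L \<le> M \<and> M \<le> k \<and> \<kappa> \<le> M + 1 - L \<and>
     measure_pmf.prob (D L M) {g. fst (run_alg y g) \<noteq> segment L M x} > \<epsilon> \<and>
     (\<forall>g \<in> set_pmf (D L M). real (length (snd (run_alg y g))) \<le> real (M + 1 - L) * \<alpha>))"

text \<open>
  The adversary keeps its memory between its moves in a tree: \<open>ch l s\<close> chooses a message
  and \<open>co l s y\<close> returns a corruption of \<open>y\<close>, each together with a new memory.  It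
  loses by an illegal move.
\<close>

primrec paLDC_rounds ::
  "real \<Rightarrow> nat \<Rightarrow> real \<Rightarrow> real \<Rightarrow> nat \<Rightarrow> nat \<Rightarrow>
   (bool list \<Rightarrow> bool list pmf) \<Rightarrow> (nat \<Rightarrow> nat \<Rightarrow> bool list oracle_alg pmf) \<Rightarrow>
   (data \<Rightarrow> (bool list \<times> data) pmf) \<Rightarrow> (data \<Rightarrow> bool list \<Rightarrow> (bool list \<times> data) pmf) \<Rightarrow>
   nat \<Rightarrow> data \<Rightarrow> bool pmf" where
  "paLDC_rounds \<alpha> \<kappa> \<delta> \<epsilon> n k E D ch co 0 s = return_pmf False"
| "paLDC_rounds \<alpha> \<kappa> \<delta> \<epsilon> n k E D ch co (Suc h) s =
     bind_pmf (ch s) (\<lambda>(x, s').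
       if length x \<noteq> k then return_pmf False
       else bind_pmf (E x) (\<lambda>y.
         bind_pmf (co s' y) (\<lambda>(y', s'').
           if length y' \<noteq> n \<or> real (hamming y y') > \<delta> * real n then return_pmf False
           else if decoding_fails \<alpha> \<kappa> \<epsilon> k D x y' then return_pmf True
           else paLDC_rounds \<alpha> \<kappa> \<delta> \<epsilon> n k E D ch co h s'')))"

definition paLDC_sec_game ::
  "real \<Rightarrow> nat \<Rightarrow> real \<Rightarrow> real \<Rightarrow> nat \<Rightarrow> nat \<Rightarrow> nat \<Rightarrow> 'sk pmf \<Rightarrow>
   ('sk \<Rightarrow> bool list \<Rightarrow> bool list pmf) \<Rightarrow> ('sk \<Rightarrow> nat \<Rightarrow> nat \<Rightarrow> bool list oracle_alg pmf) \<Rightarrow>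
   (data \<Rightarrow> (bool list \<times> data) pmf) \<Rightarrow> (data \<Rightarrow> bool list \<Rightarrow> (bool list \<times> data) pmf) \<Rightarrow>
   bool pmf" where
  "paLDC_sec_game \<alpha> \<kappa> \<delta> \<epsilon> q n k G E D ch co =
     bind_pmf G (\<lambda>sk. paLDC_rounds \<alpha> \<kappa> \<delta> \<epsilon> n k (E sk) (D sk) ch co q Atom)"

definition ppt_adversary ::
  "(nat \<Rightarrow> nat) \<Rightarrow> (nat \<Rightarrow> data \<Rightarrow> (bool list \<times> data) pmf) \<Rightarrow>
   (nat \<Rightarrow> data \<Rightarrow> bool list \<Rightarrow> (bool list \<times> data) pmf) \<Rightarrow> bool" where
  "ppt_adversary n ch co \<longleftrightarrow>
     ppt (\<lambda>l. UNIV) ch \<and> ppt (\<lambda>l. {(s, y). length y = n l}) (\<lambda>l (s, y). co l s y)"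

definition is_local_code ::
  "nat \<Rightarrow> nat \<Rightarrow> (bool list \<Rightarrow> bool list pmf) \<Rightarrow>
   (nat \<Rightarrow> nat \<Rightarrow> bool list oracle_alg pmf) \<Rightarrow> bool" where
  "is_local_code n k E D \<longleftrightarrow> (\<forall>x. length x = k \<longrightarrow> (\<forall>y \<in> set_pmf (E x). length y = n \<and>
     (\<forall>L M. 1 \<le> L \<and> L \<le> M \<and> M \<le> k \<longrightarrow> (\<forall>g \<in> set_pmf (D L M). fst (run_alg y g) = segment L M x))))"

definition paLDC ::
  "(nat \<Rightarrow> nat) \<Rightarrow> (nat \<Rightarrow> nat) \<Rightarrow> (nat \<Rightarrow> ('sk :: repr) pmf) \<Rightarrow>
   (nat \<Rightarrow> 'sk \<Rightarrow> bool list \<Rightarrow> bool list pmf) \<Rightarrow>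
   (nat \<Rightarrow> 'sk \<Rightarrow> nat \<Rightarrow> nat \<Rightarrow> bool list oracle_alg pmf) \<Rightarrow>
   real \<Rightarrow> (nat \<Rightarrow> nat) \<Rightarrow> real \<Rightarrow> (nat \<Rightarrow> real) \<Rightarrow> nat \<Rightarrow> bool" where
  "paLDC n k Gen Enc Dec \<alpha> \<kappa> \<delta> \<epsilon> q \<longleftrightarrow>
     ppt (\<lambda>l. {()}) (\<lambda>l _. Gen l) \<and>
     ppt (\<lambda>l. {(sk, x). sk \<in> set_pmf (Gen l) \<and> length x = k l}) (\<lambda>l (sk, x). Enc l sk x) \<and>
     ppt_oracle (\<lambda>l. {(sk, L, M). sk \<in> set_pmf (Gen l) \<and> 1 \<le> L \<and> L \<le> M \<and> M \<le> k l})
       (\<lambda>l (sk, L, M). Dec l sk L M) \<and>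
     (\<forall>l. \<forall>sk \<in> set_pmf (Gen l). is_local_code (n l) (k l) (Enc l sk) (Dec l sk)) \<and>
     (\<forall>ch co. ppt_adversary n ch co \<longrightarrow> (\<exists>\<mu>. negligible \<mu> \<and>
        (\<forall>l. pmf (paLDC_sec_game \<alpha> (\<kappa> l) \<delta> (\<epsilon> l) q (n l) (k l)
                   (Gen l) (Enc l) (Dec l) (ch l) (co l)) True \<le> \<mu> l)))"


section \<open>The block construction\<close>

text \<open>
  Positions of codewords, blocks and key entries are counted from 0.  A permutation \<open>\<pi>\<close> of
  \<open>{..<n}\<close> is given by the list of its values.
\<close>

type_synonym key = "nat list \<times> bool list"

definition con_gen :: "(nat \<Rightarrow> nat) \<Rightarrow> (nat \<Rightarrow> nat) \<Rightarrow> nat \<Rightarrow> key pmf" where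
  "con_gen A B l = pair_pmf (pmf_of_set (permutations_of_set {..<A l * B l}))
     (pmf_of_set {r. length r = A l * B l})"

definition xor_bits :: "bool list \<Rightarrow> bool list \<Rightarrow> bool list" where
  "xor_bits = map2 (\<noteq>)"

text \<open>\<open>permute \<pi> z\<close> is the string whose coordinate \<open>\<pi> i\<close> is \<open>z\<^sub>i\<close>.\<close>

definition permute :: "nat list \<Rightarrow> bool list \<Rightarrow> bool list" where
  "permute \<pi> z = fold (\<lambda>i y. y[\<pi> ! i := z ! i]) [0..<length z] (replicate (length z) False)"

definition con_enc :: "(nat \<Rightarrow> nat) \<Rightarrow> (nat \<Rightarrow> nat) \<Rightarrow> (nat \<Rightarrow> bool list \<Rightarrow> bool list) \<Rightarrow>
  nat \<Rightarrow> key \<Rightarrow> bool list \<Rightarrow> bool list pmf" where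
  "con_enc a B encC l sk x = (case sk of (\<pi>, r) \<Rightarrow>
     let y' = concat (map (\<lambda>j. encC l (take (a l) (drop (j * a l) x))) [0..<B l])
     in return_pmf (permute \<pi> (xor_bits y' r)))"

primrec ask_list :: "nat list \<Rightarrow> (bool list \<Rightarrow> 'r oracle_alg) \<Rightarrow> 'r oracle_alg" where
  "ask_list [] f = f []"
| "ask_list (i # is) f = Ask i (\<lambda>b. ask_list is (\<lambda>bs. f (b # bs)))"

primrec decode_blocks :: "nat \<Rightarrow> (bool list \<Rightarrow> bool list) \<Rightarrow> key \<Rightarrow> nat list \<Rightarrow>
  (bool list list \<Rightarrow> 'r oracle_alg) \<Rightarrow> 'r oracle_alg" where
  "decode_blocks m dec sk [] f = f []"
| "decode_blocks m dec sk (j # js) f =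
     ask_list (map (\<lambda>i. fst sk ! i) [j * m..<(j + 1) * m]) (\<lambda>v.
       decode_blocks m dec sk js (\<lambda>ws. f (dec (xor_bits v (take m (drop (j * m) (snd sk)))) # ws)))"

text \<open>
  Block \<open>j\<close> holds the message positions \<open>j * a + 1, \<dots>, (j + 1) * a\<close>, so position
  \<open>L\<close> is preceded by \<open>(L - 1) mod a\<close> bits in the first block that is decoded.
\<close>

definition con_dec :: "(nat \<Rightarrow> nat) \<Rightarrow> (nat \<Rightarrow> nat) \<Rightarrow> (nat \<Rightarrow> nat) \<Rightarrow>
  (nat \<Rightarrow> bool list \<Rightarrow> bool list) \<Rightarrow> nat \<Rightarrow> key \<Rightarrow> nat \<Rightarrow> nat \<Rightarrow> bool list oracle_alg pmf" where
  "con_dec a A B decC l sk L M = return_pmf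
     (decode_blocks (A l) (decC l) sk
       (filter (\<lambda>j. j * a l < M \<and> L \<le> (j + 1) * a l) [0..<B l])
       (\<lambda>ws. Done (take (M + 1 - L) (drop ((L - 1) mod a l) (concat ws)))))"

end

theory Submission
  imports Defs "HOL-Probability.Random_Permutations"
begin

text \<open>
  Security: the one-time pad makes the codeword that the adversary sees uniform and independent of
  the permutation, so the set of corrupted coordinates is chosen without knowledge of the
  permutation, and the preimage of a set of at most \<open>\<delta> n\<close> coordinates covers a
  given set of \<open>t\<close> coordinates with probability at most \<open>\<delta> ^ t\<close>.  A union
  bound over the sets of more than \<open>\<delta>C * A\<close> coordinates of one block and over the
  \<open>B\<close> blocks shows that some block is beyond the error-tolerance with probability at most
  \<open>B * 2 ^ A * \<delta> powr (\<delta>C * A)\<close>.  For \<open>\<delta> = 4 powr (- 1 / \<delta>C)\<close> this is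
  \<open>B / 2 ^ A\<close>, which is negligible because \<open>A = a / R\<close> grows faster than the logarithm.

  Efficiency: the functions that some program computes in polynomial time are closed under
  composition, case distinction and folds over lists of polynomial length, so no program has to be
  written down.
\<close>

section \<open>Computations in the writer monad over random variables\<close>

text \<open>\<open>ppt_oracle\<close> asks for the exact joint distribution of result and queries,
  within a time that depends on \<open>l\<close> alone. Programs are therefore compared with
  distributions over pairs of a value and a query list. Every closure property carries a domain: the
  encoder and the decoder of the code are given only on words of the right length, so compositions
  must show that intermediate values stay there, and loops need invariants. On the probabilistic
  side, the number of corrupted coordinates in one block is hypergeometric. Asking for the
  probability that a whole set is hit avoids tail estimates: drawing without replacement hits a
  fixed set at most as often as drawing with replacement, and this gives the power of
  \<open>\<delta>\<close>. The base 4 is 2 * 2: one factor pays for the at most \<open>2 ^ A\<close>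
  sets within a block, the other makes the bound decay. The exponent \<open>- 1 / \<delta>C\<close>
  cancels the \<open>\<delta>C\<close> of the threshold \<open>\<delta>C * A\<close>.\<close>

definition wreturn :: "'a \<Rightarrow> ('a \<times> nat list) pmf" where
  "wreturn v = return_pmf (v, [])"

text \<open>This is \<open>comp_bind\<close> with the clock forgotten, so the distribution computed
  by a composite program has the shape of the program.\<close>

definition wbind :: "('a \<times> nat list) pmf \<Rightarrow> ('a \<Rightarrow> ('b \<times> nat list) pmf) \<Rightarrow> ('b \<times> nat list) pmf" where
  "wbind M K = bind_pmf M (\<lambda>(v, qs). map_pmf (\<lambda>(w, qs'). (w, qs @ qs')) (K v))"

primrec wfold :: "('x \<Rightarrow> 's \<Rightarrow> ('s \<times> nat list) pmf) \<Rightarrow> 'x list \<Rightarrow> 's \<Rightarrow> ('s \<times> nat list) pmf" where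
  "wfold f [] s = wreturn s"
| "wfold f (x # xs) s = wbind (f x s) (wfold f xs)"

lemma wbind_wreturn [simp]: "wbind (wreturn v) K = K v"
  by (simp add: wbind_def wreturn_def bind_return_pmf case_prod_unfold map_pmf_ident)

lemma wbind_return_pmf: "wbind (return_pmf (v, qs)) K = map_pmf (\<lambda>(w, qs'). (w, qs @ qs')) (K v)"
  by (simp add: wbind_def bind_return_pmf)

lemma wbind_wreturn_right: "wbind M (\<lambda>v. wreturn (g v)) = map_pmf (\<lambda>(v, qs). (g v, qs)) M"
  by (simp add: wbind_def wreturn_def map_pmf_def bind_return_pmf case_prod_unfold)

lemma set_pmf_wreturn [simp]: "set_pmf (wreturn v) = {(v, [])}"
  by (simp add: wreturn_def)

lemma map_pmf_wbind:
  "map_pmf (\<lambda>(v, qs). (h v, qs)) (wbind M K) = wbind M (\<lambda>v. map_pmf (\<lambda>(v, qs). (h v, qs)) (K v))"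
  by (simp add: wbind_def map_bind_pmf pmf.map_comp o_def case_prod_unfold)

lemma wbind_map_pmf:
  "wbind (map_pmf (\<lambda>(v, qs). (h v, qs)) M) K = wbind M (\<lambda>v. K (h v))"
  by (simp add: wbind_def bind_map_pmf case_prod_unfold)

lemma wfold_wreturn: "wfold (\<lambda>x s. wreturn (g x s)) xs s = wreturn (fold g xs s)"
  by (induction xs arbitrary: s) simp_all

section \<open>Clocked computations: time bounds and the effect of additional time\<close>

section \<open>Time\<close>

text \<open>
  The time that is left is random; only a bound on the time used is recorded, uniformly in the
  time available.
\<close>

definition halts :: "'a comp \<Rightarrow> nat \<Rightarrow> ('a \<times> nat list) pmf \<Rightarrow> bool" where
  "halts m c M \<longleftrightarrow> (\<forall>t \<ge> c.
     map_pmf (map_option (\<lambda>(v, qs, _). (v, qs))) (m t) = map_pmf Some M \<and>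
     (\<forall>res \<in> set_pmf (m t). \<forall>v qs t'. res = Some (v, qs, t') \<longrightarrow> t \<le> t' + c))"

lemma halts_mono: "halts m c M \<Longrightarrow> c \<le> d \<Longrightarrow> halts m d M"
  unfolding halts_def by (meson le_trans add_left_mono)

text \<open>Equal distributions have equal supports, and the right-hand side in \<open>halts\<close>
  is an image under \<open>Some\<close>; hence running out of time has probability zero.\<close>

lemma halts_support:
  assumes "halts m c M" "c \<le> t" "res \<in> set_pmf (m t)"
  obtains v qs t' where "res = Some (v, qs, t')" "(v, qs) \<in> set_pmf M" "t \<le> t' + c"
proof -
  let ?f = "map_option (\<lambda>(v, qs, _). (v, qs))"
  have eq: "map_pmf ?f (m t) = map_pmf Some M" using assms by (auto simp: halts_def)
  have "?f res \<in> set_pmf (map_pmf ?f (m t))" using assms(3) by simp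
  then have "?f res \<in> Some ` set_pmf M" unfolding eq by simp
  then show thesis using that assms by (cases res) (auto simp: halts_def)
qed

lemma halts_return: "halts (comp_return v) 0 (wreturn v)"
  by (simp add: halts_def comp_return_def wreturn_def)

lemma halts_tick: "halts m c M \<Longrightarrow> halts (comp_tick k m) (k + c) M"
  unfolding halts_def comp_tick_def
proof (intro allI impI)
  fix t
  assume *: "\<forall>t\<ge>c. map_pmf (map_option (\<lambda>(v, qs, _). (v, qs))) (m t) = map_pmf Some M \<and>
             (\<forall>res\<in>set_pmf (m t). \<forall>v qs t'. res = Some (v, qs, t') \<longrightarrow> t \<le> t' + c)"
    and "k + c \<le> t"
  then have "c \<le> t - k" "\<not> t < k" by auto
  with * show "map_pmf (map_option (\<lambda>(v, qs, _). (v, qs))) (if t < k then return_pmf None else m (t - k)) =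
      map_pmf Some M \<and>
      (\<forall>res\<in>set_pmf (if t < k then return_pmf None else m (t - k)).
         \<forall>v qs t'. res = Some (v, qs, t') \<longrightarrow> t \<le> t' + (k + c))"
    by fastforce
qed

text \<open>The time left after \<open>m\<close> differs from path to path, but at least
  \<open>d\<close> steps always remain, and above \<open>d\<close> the projected distribution of
  \<open>f v\<close> no longer depends on the clock.\<close>

lemma halts_bind:
  assumes m: "halts m c M" and f: "\<And>v qs. (v, qs) \<in> set_pmf M \<Longrightarrow> halts (f v) d (K v)"
  shows "halts (comp_bind m f) (c + d) (wbind M K)"
  unfolding halts_def
proof (intro allI impI conjI ballI)
  fix t assume t: "c + d \<le> t"
  let ?p = "map_option (\<lambda>(v, qs, _). (v, qs))"
  let ?g = "\<lambda>res. case res of None \<Rightarrow> return_pmf None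
     | Some (v, qs) \<Rightarrow> map_pmf (\<lambda>(w, qs'). Some (w, qs @ qs')) (K v)"
  have "map_pmf ?p (comp_bind m f t) = bind_pmf (m t) (\<lambda>res. ?g (?p res))"
    unfolding comp_bind_def map_bind_pmf
  proof (rule bind_pmf_cong[OF refl])
    fix res assume "res \<in> set_pmf (m t)"
    with m t obtain v qs t' where res: "res = Some (v, qs, t')" "(v, qs) \<in> set_pmf M" "t \<le> t' + c"
      using halts_support[of m c M t res] by auto
    then have eq: "map_pmf ?p (f v t') = map_pmf Some (K v)"
      using f t by (auto simp: halts_def)
    have "map_pmf ?p (map_pmf (map_option (\<lambda>(w, qs', t''). (w, qs @ qs', t''))) (f v t')) =
      map_pmf (map_option (\<lambda>(w, qs'). (w, qs @ qs'))) (map_pmf ?p (f v t'))"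
      by (simp add: pmf.map_comp o_def option.map_comp case_prod_unfold)
    also have "\<dots> = map_pmf (\<lambda>(w, qs'). Some (w, qs @ qs')) (K v)"
      unfolding eq by (simp add: pmf.map_comp o_def case_prod_unfold)
    finally show "map_pmf ?p (case res of None \<Rightarrow> return_pmf None | Some (v, qs, t') \<Rightarrow>
        map_pmf (map_option (\<lambda>(w, qs', t''). (w, qs @ qs', t''))) (f v t')) = ?g (?p res)"
      using res by simp
  qed
  also have "\<dots> = bind_pmf (map_pmf ?p (m t)) ?g" by (simp add: bind_map_pmf)
  also have "\<dots> = bind_pmf (map_pmf Some M) ?g" using m t by (simp add: halts_def)
  also have "\<dots> = map_pmf Some (wbind M K)"
    by (simp add: wbind_def bind_map_pmf map_bind_pmf pmf.map_comp o_def case_prod_unfold)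
  finally show "map_pmf ?p (comp_bind m f t) = map_pmf Some (wbind M K)" .
next
  fix t res w qs t'' assume t: "c + d \<le> t" and res: "res \<in> set_pmf (comp_bind m f t)"
    and r: "res = Some (w, qs, t'')"
  from res obtain res1 where 1: "res1 \<in> set_pmf (m t)"
    "res \<in> set_pmf (case res1 of None \<Rightarrow> return_pmf None | Some (v, qs, t') \<Rightarrow>
      map_pmf (map_option (\<lambda>(w, qs', t''). (w, qs @ qs', t''))) (f v t'))"
    unfolding comp_bind_def by auto
  from 1(1) m t obtain v qs1 t1 where 2: "res1 = Some (v, qs1, t1)" "(v, qs1) \<in> set_pmf M" "t \<le> t1 + c"
    using halts_support[of m c M t res1] by auto
  have "Some (w, qs, t'') \<in> map_option (\<lambda>(w, qs', t''). (w, qs1 @ qs', t'')) ` set_pmf (f v t1)"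
    using 1(2) unfolding 2(1) r by simp
  then obtain z where z: "z \<in> set_pmf (f v t1)"
    "map_option (\<lambda>(w, qs', t''). (w, qs1 @ qs', t'')) z = Some (w, qs, t'')" by force
  then obtain qs2 where "Some (w, qs2, t'') \<in> set_pmf (f v t1)" by (cases z) auto
  with f[OF 2(2)] 2(3) t have "t1 \<le> t'' + d" unfolding halts_def by fastforce
  with 2(3) show "t \<le> t'' + (c + d)" by simp
qed

text \<open>
  \<open>outcome\<close> is known at a single time bound only, while composition needs it at every
  larger one: resilience bridges the gap.
\<close>

definition resilient :: "'a comp \<Rightarrow> bool" where
  "resilient m \<longleftrightarrow> (\<forall>t d. None \<notin> set_pmf (m t) \<longrightarrow>
     m (t + d) = map_pmf (map_option (\<lambda>(v, qs, t'). (v, qs, t' + d))) (m t))"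

lemma resilient_return: "resilient (comp_return v)"
  by (simp add: resilient_def comp_return_def)

lemma resilient_rand: "resilient (comp_rand m)"
  by (simp add: resilient_def comp_rand_def pmf.map_comp o_def)

lemma resilient_query: "resilient (comp_query y i)"
  by (simp add: resilient_def comp_query_def)

lemma resilient_tick: "resilient m \<Longrightarrow> resilient (comp_tick k m)"
  unfolding resilient_def
proof (intro allI impI)
  fix t d
  assume m: "\<forall>t d. None \<notin> set_pmf (m t) \<longrightarrow>
      m (t + d) = map_pmf (map_option (\<lambda>(v, qs, t'). (v, qs, t' + d))) (m t)"
    and N: "None \<notin> set_pmf (comp_tick k m t)"
  then have "\<not> t < k" "None \<notin> set_pmf (m (t - k))" by (auto simp: comp_tick_def split: if_splits)
  with m have "m (t - k + d) = map_pmf (map_option (\<lambda>(v, qs, t'). (v, qs, t' + d))) (m (t - k))"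
    by blast
  with \<open>\<not> t < k\<close> show "comp_tick k m (t + d) =
      map_pmf (map_option (\<lambda>(v, qs, t'). (v, qs, t' + d))) (comp_tick k m t)"
    by (simp add: comp_tick_def)
qed

text \<open>The continuation \<open>f'\<close> may differ from \<open>f\<close> because a loop with
  more time also gets a larger bound on its number of tests.\<close>

lemma comp_bind_more_time:
  assumes m: "m' = map_pmf (map_option (\<lambda>(v, qs, t'). (v, qs, t' + d))) (m t)"
    and None: "None \<notin> set_pmf (comp_bind m f t)"
    and f: "\<And>v t'. None \<notin> set_pmf (f v t') \<Longrightarrow>
      f' v (t' + d) = map_pmf (map_option (\<lambda>(v, qs, t'). (v, qs, t' + d))) (f v t')"
  shows "bind_pmf m' (\<lambda>res. case res of None \<Rightarrow> return_pmf None | Some (v, qs, t') \<Rightarrow>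
        map_pmf (map_option (\<lambda>(w, qs', t''). (w, qs @ qs', t''))) (f' v t')) =
    map_pmf (map_option (\<lambda>(v, qs, t'). (v, qs, t' + d))) (comp_bind m f t)"
  unfolding m comp_bind_def bind_map_pmf map_bind_pmf
proof (rule bind_pmf_cong[OF refl])
  fix res assume res: "res \<in> set_pmf (m t)"
  show "(case map_option (\<lambda>(v, qs, t'). (v, qs, t' + d)) res of None \<Rightarrow> return_pmf None
      | Some (v, qs, t') \<Rightarrow> map_pmf (map_option (\<lambda>(w, qs', t''). (w, qs @ qs', t''))) (f' v t')) =
    map_pmf (map_option (\<lambda>(v, qs, t'). (v, qs, t' + d))) (case res of None \<Rightarrow> return_pmf None
      | Some (v, qs, t') \<Rightarrow> map_pmf (map_option (\<lambda>(w, qs', t''). (w, qs @ qs', t''))) (f v t'))"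
  proof (cases res)
    case (Some r)
    obtain v qs t' where r: "r = (v, qs, t')" by (cases r)
    have "None \<notin> set_pmf (f v t')"
      using None res Some r unfolding comp_bind_def by (auto simp: image_iff)
    then show ?thesis
      unfolding Some r option.case option.map prod.case by (subst f)
        (auto simp only: pmf.map_comp o_def option.map_comp split_beta fst_conv snd_conv)
  qed simp
qed

lemma resilient_bind: "resilient m \<Longrightarrow> (\<And>v. resilient (f v)) \<Longrightarrow> resilient (comp_bind m f)"
  unfolding resilient_def
proof (intro allI impI)
  fix t d
  assume m: "\<forall>t d. None \<notin> set_pmf (m t) \<longrightarrow>
      m (t + d) = map_pmf (map_option (\<lambda>(v, qs, t'). (v, qs, t' + d))) (m t)"
    and f: "\<And>v. \<forall>t d. None \<notin> set_pmf (f v t) \<longrightarrow>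
      f v (t + d) = map_pmf (map_option (\<lambda>(v, qs, t'). (v, qs, t' + d))) (f v t)"
    and N: "None \<notin> set_pmf (comp_bind m f t)"
  have "None \<notin> set_pmf (m t)" using N unfolding comp_bind_def by force
  with m have "m (t + d) = map_pmf (map_option (\<lambda>(v, qs, t'). (v, qs, t' + d))) (m t)" by blast
  from comp_bind_more_time[OF this N] f
  show "comp_bind m f (t + d) = map_pmf (map_option (\<lambda>(v, qs, t'). (v, qs, t' + d))) (comp_bind m f t)"
    by (simp add: comp_bind_def)
qed

text \<open>A loop that never returns \<open>None\<close> has not exhausted its \<open>m\<close>
  tests, so raising that bound changes nothing but the time left.\<close>

lemma comp_loop_more_time:
  assumes f: "\<And>v. resilient (f v)"
  shows "None \<notin> set_pmf (comp_loop m f v t) \<Longrightarrow>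
    comp_loop (m + e) f v (t + d) =
      map_pmf (map_option (\<lambda>(v, qs, t'). (v, qs, t' + d))) (comp_loop m f v t)"
proof (induction m arbitrary: v t)
  case (Suc m)
  show ?case
  proof (cases "left v = Atom")
    case False
    have t: "\<not> t < 1" using Suc.prems False by (auto simp: comp_tick_def split: if_splits)
    have N: "None \<notin> set_pmf (comp_bind (f v) (comp_loop m f) (t - 1))"
      using Suc.prems False t by (simp add: comp_tick_def)
    have "None \<notin> set_pmf (f v (t - 1))" using N unfolding comp_bind_def by force
    with f have "f v (t - 1 + d) = map_pmf (map_option (\<lambda>(v, qs, t'). (v, qs, t' + d))) (f v (t - 1))"
      unfolding resilient_def by blast
    from comp_bind_more_time[OF this N Suc.IH]
    have "comp_bind (f v) (comp_loop (m + e) f) (t - 1 + d) =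
        map_pmf (map_option (\<lambda>(v, qs, t'). (v, qs, t' + d))) (comp_bind (f v) (comp_loop m f) (t - 1))"
      unfolding comp_bind_def[of _ "comp_loop (m + e) f"] by blast
    with False t show ?thesis by (simp add: comp_tick_def)
  qed (simp add: comp_return_def)
qed simp

lemma resilient_exec: "resilient (exec y p v)"
proof (induction p arbitrary: v)
  case (Loop p)
  \<comment> \<open>The bound on the tests is \<open>Suc t\<close> and moves with the clock, so the
    extra time is used for both \<open>d\<close> and \<open>e\<close>.\<close>
  have "resilient (\<lambda>t. comp_loop (Suc t) (exec y p) v t)"
    unfolding resilient_def using comp_loop_more_time[of "exec y p", OF Loop]
    by (metis add_Suc)
  then show ?case by (simp add: resilient_tick)
next
  case (Cond p q r)
  then show ?case by (auto intro!: resilient_tick resilient_bind)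
qed (auto intro!: resilient_tick resilient_bind resilient_return resilient_rand resilient_query)

text \<open>With budget \<open>c\<close> no path times out, so resilience applies: with budget
  \<open>t\<close> each path ends with \<open>t - c\<close> more steps left than with budget
  \<open>c\<close>, and has thus used at most \<open>c\<close>.\<close>

lemma halts_exec_if_outcome:
  assumes "outcome y p v c = map_pmf Some M"
  shows "halts (exec y p v) c M"
proof -
  let ?p = "map_option (\<lambda>(v, qs, _). (v, qs))"
  have eq: "map_pmf ?p (exec y p v c) = map_pmf Some M" using assms by (simp add: outcome_def)
  have N: "None \<notin> set_pmf (exec y p v c)"
  proof
    assume "None \<in> set_pmf (exec y p v c)"
    then have "?p None \<in> set_pmf (map_pmf ?p (exec y p v c))" by force
    then show False unfolding eq by auto
  qed
  have more: "exec y p v t = map_pmf (map_option (\<lambda>(v, qs, t'). (v, qs, t' + (t - c)))) (exec y p v c)"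
    if "c \<le> t" for t
    using resilient_exec[unfolded resilient_def, rule_format, OF N, of "t - c"] that by simp
  show ?thesis unfolding halts_def
  proof (intro allI impI conjI ballI)
    fix t assume t: "c \<le> t"
    show "map_pmf ?p (exec y p v t) = map_pmf Some M"
      unfolding more[OF t] eq[symmetric] by (simp add: pmf.map_comp o_def option.map_comp case_prod_unfold)
    fix res w qs t' assume "res \<in> set_pmf (exec y p v t)" "res = Some (w, qs, t')"
    then have "Some (w, qs, t') \<in> map_option (\<lambda>(v, qs, t'). (v, qs, t' + (t - c))) ` set_pmf (exec y p v c)"
      by (simp only: more[OF t] set_map_pmf)
    then obtain x where "Some (w, qs, t') = map_option (\<lambda>(v, qs, t'). (v, qs, t' + (t - c))) x"
      by blast
    with t show "t \<le> t' + c" by (cases x) auto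
  qed
qed

lemma outcome_if_halts_exec: "halts (exec y p v) c M \<Longrightarrow> outcome y p v c = map_pmf Some M"
  by (simp add: halts_def outcome_def)

section \<open>Closure properties of polynomially bounded functions\<close>

lemma polynomially_bounded_const: "polynomially_bounded (\<lambda>_. c)"
  unfolding polynomially_bounded_def by (rule exI[of _ "[:c:]"]) simp

lemma polynomially_bounded_ident: "polynomially_bounded (\<lambda>l. l)"
  unfolding polynomially_bounded_def by (rule exI[of _ "[:0, 1:]"]) simp

lemma polynomially_bounded_add:
  "polynomially_bounded f \<Longrightarrow> polynomially_bounded g \<Longrightarrow> polynomially_bounded (\<lambda>l. f l + g l)"
  unfolding polynomially_bounded_def by (metis add_mono poly_add)

lemma polynomially_bounded_mult:
  "polynomially_bounded f \<Longrightarrow> polynomially_bounded g \<Longrightarrow> polynomially_bounded (\<lambda>l. f l * g l)"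
  unfolding polynomially_bounded_def by (metis mult_le_mono poly_mult)

lemma polynomially_bounded_mono:
  "polynomially_bounded g \<Longrightarrow> (\<And>l. f l \<le> g l) \<Longrightarrow> polynomially_bounded f"
  unfolding polynomially_bounded_def by (meson le_trans)

lemmas polynomially_bounded_intros =
  polynomially_bounded_const polynomially_bounded_ident polynomially_bounded_add polynomially_bounded_mult

section \<open>Polynomial-time computations\<close>

text \<open>The oracle string is a parameter of \<open>F\<close>, instead of \<open>F\<close>
  producing a tree of questions as in \<open>ppt_oracle\<close>, because distributions in this form
  compose with \<open>wbind\<close>.\<close>

definition efficient ::
  "(nat \<Rightarrow> ('i :: repr) set) \<Rightarrow> (bool list \<Rightarrow> nat \<Rightarrow> 'i \<Rightarrow> (('o :: repr) \<times> nat list) pmf) \<Rightarrow> bool" where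
  "efficient D F \<longleftrightarrow> (\<exists>p T. polynomially_bounded T \<and> (\<forall>l. \<forall>i \<in> D l. \<forall>y.
     halts (exec y p (repr (l, i))) (T l) (map_pmf (\<lambda>(v, qs). (repr v, qs)) (F y l i))))"

definition pt :: "(nat \<Rightarrow> ('i :: repr) set) \<Rightarrow> (nat \<Rightarrow> 'i \<Rightarrow> ('o :: repr)) \<Rightarrow> bool" where
  "pt D f \<longleftrightarrow> efficient D (\<lambda>y l i. wreturn (f l i))"

text \<open>The number of iterations of a loop and the size of unary numbers must be bounded in
  \<open>l\<close> alone, uniformly over the inputs of the domain.\<close>

definition bounded_on :: "(nat \<Rightarrow> 'i set) \<Rightarrow> (nat \<Rightarrow> 'i \<Rightarrow> nat) \<Rightarrow> bool" where
  "bounded_on D f \<longleftrightarrow> (\<exists>N. polynomially_bounded N \<and> (\<forall>l. \<forall>i \<in> D l. f l i \<le> N l))"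

lemma bounded_onI: "polynomially_bounded N \<Longrightarrow> (\<And>l i. i \<in> D l \<Longrightarrow> f l i \<le> N l) \<Longrightarrow> bounded_on D f"
  unfolding bounded_on_def by blast

lemma bounded_on_param: "polynomially_bounded f \<Longrightarrow> bounded_on D (\<lambda>l i. f l)"
  by (erule bounded_onI) simp

lemma efficientI:
  assumes "polynomially_bounded T"
    and "\<And>l i y. i \<in> D l \<Longrightarrow>
      halts (exec y p (repr (l, i))) (T l) (map_pmf (\<lambda>(v, qs). (repr v, qs)) (F y l i))"
  shows "efficient D F"
  unfolding efficient_def using assms by blast

lemma efficientE:
  assumes "efficient D F"
  obtains p T where "polynomially_bounded T"
    "\<And>l i y. i \<in> D l \<Longrightarrow>
      halts (exec y p (repr (l, i))) (T l) (map_pmf (\<lambda>(v, qs). (repr v, qs)) (F y l i))"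
  using assms unfolding efficient_def by blast

lemma ptE:
  assumes "pt D f"
  obtains p T where "polynomially_bounded T"
    "\<And>l i y. i \<in> D l \<Longrightarrow> halts (exec y p (repr (l, i))) (T l) (wreturn (repr (f l i)))"
  using assms unfolding pt_def by (rule efficientE) (auto simp: wreturn_def)

lemma ptI:
  assumes "polynomially_bounded T"
    and "\<And>l i y. i \<in> D l \<Longrightarrow> halts (exec y p (repr (l, i))) (T l) (wreturn (repr (f l i)))"
  shows "pt D f"
  unfolding pt_def using assms by (intro efficientI[of T _ p]) (auto simp: wreturn_def)

lemma efficient_cong:
  assumes "efficient D F" "\<And>y l i. i \<in> D l \<Longrightarrow> F y l i = G y l i"
  shows "efficient D G"
  using assms(1) by (rule efficientE) (rule efficientI, simp_all flip: assms(2))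

lemma pt_cong: "pt D f \<Longrightarrow> (\<And>l i. i \<in> D l \<Longrightarrow> f l i = g l i) \<Longrightarrow> pt D g"
  unfolding pt_def by (erule efficient_cong) simp

text \<open>Resilience extends the single time bound of \<open>outcome\<close> to all larger ones;
  conversely \<open>halts\<close> is instantiated at its own bound.\<close>

lemma efficient_iff_ppt_oracle:
  "ppt_oracle D F \<longleftrightarrow> efficient D (\<lambda>y l i. map_pmf (run_alg y) (F l i))"
proof -
  have "outcome y p v c = map_pmf (\<lambda>g. case run_alg y g of (v, qs) \<Rightarrow> Some (repr v, qs)) M \<longleftrightarrow>
      halts (exec y p v) c (map_pmf (\<lambda>(v, qs). (repr v, qs)) (map_pmf (run_alg y) M))"
    for y p v c and M :: "'b oracle_alg pmf"
  proof -
    have eq: "map_pmf (\<lambda>g. case run_alg y g of (v, qs) \<Rightarrow> Some (repr v, qs)) M =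
        map_pmf Some (map_pmf (\<lambda>(v, qs). (repr v, qs)) (map_pmf (run_alg y) M))"
      by (simp add: pmf.map_comp o_def case_prod_unfold)
    show ?thesis unfolding eq by (auto intro: halts_exec_if_outcome outcome_if_halts_exec)
  qed
  then show ?thesis unfolding ppt_oracle_def efficient_def by auto
qed

lemma ppt_iff_efficient: "ppt D F \<longleftrightarrow> efficient D (\<lambda>y l i. map_pmf (\<lambda>v. (v, [])) (F l i))"
  by (simp add: ppt_def efficient_iff_ppt_oracle pmf.map_comp o_def)

lemma poly_time_iff_pt: "poly_time D f \<longleftrightarrow> pt D f"
  by (simp add: poly_time_def ppt_iff_efficient pt_def wreturn_def)

subsection \<open>Straight-line programs\<close>

text \<open>Programs that only rearrange trees: their cost is constant and their result
  deterministic, so claims about them are settled by evaluating \<open>sl_result\<close>.\<close>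

primrec straight :: "prog \<Rightarrow> bool" where
  "straight Ident = True"
| "straight Const_Atom = True"
| "straight (Make p q) = (straight p \<and> straight q)"
| "straight Left = True"
| "straight Right = True"
| "straight (Then p q) = (straight p \<and> straight q)"
| "straight (Cond p q r) = False"
| "straight (Loop p) = False"
| "straight Rand = False"
| "straight Query = False"

text \<open>The last four equations are default values outside the straight-line programs.\<close>

primrec sl_result :: "prog \<Rightarrow> data \<Rightarrow> data" where
  "sl_result Ident v = v"
| "sl_result Const_Atom v = Atom"
| "sl_result (Make p q) v = Cell (sl_result p v) (sl_result q v)"
| "sl_result Left v = left v"
| "sl_result Right v = right v"
| "sl_result (Then p q) v = sl_result q (sl_result p v)"
| "sl_result (Cond p q r) v = Atom"
| "sl_result (Loop p) v = Atom"
| "sl_result Rand v = Atom"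
| "sl_result Query v = Atom"

text \<open>The exact running time of a straight-line program: every node of its syntax tree takes
  one step, \<open>size\<close> counts the inner nodes, and a binary tree has one more leaf than
  inner nodes.\<close>

definition sl_cost :: "prog \<Rightarrow> nat" where
  "sl_cost p = 2 * size p + 1"

lemma halts_Make:
  assumes "halts (exec y p v) c M" "halts (exec y q v) d N"
  shows "halts (exec y (Make p q) v) (1 + (c + d)) (wbind M (\<lambda>u. wbind N (\<lambda>w. wreturn (Cell u w))))"
proof -
  have "halts (comp_bind (exec y q v) (\<lambda>w. comp_return (Cell u w))) (d + 0)
      (wbind N (\<lambda>w. wreturn (Cell u w)))" for u
    by (rule halts_bind[OF assms(2) halts_return])
  then show ?thesis by (simp add: halts_tick[of _ _ _ 1, simplified] halts_bind[OF assms(1)])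
qed

lemma halts_Then:
  assumes "halts (exec y p v) c M" "\<And>u qs. (u, qs) \<in> set_pmf M \<Longrightarrow> halts (exec y q u) d (K u)"
  shows "halts (exec y (Then p q) v) (1 + (c + d)) (wbind M K)"
  by (simp add: halts_tick[of _ _ _ 1, simplified] halts_bind assms)

lemma halts_Then_det:
  assumes "halts (exec y p v) c (wreturn u)" "halts (exec y q u) d M"
  shows "halts (exec y (Then p q) v) (1 + (c + d)) M"
  using halts_Then[OF assms(1), of q d "\<lambda>_. M"] assms(2) by simp

lemma halts_Make_det:
  assumes "halts (exec y p v) c (wreturn u)" "halts (exec y q v) d (wreturn w)"
  shows "halts (exec y (Make p q) v) (1 + (c + d)) (wreturn (Cell u w))"
  using halts_Make[OF assms] by simp

lemma halts_straight: "straight p \<Longrightarrow> halts (exec y p v) (sl_cost p) (wreturn (sl_result p v))"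
proof (induction p arbitrary: v)
  case (Make p q)
  have "halts (exec y (Make p q) v) (1 + (sl_cost p + (sl_cost q)))
      (wreturn (sl_result (Make p q) v))"
    using Make by (simp only: sl_result.simps) (intro halts_Make_det, auto)
  then show ?case by (rule halts_mono) (simp add: sl_cost_def)
next
  case (Then p q)
  have "halts (exec y (Then p q) v) (1 + (sl_cost p + (sl_cost q)))
      (wreturn (sl_result (Then p q) v))"
    using Then by (simp only: sl_result.simps) (intro halts_Then_det, auto)
  then show ?case by (rule halts_mono) (simp add: sl_cost_def)
qed (use halts_tick[OF halts_return, of 1 "_ :: data"] in \<open>auto simp: sl_cost_def\<close>)

subsection \<open>Sequential composition\<close>

text \<open>The second program is known to behave only on \<open>E\<close>, hence the condition on
  \<open>f\<close>. \<open>Make Left p\<close> hands the security parameter on to it.\<close>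

lemma efficient_comp:
  assumes "pt D f" "efficient E G" "\<And>l i. i \<in> D l \<Longrightarrow> f l i \<in> E l"
  shows "efficient D (\<lambda>y l i. G y l (f l i))"
proof -
  obtain p S where S: "polynomially_bounded S" and p: "\<And>l i y. i \<in> D l \<Longrightarrow>
      halts (exec y p (repr (l, i))) (S l) (wreturn (repr (f l i)))"
    using assms(1) by (rule ptE) (blast intro: that)
  obtain q T where T: "polynomially_bounded T" and q: "\<And>l i y. i \<in> E l \<Longrightarrow>
      halts (exec y q (repr (l, i))) (T l) (map_pmf (\<lambda>(v, qs). (repr v, qs)) (G y l i))"
    using assms(2) by (rule efficientE) (blast intro: that)
  show ?thesis
  proof (rule efficientI[of "\<lambda>l. 1 + ((1 + (1 + S l)) + T l)" _ "Then (Make Left p) q"])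
    fix l i y assume i: "i \<in> D l"
    have "halts (exec y Left (repr (l, i))) 1 (wreturn (repr l))"
      using halts_straight[of Left y "repr (l, i)"] by (simp add: repr_prod_def sl_cost_def)
    from halts_Make_det[OF this p[OF i]]
    have "halts (exec y (Make Left p) (repr (l, i))) (1 + (1 + S l)) (wreturn (repr (l, f l i)))"
      by (simp add: repr_prod_def)
    then show "halts (exec y (Then (Make Left p) q) (repr (l, i))) (1 + ((1 + (1 + S l)) + T l))
        (map_pmf (\<lambda>(v, qs). (repr v, qs)) (G y l (f l i)))"
      by (rule halts_Then_det) (rule q, rule assms(3)[OF i])
  qed (intro polynomially_bounded_intros S T)
qed

lemma efficient_bind:
  assumes "efficient D F" "efficient E G"
    and "\<And>y l i v qs. i \<in> D l \<Longrightarrow> (v, qs) \<in> set_pmf (F y l i) \<Longrightarrow> (i, v) \<in> E l"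
  shows "efficient D (\<lambda>y l i. wbind (F y l i) (\<lambda>v. G y l (i, v)))"
proof -
  obtain p S where S: "polynomially_bounded S" and p: "\<And>l i y. i \<in> D l \<Longrightarrow>
      halts (exec y p (repr (l, i))) (S l) (map_pmf (\<lambda>(v, qs). (repr v, qs)) (F y l i))"
    using assms(1) by (rule efficientE) (blast intro: that)
  obtain q T where T: "polynomially_bounded T" and q: "\<And>l i y. i \<in> E l \<Longrightarrow>
      halts (exec y q (repr (l, i))) (T l) (map_pmf (\<lambda>(v, qs). (repr v, qs)) (G y l i))"
    using assms(2) by (rule efficientE) (blast intro: that)
  \<comment> \<open>On representations this rearranges \<open>((l, i), v)\<close> into
    \<open>(l, (i, v))\<close>.\<close>
  let ?arr = "Make (Then Left Left) (Make (Then Left Right) Right)"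
  let ?c = "sl_cost ?arr"
  show ?thesis
  proof (rule efficientI[of "\<lambda>l. 1 + ((1 + (1 + S l)) + (1 + (?c + T l)))" _
        "Then (Make Ident p) (Then ?arr q)"])
    fix l i y assume i: "i \<in> D l"
    let ?r = "\<lambda>(v, qs). (repr v, qs)"
    have "halts (exec y Ident (repr (l, i))) 1 (wreturn (repr (l, i)))"
      using halts_straight[of Ident y "repr (l, i)"] by (simp add: sl_cost_def)
    from halts_Make[OF this p[OF i]]
    have 1: "halts (exec y (Make Ident p) (repr (l, i))) (1 + (1 + S l))
        (map_pmf (\<lambda>(v, qs). (repr ((l, i), v), qs)) (F y l i))"
      by (simp add: wbind_wreturn_right pmf.map_comp o_def case_prod_unfold repr_prod_def)
    have 2: "halts (exec y (Then ?arr q) (repr ((l, i), v))) (1 + (?c + T l))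
        (map_pmf ?r (G y l (i, v)))" if "(v, qs) \<in> set_pmf (F y l i)" for v qs
    proof -
      have "halts (exec y ?arr (repr ((l, i), v))) ?c (wreturn (repr (l, (i, v))))"
        using halts_straight[of ?arr y "repr ((l, i), v)"] by (simp add: repr_prod_def)
      then show ?thesis by (rule halts_Then_det) (rule q, rule assms(3)[OF i that])
    qed
    \<comment> \<open>The second program runs on trees; since \<open>repr\<close> is injective, the value can be read off.\<close>
    define K where "K = (\<lambda>u. map_pmf ?r (G y l (i, THE v. u = repr ((l, i), v))))"
    have K: "K (repr ((l, i), v)) = map_pmf ?r (G y l (i, v))" for v
    proof -
      have "(THE v'. repr ((l, i), v) = repr ((l, i), v')) = v"
        by (rule the_equality) (auto dest: repr_inject)
      then show ?thesis by (simp add: K_def)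
    qed
    have "halts (exec y (Then (Make Ident p) (Then ?arr q)) (repr (l, i)))
        (1 + ((1 + (1 + S l)) + (1 + (?c + T l))))
        (wbind (map_pmf (\<lambda>(v, qs). (repr ((l, i), v), qs)) (F y l i)) K)"
    proof (rule halts_Then[OF 1])
      fix u qs
      assume "(u, qs) \<in> set_pmf (map_pmf (\<lambda>(v, qs). (repr ((l, i), v), qs)) (F y l i))"
      then obtain v where v: "(v, qs) \<in> set_pmf (F y l i)" "u = repr ((l, i), v)" by auto
      show "halts (exec y (Then ?arr q) u) (1 + (?c + T l)) (K u)"
        unfolding v(2) K by (rule 2[OF v(1)])
    qed
    also have "wbind (map_pmf (\<lambda>(v, qs). (repr ((l, i), v), qs)) (F y l i)) K =
        map_pmf ?r (wbind (F y l i) (\<lambda>v. G y l (i, v)))"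
      by (simp add: wbind_map_pmf K map_pmf_wbind)
    finally show "halts (exec y (Then (Make Ident p) (Then ?arr q)) (repr (l, i)))
        (1 + ((1 + (1 + S l)) + (1 + (?c + T l))))
        (map_pmf ?r (wbind (F y l i) (\<lambda>v. G y l (i, v))))" .
  qed (intro polynomially_bounded_intros S T)
qed

lemma efficient_map:
  assumes "efficient D F" "pt E g"
    and "\<And>y l i v qs. i \<in> D l \<Longrightarrow> (v, qs) \<in> set_pmf (F y l i) \<Longrightarrow> (i, v) \<in> E l"
  shows "efficient D (\<lambda>y l i. map_pmf (\<lambda>(v, qs). (g l (i, v), qs)) (F y l i))"
  using efficient_bind[OF assms(1) assms(2)[unfolded pt_def] assms(3)]
  by (simp add: wbind_wreturn_right)

lemma pt_comp:
  assumes "pt D f" "pt E g" "\<And>l i. i \<in> D l \<Longrightarrow> f l i \<in> E l"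
  shows "pt D (\<lambda>l i. g l (f l i))"
  using efficient_comp[OF assms(1) assms(2)[unfolded pt_def] assms(3)] by (simp add: pt_def)

text \<open>The source of programs for typed operations: it suffices that the operation is a fixed
  rearrangement of the representing trees.\<close>

lemma pt_straight:
  assumes "pt D f" "straight q" "\<And>l i. i \<in> D l \<Longrightarrow> sl_result q (repr (f l i)) = repr (g l i)"
  shows "pt D g"
proof -
  obtain p S where S: "polynomially_bounded S" and p: "\<And>l i y. i \<in> D l \<Longrightarrow>
      halts (exec y p (repr (l, i))) (S l) (wreturn (repr (f l i)))"
    using assms(1) by (rule ptE) (blast intro: that)
  have "halts (exec y (Then p q) (repr (l, i))) (1 + (S l + (sl_cost q))) (wreturn (repr (g l i)))"
    if "i \<in> D l" for l i y
    using halts_Then_det[OF p[OF that] halts_straight[OF assms(2)]] assms(3)[OF that] by simp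
  then show ?thesis by (rule ptI[rotated]) (assumption | intro polynomially_bounded_intros S)+
qed

lemma pt_straight_input:
  assumes "straight q" "\<And>l i. i \<in> D l \<Longrightarrow> sl_result q (repr (l, i)) = repr (g l i)"
  shows "pt D g"
proof (rule ptI)
  show "halts (exec y q (repr (l, i))) (sl_cost q) (wreturn (repr (g l i)))" if "i \<in> D l" for l i y
    using halts_straight[OF assms(1)] assms(2)[OF that] by metis
qed (rule polynomially_bounded_const)

lemma pt_input: "pt D (\<lambda>l i. i)"
  by (rule pt_straight_input[of Right]) (simp_all add: repr_prod_def)

text \<open>Every tree is built by a straight-line program, whose cost is constant because
  \<open>c\<close> does not depend on \<open>l\<close>.\<close>

lemma pt_const: "pt D (\<lambda>l i. c)"
proof -
  have "\<exists>q. straight q \<and> (\<forall>v. sl_result q v = d)" for d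
  proof (induction d)
    case Atom
    show ?case by (rule exI[of _ Const_Atom]) simp
  next
    case (Cell d e)
    then obtain q r where "straight q" "\<forall>v. sl_result q v = d" "straight r" "\<forall>v. sl_result r v = e"
      by blast
    then show ?case by (intro exI[of _ "Make q r"]) simp
  qed
  then obtain q where "straight q" "\<forall>v. sl_result q v = repr c" by blast
  then show ?thesis by (intro pt_straight_input[of q]) auto
qed

lemma pt_pair:
  assumes "pt D f" "pt D g"
  shows "pt D (\<lambda>l i. (f l i, g l i))"
proof -
  obtain p S where S: "polynomially_bounded S" and p: "\<And>l i y. i \<in> D l \<Longrightarrow>
      halts (exec y p (repr (l, i))) (S l) (wreturn (repr (f l i)))"
    using assms(1) by (rule ptE) (blast intro: that)
  obtain q T where T: "polynomially_bounded T" and q: "\<And>l i y. i \<in> D l \<Longrightarrow>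
      halts (exec y q (repr (l, i))) (T l) (wreturn (repr (g l i)))"
    using assms(2) by (rule ptE) (blast intro: that)
  have "halts (exec y (Make p q) (repr (l, i))) (1 + (S l + T l)) (wreturn (repr (f l i, g l i)))"
    if "i \<in> D l" for l i y
    using halts_Make_det[OF p[OF that] q[OF that]] by (simp add: repr_prod_def)
  then show ?thesis by (rule ptI[rotated]) (assumption | intro polynomially_bounded_intros S T)+
qed

text \<open>Values of different types may share a tree: a nonempty list and the pair of its head and
  tail, or a number and a list of units.\<close>

lemma pt_repr_eq:
  assumes "pt D f" "\<And>l i. i \<in> D l \<Longrightarrow> repr (f l i) = repr (g l i)"
  shows "pt D g"
  using assms(2) by (intro pt_straight[OF assms(1), of Ident]) simp_all

lemma pt_fst: "pt D f \<Longrightarrow> pt D (\<lambda>l i. fst (f l i))"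
  by (erule pt_straight[of _ _ Left]) (simp_all add: repr_prod_def)

lemma pt_snd: "pt D f \<Longrightarrow> pt D (\<lambda>l i. snd (f l i))"
  by (erule pt_straight[of _ _ Right]) (simp_all add: repr_prod_def)

lemma pt_Cons: "pt D f \<Longrightarrow> pt D g \<Longrightarrow> pt D (\<lambda>l i. f l i # g l i)"
  using pt_repr_eq[OF pt_pair, of D f g "\<lambda>l i. f l i # g l i"] by (simp add: repr_prod_def)

lemma pt_hd:
  assumes "pt D f" "\<And>l i. i \<in> D l \<Longrightarrow> f l i \<noteq> []"
  shows "pt D (\<lambda>l i. hd (f l i))"
proof (rule pt_straight[OF assms(1), of Left])
  fix l i assume "i \<in> D l"
  from assms(2)[OF this] show "sl_result Left (repr (f l i)) = repr (hd (f l i))"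
    by (cases "f l i") simp_all
qed simp

lemma pt_tl:
  assumes "pt D f" shows "pt D (\<lambda>l i. tl (f l i))"
proof (rule pt_straight[OF assms, of Right])
  fix l i show "sl_result Right (repr (f l i)) = repr (tl (f l i))" by (cases "f l i") simp_all
qed simp

lemma pt_Suc: "pt D f \<Longrightarrow> pt D (\<lambda>l i. Suc (f l i))"
  by (erule pt_straight[of _ _ "Make Const_Atom Ident"]) simp_all

lemma pt_pred:
  fixes f :: "nat \<Rightarrow> 'i :: repr \<Rightarrow> nat"
  assumes "pt D f" shows "pt D (\<lambda>l i. f l i - 1)"
proof (rule pt_straight[OF assms, of Right])
  fix l i show "sl_result Right (repr (f l i)) = repr (f l i - 1)" by (cases "f l i") simp_all
qed simp

text \<open>Each branch has to be efficient only where it is taken, so a test can guard a partial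
  operation such as \<open>hd\<close>.\<close>

lemma efficient_if:
  assumes "pt D b" "efficient (\<lambda>l. {i \<in> D l. b l i}) F" "efficient (\<lambda>l. {i \<in> D l. \<not> b l i}) G"
  shows "efficient D (\<lambda>y l i. if b l i then F y l i else G y l i)"
proof -
  let ?r = "\<lambda>(v, qs). (repr v, qs)"
  obtain p S where S: "polynomially_bounded S" and p: "\<And>l i y. i \<in> D l \<Longrightarrow>
      halts (exec y p (repr (l, i))) (S l) (wreturn (repr (b l i)))"
    using assms(1) by (rule ptE) (blast intro: that)
  obtain q T where T: "polynomially_bounded T" and q: "\<And>l i y. i \<in> {i \<in> D l. b l i} \<Longrightarrow>
      halts (exec y q (repr (l, i))) (T l) (map_pmf ?r (F y l i))"
    using assms(2) by (rule efficientE) (blast intro: that)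
  obtain q' T' where T': "polynomially_bounded T'" and q': "\<And>l i y. i \<in> {i \<in> D l. \<not> b l i} \<Longrightarrow>
      halts (exec y q' (repr (l, i))) (T' l) (map_pmf ?r (G y l i))"
    using assms(3) by (rule efficientE) (blast intro: that)
  show ?thesis
  proof (rule efficientI[of "\<lambda>l. 1 + (S l + (T l + T' l))" _ "Cond p q q'"])
    fix l i y assume i: "i \<in> D l"
    let ?M = "map_pmf ?r (if b l i then F y l i else G y l i)"
    let ?f = "\<lambda>u. if u \<noteq> Atom then exec y q (repr (l, i)) else exec y q' (repr (l, i))"
    have "halts (?f (repr (b l i))) (T l + T' l) ?M"
      using i by (auto simp: repr_bool_def intro: halts_mono[OF q] halts_mono[OF q'])
    then have "halts (comp_bind (exec y p (repr (l, i))) ?f) (S l + (T l + T' l))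
        (wbind (wreturn (repr (b l i))) (\<lambda>_. ?M))"
      by (intro halts_bind[OF p[OF i]]) auto
    then show "halts (exec y (Cond p q q') (repr (l, i))) (1 + (S l + (T l + T' l))) ?M"
      by (simp add: halts_tick[of _ _ _ 1, simplified])
  qed (intro polynomially_bounded_intros S T T')
qed

lemma pt_if:
  assumes "pt D b" "pt (\<lambda>l. {i \<in> D l. b l i}) f" "pt (\<lambda>l. {i \<in> D l. \<not> b l i}) g"
  shows "pt D (\<lambda>l i. if b l i then f l i else g l i)"
  using efficient_if[OF assms(1) assms(2,3)[unfolded pt_def]] unfolding pt_def
  by (rule efficient_cong) simp

text \<open>The machine only distinguishes \<open>Atom\<close> from cells; the conditional turns any
  cell into the representation of \<open>True\<close>.\<close>

lemma pt_test:
  assumes "pt D f" "\<And>l i. i \<in> D l \<Longrightarrow> b l i \<longleftrightarrow> repr (f l i) \<noteq> Atom"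
  shows "pt D b"
proof -
  obtain p S where S: "polynomially_bounded S" and p: "\<And>l i y. i \<in> D l \<Longrightarrow>
      halts (exec y p (repr (l, i))) (S l) (wreturn (repr (f l i)))"
    using assms(1) by (rule ptE) (blast intro: that)
  let ?q = "Make Const_Atom Const_Atom"
  let ?c = "sl_cost ?q + sl_cost Const_Atom"
  show ?thesis
  proof (rule ptI[of "\<lambda>l. 1 + (S l + ?c)" _ "Cond p ?q Const_Atom"])
    fix l i y assume i: "i \<in> D l"
    let ?f = "\<lambda>u. if u \<noteq> Atom then exec y ?q (repr (l, i)) else exec y Const_Atom (repr (l, i))"
    have "halts (?f (repr (f l i))) ?c (wreturn (repr (b l i)))"
      using assms(2)[OF i] halts_straight[of ?q y "repr (l, i)"]
        halts_straight[of Const_Atom y "repr (l, i)"]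
      by (auto simp: repr_bool_def simp del: exec.simps elim: halts_mono)
    then have "halts (comp_bind (exec y p (repr (l, i))) ?f) (S l + ?c)
        (wbind (wreturn (repr (f l i))) (\<lambda>_. wreturn (repr (b l i))))"
      by (intro halts_bind[OF p[OF i]]) auto
    then show "halts (exec y (Cond p ?q Const_Atom) (repr (l, i))) (1 + (S l + ?c))
        (wreturn (repr (b l i)))"
      by (subst exec.simps(7)) (simp only: wbind_wreturn halts_tick)
  qed (intro polynomially_bounded_intros S)
qed

lemma pt_nonempty: "pt D f \<Longrightarrow> pt D (\<lambda>l i. f l i \<noteq> [])"
proof (erule pt_test)
  fix l i show "(f l i \<noteq> []) = (repr (f l i) \<noteq> Atom)" by (cases "f l i") simp_all
qed

lemma pt_pos:
  fixes f :: "nat \<Rightarrow> 'i :: repr \<Rightarrow> nat"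
  assumes "pt D f" shows "pt D (\<lambda>l i. f l i > 0)"
proof (rule pt_test[OF assms])
  fix l i show "(0 < f l i) = (repr (f l i) \<noteq> Atom)" by (cases "f l i") simp_all
qed

lemma spine_repr_nat: "spine (repr (n :: nat)) = n"
  by (induction n) simp_all

text \<open>\<open>Rand\<close> pays for the unary size of its argument, hence the bound on
  \<open>n\<close>. The value 0 for an empty range is the default of
  \<open>comp_rand\<close>.\<close>

lemma efficient_rand:
  assumes "pt D n" "bounded_on D n"
  shows "efficient D (\<lambda>y l i. map_pmf (\<lambda>k. (k, []))
    (if n l i = 0 then return_pmf 0 else pmf_of_set {..<n l i}))"
proof -
  obtain p S where S: "polynomially_bounded S" and p: "\<And>l i y. i \<in> D l \<Longrightarrow>
      halts (exec y p (repr (l, i))) (S l) (wreturn (repr (n l i)))"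
    using assms(1) by (rule ptE) (blast intro: that)
  obtain N where N: "polynomially_bounded N" "\<And>l i. i \<in> D l \<Longrightarrow> n l i \<le> N l"
    using assms(2) unfolding bounded_on_def by blast
  show ?thesis
  proof (rule efficientI[of "\<lambda>l. 1 + (S l + (1 + N l))" _ "Then p Rand"])
    fix l i y assume i: "i \<in> D l"
    let ?M = "if n l i = 0 then return_pmf 0 else pmf_of_set {..<n l i}"
    have "halts (comp_rand (n l i)) 0 (map_pmf (\<lambda>k. (k, [])) ?M)"
      by (auto simp: halts_def comp_rand_def pmf.map_comp o_def)
    from halts_bind[OF this halts_return]
    have "halts (comp_bind (comp_rand (n l i)) (\<lambda>i. comp_return (repr i))) (0 + 0)
      (wbind (map_pmf (\<lambda>k. (k, [])) ?M) (\<lambda>i. wreturn (repr i)))" .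
    from halts_tick[OF this, of "Suc (n l i)"]
    have "halts (exec y Rand (repr (n l i))) (Suc (n l i) + (0 + 0))
      (map_pmf (\<lambda>k. (repr k, [])) ?M)"
      by (simp add: spine_repr_nat wbind_wreturn_right pmf.map_comp o_def)
    then have "halts (exec y Rand (repr (n l i))) (1 + N l) (map_pmf (\<lambda>k. (repr k, [])) ?M)"
      by (rule halts_mono) (use N(2)[OF i] in simp)
    from halts_Then_det[OF p[OF i] this]
    show "halts (exec y (Then p Rand) (repr (l, i))) (1 + (S l + (1 + N l)))
      (map_pmf (\<lambda>(v, qs). (repr v, qs)) (map_pmf (\<lambda>k. (k, [])) ?M))"
      by (simp only: pmf.map_comp o_def prod.case)
  qed (intro polynomially_bounded_intros S N)
qed

lemma efficient_query:
  assumes "pt D n" "bounded_on D n"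
  shows "efficient D (\<lambda>y l i. return_pmf (n l i < length y \<and> y ! n l i, [n l i]))"
proof -
  obtain p S where S: "polynomially_bounded S" and p: "\<And>l i y. i \<in> D l \<Longrightarrow>
      halts (exec y p (repr (l, i))) (S l) (wreturn (repr (n l i)))"
    using assms(1) by (rule ptE) (blast intro: that)
  obtain N where N: "polynomially_bounded N" "\<And>l i. i \<in> D l \<Longrightarrow> n l i \<le> N l"
    using assms(2) unfolding bounded_on_def by blast
  show ?thesis
  proof (rule efficientI[of "\<lambda>l. 1 + (S l + (1 + N l))" _ "Then p Query"])
    fix l i y assume i: "i \<in> D l"
    let ?b = "n l i < length y \<and> y ! n l i"
    have "halts (comp_query y (n l i)) 0 (return_pmf (?b, [n l i]))"
      by (auto simp: halts_def comp_query_def)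
    from halts_bind[OF this halts_return]
    have "halts (comp_bind (comp_query y (n l i)) (\<lambda>i. comp_return (repr i))) (0 + 0)
      (wbind (return_pmf (?b, [n l i])) (\<lambda>i. wreturn (repr i)))" .
    from halts_tick[OF this, of "Suc (n l i)"]
    have "halts (exec y Query (repr (n l i))) (Suc (n l i) + (0 + 0))
      (return_pmf (repr ?b, [n l i]))"
      by (simp add: spine_repr_nat wbind_wreturn_right)
    then have "halts (exec y Query (repr (n l i))) (1 + N l) (return_pmf (repr ?b, [n l i]))"
      by (rule halts_mono) (use N(2)[OF i] in simp)
    from halts_Then_det[OF p[OF i] this]
    show "halts (exec y (Then p Query) (repr (l, i))) (1 + (S l + (1 + N l)))
      (map_pmf (\<lambda>(v, qs). (repr v, qs)) (return_pmf (?b, [n l i])))"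
      by simp
  qed (intro polynomially_bounded_intros S N)
qed

subsection \<open>Iteration\<close>

text \<open>Every later iteration is an instance of this use of \<open>Loop\<close>.
  \<open>Inv\<close> is a loop invariant that may refer to the elements still to come; it keeps the
  arguments of \<open>step\<close> inside \<open>E\<close>, where its program is correct and
  fast.\<close>

lemma efficient_fold:
  fixes xs :: "nat \<Rightarrow> 'i :: repr \<Rightarrow> 'x :: repr list" and s0 :: "nat \<Rightarrow> 'i \<Rightarrow> 's :: repr"
  assumes "pt D xs" "pt D s0" "bounded_on D (\<lambda>l i. length (xs l i))" "efficient E step"
    and init: "\<And>l i. i \<in> D l \<Longrightarrow> Inv l i (xs l i) (s0 l i)"
    and dom: "\<And>l i x xs' s. i \<in> D l \<Longrightarrow> Inv l i (x # xs') s \<Longrightarrow> ((i, x), s) \<in> E l"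
    and inv: "\<And>y l i x xs' s s' qs. i \<in> D l \<Longrightarrow> Inv l i (x # xs') s \<Longrightarrow>
      (s', qs) \<in> set_pmf (step y l ((i, x), s)) \<Longrightarrow> Inv l i xs' s'"
  shows "efficient D (\<lambda>y l i. wfold (\<lambda>x s. step y l ((i, x), s)) (xs l i) (s0 l i))"
proof -
  let ?r = "\<lambda>(v, qs). (repr v, qs)"
  obtain p S where S: "polynomially_bounded S" and p: "\<And>l i y. i \<in> D l \<Longrightarrow>
      halts (exec y p (repr (l, i))) (S l) (wreturn (repr (xs l i)))"
    using assms(1) by (rule ptE) (blast intro: that)
  obtain q T where T: "polynomially_bounded T" and q: "\<And>l i y. i \<in> D l \<Longrightarrow>
      halts (exec y q (repr (l, i))) (T l) (wreturn (repr (s0 l i)))"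
    using assms(2) by (rule ptE) (blast intro: that)
  obtain N where N: "polynomially_bounded N" "\<And>l i. i \<in> D l \<Longrightarrow> length (xs l i) \<le> N l"
    using assms(3) unfolding bounded_on_def by blast
  obtain b U where U: "polynomially_bounded U" and b: "\<And>l i y. i \<in> E l \<Longrightarrow>
      halts (exec y b (repr (l, i))) (U l) (map_pmf ?r (step y l i))"
    using assms(4) by (rule efficientE) (blast intro: that)
  \<comment> \<open>The remaining list is the left component, which the loop tests against
    \<open>Atom\<close>; the input is carried along for use in \<open>step\<close>.\<close>
  define st where "st l i (xs :: 'x list) (s :: 's) = Cell (repr xs) (Cell (repr (l, i)) (repr s))"
    for l :: nat and i :: 'i and xs s
  \<comment> \<open>Extracts \<open>(l, ((i, x), s))\<close>, the input of the program for
    \<open>step\<close>, from the loop state.\<close>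
  define arr where "arr = Make (Then Right (Then Left Left))
    (Make (Make (Then Right (Then Left Right)) (Then Left Left)) (Then Right Right))"
  define body where "body = Make (Then Left Right) (Make (Then Right Left) (Then arr b))"
  define c where "c = sl_cost arr + sl_cost (Then Left Right) + sl_cost (Then Right Left) + 3"
  have straight_arr: "straight arr" by (simp add: arr_def)
  have body: "halts (exec y body (st l i (x # xs') s)) (c + U l)
      (map_pmf (\<lambda>(s', qs). (st l i xs' s', qs)) (step y l ((i, x), s)))"
    if "((i, x), s) \<in> E l" for y l i x xs' s
  proof -
    let ?v = "st l i (x # xs') s"
    have "halts (exec y arr ?v) (sl_cost arr) (wreturn (repr (l, ((i, x), s))))"
      using halts_straight[OF straight_arr, of y ?v]
      by (simp add: st_def arr_def repr_prod_def)
    from halts_Then_det[OF this b[OF that]]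
    have "halts (exec y (Then arr b) ?v) (1 + (sl_cost arr + U l))
      (map_pmf ?r (step y l ((i, x), s)))" .
    note halts_Make[OF halts_straight[of "Then Left Right" y ?v]
        halts_Make[OF halts_straight[of "Then Right Left" y ?v] this]]
    then have "halts (exec y body ?v)
      (1 + (sl_cost (Then Left Right) + (1 + (sl_cost (Then Right Left) + (1 + (sl_cost arr + U l))))))
      (map_pmf (\<lambda>(s', qs). (st l i xs' s', qs)) (step y l ((i, x), s)))"
      by (simp add: body_def wbind_wreturn_right pmf.map_comp o_def case_prod_unfold st_def
          del: exec.simps)
    then show ?thesis by (rule halts_mono) (simp add: c_def)
  qed
  \<comment> \<open>The inequality is strict because the final test, on the empty list, is counted
    as well.\<close>
  have loop: "halts (comp_loop m (exec y body) (st l i xs' s)) (length xs' * (1 + (c + U l)))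
      (map_pmf (\<lambda>(s', qs). (st l i [] s', qs)) (wfold (\<lambda>x s. step y l ((i, x), s)) xs' s))"
    if "i \<in> D l" "Inv l i xs' s" "length xs' < m" for m y l i xs' s
    using that(2,3)
  proof (induction xs' arbitrary: s m)
    case Nil
    then obtain m' where "m = Suc m'" by (cases m) auto
    moreover have "left (st l i [] s) = Atom" by (simp add: st_def)
    ultimately show ?case using halts_return[of "st l i [] s"] by (simp add: wreturn_def)
  next
    case (Cons x xs')
    from Cons.prems obtain m' where m: "m = Suc m'" "length xs' < m'" by (cases m) auto
    have nA: "left (st l i (x # xs') s) \<noteq> Atom" by (simp add: st_def)
    let ?f = "\<lambda>x s. step y l ((i, x), s)"
    let ?s = "\<lambda>(s', qs). (st l i xs' s', qs)"
    \<comment> \<open>As in \<open>efficient_bind\<close>, the typed state is recovered from its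
      tree by injectivity.\<close>
    define K where "K = (\<lambda>u. map_pmf (\<lambda>(s', qs). (st l i [] s', qs))
      (wfold ?f xs' (THE s. u = st l i xs' s)))"
    have K: "K (st l i xs' s) = map_pmf (\<lambda>(s', qs). (st l i [] s', qs)) (wfold ?f xs' s)" for s
    proof -
      have "(THE s'. st l i xs' s = st l i xs' s') = s"
        by (rule the_equality) (auto simp: st_def dest: repr_inject)
      then show ?thesis by (simp add: K_def)
    qed
    have "halts (comp_bind (exec y body (st l i (x # xs') s)) (comp_loop m' (exec y body)))
      (c + U l + length xs' * (1 + (c + U l))) (wbind (map_pmf ?s (?f x s)) K)"
    proof (rule halts_bind[OF body[OF dom[OF that(1) Cons.prems(1)]]])
      fix u qs assume "(u, qs) \<in> set_pmf (map_pmf ?s (?f x s))"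
      then obtain s' where s': "(s', qs) \<in> set_pmf (?f x s)" "u = st l i xs' s'" by auto
      show "halts (comp_loop m' (exec y body) u) (length xs' * (1 + (c + U l))) (K u)"
        unfolding s'(2) K
        using Cons.IH[OF inv[OF that(1) Cons.prems(1) s'(1)] m(2)] .
    qed
    from halts_tick[OF this, of 1]
    show ?case
      using nA by (simp add: m(1) wbind_map_pmf K map_pmf_wbind algebra_simps)
  qed
  let ?prog = "Then (Make p (Make Ident q)) (Then (Loop body) (Then Right Right))"
  let ?T = "\<lambda>l. 1 + ((1 + (S l + (1 + (1 + T l)))) +
      (1 + ((1 + N l * (1 + (c + U l))) + (sl_cost (Then Right Right)))))"
  show ?thesis
  proof (rule efficientI[of ?T _ ?prog])
    fix l i y assume i: "i \<in> D l"
    let ?f = "\<lambda>x s. step y l ((i, x), s)"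
    have "halts (exec y Ident (repr (l, i))) 1 (wreturn (repr (l, i)))"
      using halts_straight[of Ident y "repr (l, i)"] by (simp add: sl_cost_def)
    from halts_Make_det[OF p[OF i] halts_Make_det[OF this q[OF i]]]
    have 1: "halts (exec y (Make p (Make Ident q)) (repr (l, i))) (1 + (S l + (1 + (1 + T l))))
        (wreturn (st l i (xs l i) (s0 l i)))"
      by (simp add: st_def del: exec.simps)
    have "halts (\<lambda>t. comp_loop (Suc t) (exec y body) (st l i (xs l i) (s0 l i)) t)
        (N l * (1 + (c + U l)))
        (map_pmf (\<lambda>(s', qs). (st l i [] s', qs)) (wfold ?f (xs l i) (s0 l i)))"
      unfolding halts_def
    proof (intro allI impI)
      fix t assume t: "N l * (1 + (c + U l)) \<le> t"
      \<comment> \<open>Each iteration is charged at least one step, so the available time exceeds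
        the length of the list, and the \<open>Suc t\<close> tests that \<open>exec\<close> allows
        suffice.\<close>
      have "length (xs l i) \<le> N l * 1" using N(2)[OF i] by simp
      also have "\<dots> \<le> N l * (1 + (c + U l))" by (rule mult_le_mono) simp_all
      finally have "length (xs l i) < Suc t" using t by linarith
      note halts_mono[OF loop[OF i init[OF i] this] mult_le_mono1[OF N(2)[OF i]]]
      then show "map_pmf (map_option (\<lambda>(v, qs, _). (v, qs)))
          (comp_loop (Suc t) (exec y body) (st l i (xs l i) (s0 l i)) t) =
        map_pmf Some (map_pmf (\<lambda>(s', qs). (st l i [] s', qs)) (wfold ?f (xs l i) (s0 l i))) \<and>
        (\<forall>res\<in>set_pmf (comp_loop (Suc t) (exec y body) (st l i (xs l i) (s0 l i)) t).
          \<forall>v qs t'. res = Some (v, qs, t') \<longrightarrow> t \<le> t' + N l * (1 + (c + U l)))"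
        using t unfolding halts_def by blast
    qed
    from halts_tick[OF this, of 1]
    have 2: "halts (exec y (Loop body) (st l i (xs l i) (s0 l i))) (1 + N l * (1 + (c + U l)))
        (map_pmf (\<lambda>(s', qs). (st l i [] s', qs)) (wfold ?f (xs l i) (s0 l i)))"
      by (simp only: exec.simps)
    have 3: "halts (exec y (Then (Loop body) (Then Right Right)) (st l i (xs l i) (s0 l i)))
        (1 + ((1 + N l * (1 + (c + U l))) + (sl_cost (Then Right Right))))
        (wbind (map_pmf (\<lambda>(s', qs). (st l i [] s', qs)) (wfold ?f (xs l i) (s0 l i)))
          (\<lambda>u. wreturn (sl_result (Then Right Right) u)))"
      by (rule halts_Then[OF 2 halts_straight]) simp
    have 4: "wbind (map_pmf (\<lambda>(s', qs). (st l i [] s', qs)) (wfold ?f (xs l i) (s0 l i)))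
          (\<lambda>u. wreturn (sl_result (Then Right Right) u)) = map_pmf ?r (wfold ?f (xs l i) (s0 l i))"
      by (simp add: wbind_wreturn_right pmf.map_comp o_def case_prod_unfold st_def)
    show "halts (exec y ?prog (repr (l, i))) (?T l) (map_pmf ?r (wfold ?f (xs l i) (s0 l i)))"
      by (rule halts_Then_det[OF 1 3[unfolded 4]])
  qed (intro polynomially_bounded_intros S T U N)
qed

lemma pt_fold:
  fixes xs :: "nat \<Rightarrow> 'i :: repr \<Rightarrow> 'x :: repr list" and s0 :: "nat \<Rightarrow> 'i \<Rightarrow> 's :: repr"
  assumes "pt D xs" "pt D s0" "bounded_on D (\<lambda>l i. length (xs l i))" "pt E step"
    and "\<And>l i. i \<in> D l \<Longrightarrow> Inv l i (xs l i) (s0 l i)"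
    and "\<And>l i x xs' s. i \<in> D l \<Longrightarrow> Inv l i (x # xs') s \<Longrightarrow> ((i, x), s) \<in> E l"
    and "\<And>l i x xs' s. i \<in> D l \<Longrightarrow> Inv l i (x # xs') s \<Longrightarrow> Inv l i xs' (step l ((i, x), s))"
  shows "pt D (\<lambda>l i. fold (\<lambda>x s. step l ((i, x), s)) (xs l i) (s0 l i))"
proof -
  have "efficient D (\<lambda>y l i. wfold (\<lambda>x s. wreturn (step l ((i, x), s))) (xs l i) (s0 l i))"
  proof (rule efficient_fold[OF assms(1-3) assms(4)[unfolded pt_def], where Inv = Inv])
    fix y :: "bool list" and l i x xs' s s' and qs :: "nat list"
    assume "i \<in> D l" "Inv l i (x # xs') s" "(s', qs) \<in> set_pmf (wreturn (step l ((i, x), s)))"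
    with assms(7) show "Inv l i xs' s'" by auto
  qed (fact assms(5), fact assms(6))
  then show ?thesis unfolding pt_def wfold_wreturn .
qed

text \<open>A unary number has the same tree as a list of that many units, so a counting loop is a
  fold over the number itself.\<close>

lemma efficient_repeat:
  fixes n :: "nat \<Rightarrow> 'i :: repr \<Rightarrow> nat" and s0 :: "nat \<Rightarrow> 'i \<Rightarrow> 's :: repr"
  assumes "pt D n" "pt D s0" "bounded_on D n" "efficient E step"
    and "\<And>l i. i \<in> D l \<Longrightarrow> Inv l i (n l i) (s0 l i)"
    and "\<And>l i k s. i \<in> D l \<Longrightarrow> Inv l i (Suc k) s \<Longrightarrow> (i, s) \<in> E l"
    and inv: "\<And>y l i k s s' qs. i \<in> D l \<Longrightarrow> Inv l i (Suc k) s \<Longrightarrow>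
      (s', qs) \<in> set_pmf (step y l (i, s)) \<Longrightarrow> Inv l i k s'"
  shows "efficient D (\<lambda>y l i. wfold (\<lambda>_ s. step y l (i, s)) (replicate (n l i) ()) (s0 l i))"
proof -
  have units: "pt D (\<lambda>l i. replicate (n l i) ())"
  proof (rule pt_repr_eq[OF assms(1)])
    fix l i
    have "repr k = repr (replicate k ())" for k :: nat
      by (induction k) (simp_all add: repr_unit_def)
    then show "repr (n l i) = repr (replicate (n l i) ())" .
  qed
  let ?E = "\<lambda>l. {((i, x :: unit), s). (i, s) \<in> E l}"
  let ?step = "\<lambda>y l z. step y l (fst (fst z), snd z)"
  have step: "efficient ?E ?step"
    by (rule efficient_comp[OF pt_pair[OF pt_fst[OF pt_fst[OF pt_input]] pt_snd[OF pt_input]] assms(4)])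
      auto
  have "efficient D (\<lambda>y l i. wfold (\<lambda>x s. ?step y l ((i, x), s)) (replicate (n l i) ()) (s0 l i))"
  proof (rule efficient_fold[OF units assms(2) _ step, where Inv = "\<lambda>l i xs. Inv l i (length xs)"])
    fix y :: "bool list" and l i s s' and x :: unit and xs' and qs :: "nat list"
    assume "i \<in> D l" "Inv l i (length (x # xs')) s" "(s', qs) \<in> set_pmf (?step y l ((i, x), s))"
    then show "Inv l i (length xs') s'" by (auto intro: inv)
  qed (use assms(3,5,6) in auto)
  then show ?thesis by simp
qed

lemma pt_funpow:
  fixes n :: "nat \<Rightarrow> 'i :: repr \<Rightarrow> nat" and s0 :: "nat \<Rightarrow> 'i \<Rightarrow> 's :: repr"
  assumes "pt D n" "pt D s0" "bounded_on D n" "pt E step"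
    and "\<And>l i. i \<in> D l \<Longrightarrow> Inv l i (n l i) (s0 l i)"
    and "\<And>l i k s. i \<in> D l \<Longrightarrow> Inv l i (Suc k) s \<Longrightarrow> (i, s) \<in> E l"
    and "\<And>l i k s. i \<in> D l \<Longrightarrow> Inv l i (Suc k) s \<Longrightarrow> Inv l i k (step l (i, s))"
  shows "pt D (\<lambda>l i. ((\<lambda>s. step l (i, s)) ^^ n l i) (s0 l i))"
proof -
  have "efficient D (\<lambda>y l i. wfold (\<lambda>_ s. wreturn (step l (i, s))) (replicate (n l i) ()) (s0 l i))"
  proof (rule efficient_repeat[OF assms(1-3) assms(4)[unfolded pt_def], where Inv = Inv])
    fix y :: "bool list" and l i k s s' and qs :: "nat list"
    assume "i \<in> D l" "Inv l i (Suc k) s" "(s', qs) \<in> set_pmf (wreturn (step l (i, s)))"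
    with assms(7) show "Inv l i k s'" by auto
  qed (fact assms(5), fact assms(6))
  moreover have "fold (\<lambda>x. f) (replicate k ()) s = (f ^^ k) s" for f :: "'s \<Rightarrow> 's" and k s
    by (induction k arbitrary: s) (simp_all add: funpow_swap1)
  ultimately show ?thesis unfolding pt_def wfold_wreturn by simp
qed

section \<open>Closure properties of bounds that are uniform over a domain\<close>

lemma bounded_on_add: "bounded_on D f \<Longrightarrow> bounded_on D g \<Longrightarrow> bounded_on D (\<lambda>l i. f l i + g l i)"
proof -
  assume "bounded_on D f" "bounded_on D g"
  then obtain M N where "polynomially_bounded M" "\<forall>l. \<forall>i \<in> D l. f l i \<le> M l"
    "polynomially_bounded N" "\<forall>l. \<forall>i \<in> D l. g l i \<le> N l"
    unfolding bounded_on_def by blast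
  then show ?thesis
    by (intro bounded_onI[of "\<lambda>l. M l + N l"]) (auto intro: polynomially_bounded_add add_mono)
qed

lemma bounded_on_mult: "bounded_on D f \<Longrightarrow> bounded_on D g \<Longrightarrow> bounded_on D (\<lambda>l i. f l i * g l i)"
proof -
  assume "bounded_on D f" "bounded_on D g"
  then obtain M N where "polynomially_bounded M" "\<forall>l. \<forall>i \<in> D l. f l i \<le> M l"
    "polynomially_bounded N" "\<forall>l. \<forall>i \<in> D l. g l i \<le> N l"
    unfolding bounded_on_def by blast
  then show ?thesis
    by (intro bounded_onI[of "\<lambda>l. M l * N l"]) (auto intro: polynomially_bounded_mult mult_le_mono)
qed

lemma bounded_on_mono:
  "bounded_on D g \<Longrightarrow> (\<And>l i. i \<in> D l \<Longrightarrow> f l i \<le> g l i) \<Longrightarrow> bounded_on D f"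
  unfolding bounded_on_def by (meson le_trans)

lemma bounded_on_const: "bounded_on D (\<lambda>l i. c)"
  by (rule bounded_on_param) (rule polynomially_bounded_const)

lemma bounded_on_comp:
  assumes "bounded_on E g" "\<And>l i. i \<in> D l \<Longrightarrow> f l i \<in> E l"
  shows "bounded_on D (\<lambda>l i. g l (f l i))"
  using assms unfolding bounded_on_def by blast

lemma bounded_on_fst:
  assumes "bounded_on D g" "\<And>l i. i \<in> E l \<Longrightarrow> fst i \<in> D l"
  shows "bounded_on E (\<lambda>l i. g l (fst i))"
  using bounded_on_comp[OF assms(1), of E "\<lambda>l. fst"] assms(2) by blast

subsection \<open>Arithmetic\<close>

lemma pt_add:
  assumes "pt D f" "pt D g" "bounded_on D g"
  shows "pt D (\<lambda>l i. f l i + g l i)"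
  using pt_funpow[OF assms(2,1,3) pt_Suc[OF pt_snd[OF pt_input[of "\<lambda>_. UNIV"]]],
        of "\<lambda>_ _ _ _. True"]
  by (simp add: add.commute)

lemma pt_diff:
  fixes f g :: "nat \<Rightarrow> 'i :: repr \<Rightarrow> nat"
  assumes "pt D f" "pt D g" "bounded_on D g"
  shows "pt D (\<lambda>l i. f l i - g l i)"
proof -
  have "((\<lambda>k. k - 1) ^^ n) m = m - n" for m n :: nat by (induction n) simp_all
  then show ?thesis
    using pt_funpow[OF assms(2,1,3) pt_pred[OF pt_snd[OF pt_input[of "\<lambda>_. UNIV"]]],
        of "\<lambda>_ _ _ _. True"]
    by simp
qed

lemma pt_mult:
  fixes f g :: "nat \<Rightarrow> 'i :: repr \<Rightarrow> nat"
  assumes "pt D f" "pt D g" "bounded_on D f" "bounded_on D g"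
  shows "pt D (\<lambda>l i. f l i * g l i)"
proof -
  have eq: "((\<lambda>k. k + m) ^^ n) 0 = m * n" for m n :: nat by (induction n) simp_all
  let ?E = "\<lambda>l. {(i, k :: nat). i \<in> D l}"
  have f: "pt ?E (\<lambda>l z. f l (fst z))"
    by (rule pt_comp[OF pt_fst[OF pt_input] assms(1)]) auto
  have "pt ?E (\<lambda>l z. snd z + f l (fst z))"
    by (rule pt_add[OF pt_snd[OF pt_input] f bounded_on_fst[OF assms(3)]]) auto
  from pt_funpow[OF assms(2) pt_const[of D 0] assms(4) this, of "\<lambda>_ _ _ _. True"] show ?thesis
    by (simp add: eq)
qed

lemma pt_less:
  fixes f g :: "nat \<Rightarrow> 'i :: repr \<Rightarrow> nat"
  assumes "pt D f" "pt D g" "bounded_on D f"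
  shows "pt D (\<lambda>l i. f l i < g l i)"
  using pt_pos[OF pt_diff[OF assms(2,1,3)]] by simp

text \<open>Quotient and remainder are found by counting up to the dividend, resetting the remainder
  when it would reach the divisor. The invariant that the remainder is below the divisor supplies
  the bound that the comparison in each step requires.\<close>

lemma pt_div_mod:
  fixes f g :: "nat \<Rightarrow> 'i :: repr \<Rightarrow> nat"
  assumes f: "pt D f" "bounded_on D f" and g: "pt D g" "bounded_on D g"
    and pos: "\<And>l i. i \<in> D l \<Longrightarrow> 0 < g l i"
  shows "pt D (\<lambda>l i. f l i div g l i)" "pt D (\<lambda>l i. f l i mod g l i)"
proof -
  let ?step = "\<lambda>m (q, r). if Suc r < m then (q, Suc r) else (Suc q, 0)"
  have eq: "(?step m ^^ n) (0, 0) = (n div m, n mod m)" if "0 < m" for m n :: nat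
  proof (induction n)
    case (Suc n)
    have "n mod m < m" using that by simp
    then have "Suc (n mod m) < m \<longleftrightarrow> Suc (n mod m) \<noteq> m" by linarith
    with Suc that show ?case by (auto simp: mod_Suc div_Suc)
  qed simp
  let ?E = "\<lambda>l. {(i, qr :: nat \<times> nat). i \<in> D l \<and> snd qr < g l i}"
  have g': "pt ?E (\<lambda>l z. g l (fst z))"
    by (rule pt_comp[OF pt_fst[OF pt_input] g(1)]) auto
  have bg: "bounded_on ?E (\<lambda>l z. g l (fst z))"
    by (rule bounded_on_fst[OF g(2)]) auto
  have bounded: "bounded_on ?E (\<lambda>l z. Suc (snd (snd z)))"
    by (rule bounded_on_mono[OF bg]) auto
  have "pt ?E (\<lambda>l z. if Suc (snd (snd z)) < g l (fst z)
    then (fst (snd z), Suc (snd (snd z))) else (Suc (fst (snd z)), 0))"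
    by (intro pt_if pt_pair pt_Suc pt_less g' bounded pt_fst pt_snd pt_input pt_const)
  from pt_funpow[OF f(1) pt_const[of D "(0 :: nat, 0 :: nat)"] f(2) this,
      of "\<lambda>l i k qr. snd qr < g l i"] pos
  have "pt D (\<lambda>l i. (?step (g l i) ^^ f l i) (0, 0))"
    by (simp add: case_prod_unfold cong: if_cong)
  then have "pt D (\<lambda>l i. (f l i div g l i, f l i mod g l i))"
    by (rule pt_cong) (simp add: eq pos)
  from pt_fst[OF this] pt_snd[OF this]
  show "pt D (\<lambda>l i. f l i div g l i)" "pt D (\<lambda>l i. f l i mod g l i)" by simp_all
qed

subsection \<open>Lists\<close>

text \<open>Accumulating with \<open>Cons\<close> reverses. The list functions below therefore build
  their results backwards and end with \<open>pt_rev\<close>.\<close>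

lemma pt_fold_append:
  assumes "pt D f" "pt D g" "bounded_on D (\<lambda>l i. length (f l i))"
  shows "pt D (\<lambda>l i. rev (f l i) @ g l i)"
proof -
  have "pt (\<lambda>_. UNIV) (\<lambda>l z. snd (fst z) # snd z)"
    by (intro pt_Cons pt_fst pt_snd pt_input)
  from pt_fold[OF assms this, of "\<lambda>_ _ _ _. True"] show ?thesis
    by (simp add: fold_Cons_rev)
qed

lemma pt_rev:
  "pt D f \<Longrightarrow> bounded_on D (\<lambda>l i. length (f l i)) \<Longrightarrow> pt D (\<lambda>l i. rev (f l i))"
  using pt_fold_append[of D f "\<lambda>_ _. []"] by (simp add: pt_const)

lemma pt_append:
  assumes "pt D f" "pt D g" "bounded_on D (\<lambda>l i. length (f l i))"
  shows "pt D (\<lambda>l i. f l i @ g l i)"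
  using pt_fold_append[OF pt_rev[OF assms(1,3)] assms(2)] assms(3) by simp

lemma pt_length:
  assumes "pt D f" "bounded_on D (\<lambda>l i. length (f l i))"
  shows "pt D (\<lambda>l i. length (f l i))"
proof -
  have eq: "fold (\<lambda>_. Suc) xs n = length xs + n" for xs :: "'b list" and n
    by (induction xs arbitrary: n) simp_all
  have "pt (\<lambda>_. UNIV) (\<lambda>l z. Suc (snd z))"
    by (intro pt_Suc pt_snd pt_input)
  from pt_fold[OF assms(1) pt_const[of D "0 :: nat"] assms(2) this, of "\<lambda>_ _ _ _. True"]
  show ?thesis by (simp add: eq)
qed

lemma pt_drop:
  assumes "pt D n" "pt D f" "bounded_on D n"
  shows "pt D (\<lambda>l i. drop (n l i) (f l i))"
proof -
  have "(tl ^^ n) xs = drop n xs" for n and xs :: "'b list"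
    by (induction n) (simp_all add: drop_Suc tl_drop)
  then show ?thesis
    using pt_funpow[OF assms pt_tl[OF pt_snd[OF pt_input[of "\<lambda>_. UNIV"]]],
        of "\<lambda>_ _ _ _. True"] by simp
qed

lemma pt_take:
  assumes "pt D n" "pt D f" "bounded_on D n"
  shows "pt D (\<lambda>l i. take (n l i) (f l i))"
proof -
  let ?step = "\<lambda>(acc, rest). if rest \<noteq> [] then (hd rest # acc, tl rest) else (acc, rest)"
  have eq: "(?step ^^ n) (acc, xs) = (rev (take n xs) @ acc, drop n xs)" for n and acc xs :: "'b list"
  proof (induction n)
    case (Suc n)
    then show ?case
      by (auto simp: take_Suc_conv_app_nth hd_drop_conv_nth drop_Suc tl_drop)
  qed simp
  have "pt (\<lambda>_. UNIV) (\<lambda>l z. if snd (snd z) \<noteq> [] then (hd (snd (snd z)) # fst (snd z), tl (snd (snd z)))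
     else (fst (snd z), snd (snd z)))"
    by (intro pt_if pt_pair pt_Cons pt_hd pt_tl pt_nonempty pt_fst pt_snd pt_input) auto
  from pt_funpow[OF assms(1) pt_pair[OF pt_const[of D "[]"] assms(2)] assms(3) this,
      of "\<lambda>_ _ _ _. True"]
  have "pt D (\<lambda>l i. (?step ^^ n l i) ([], f l i))"
    by (simp add: case_prod_unfold cong: if_cong)
  from pt_fst[OF this] have "pt D (\<lambda>l i. rev (take (n l i) (f l i)))" by (simp add: eq)
  from pt_rev[OF this bounded_on_mono[OF assms(3)]] show ?thesis by simp
qed

lemma pt_nth:
  assumes "pt D f" "pt D n" "bounded_on D n" "\<And>l i. i \<in> D l \<Longrightarrow> n l i < length (f l i)"
  shows "pt D (\<lambda>l i. f l i ! n l i)"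
proof -
  have "pt D (\<lambda>l i. hd (drop (n l i) (f l i)))"
    by (intro pt_hd pt_drop assms(1-3)) (simp add: assms(4) not_le)
  then show ?thesis by (rule pt_cong) (simp add: hd_drop_conv_nth assms(4))
qed

lemma pt_zip:
  assumes "pt D f" "pt D g" "bounded_on D (\<lambda>l i. length (f l i))"
    and "\<And>l i. i \<in> D l \<Longrightarrow> length (f l i) \<le> length (g l i)"
  shows "pt D (\<lambda>l i. zip (f l i) (g l i))"
proof -
  let ?step = "\<lambda>x (acc, rest). ((x, hd rest) # acc, tl rest)"
  have eq: "fst (fold ?step xs (acc, ys)) = rev (zip xs ys) @ acc" if "length xs \<le> length ys"
    for xs :: "'b list" and ys :: "'c list" and acc
    using that
  proof (induction xs arbitrary: acc ys)
    case (Cons x xs)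
    then show ?case by (cases ys) simp_all
  qed simp
  have "pt (\<lambda>l. {z. snd (snd z) \<noteq> []})
    (\<lambda>l z. ((snd (fst z), hd (snd (snd z))) # fst (snd z), tl (snd (snd z))))"
    by (intro pt_pair pt_Cons pt_hd pt_tl pt_fst pt_snd pt_input) auto
  from pt_fold[OF assms(1) pt_pair[OF pt_const[of D "[]"] assms(2)] assms(3) this,
      of "\<lambda>_ _ xs s. length xs \<le> length (snd s)"] assms(4)
  have "pt D (\<lambda>l i. fold ?step (f l i) ([], g l i))" by (force simp: case_prod_unfold)
  from pt_fst[OF this] have "pt D (\<lambda>l i. fst (fold ?step (f l i) ([], g l i)))" .
  then have "pt D (\<lambda>l i. rev (zip (f l i) (g l i)))"
    by (rule pt_cong) (simp add: eq[OF assms(4)])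
  from pt_rev[OF this bounded_on_mono[OF assms(3)]] show ?thesis by simp
qed

lemma pt_replicate:
  assumes "pt D n" "bounded_on D n"
  shows "pt D (\<lambda>l i. replicate (n l i) c)"
proof -
  have "((#) c ^^ n) [] = replicate n c" for n by (induction n) simp_all
  then show ?thesis
    using pt_funpow[OF assms(1) pt_const[of D "[]"] assms(2) pt_Cons[OF pt_const[of _ c] pt_snd[OF pt_input[of "\<lambda>_. UNIV"]]],
      of "\<lambda>_ _ _ _. True"] by simp
qed

lemma pt_upt:
  assumes "pt D n" "bounded_on D n"
  shows "pt D (\<lambda>l i. [0..<n l i])"
proof -
  let ?step = "\<lambda>(k, acc). (Suc k, k # acc)"
  have eq: "(?step ^^ n) (0, []) = (n, rev [0..<n])" for n by (induction n) simp_all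
  have "pt (\<lambda>_. UNIV) (\<lambda>l z. (Suc (fst (snd z)), fst (snd z) # snd (snd z)))"
    by (intro pt_pair pt_Cons pt_Suc pt_fst pt_snd pt_input)
  from pt_funpow[OF assms(1) pt_const[of D "(0, [])"] assms(2) this, of "\<lambda>_ _ _ _. True"]
  have "pt D (\<lambda>l i. (?step ^^ n l i) (0, []))" by (simp add: case_prod_unfold)
  from pt_snd[OF this] have "pt D (\<lambda>l i. rev [0..<n l i])" by (simp add: eq)
  from pt_rev[OF this] assms(2) show ?thesis by simp
qed

lemma pt_xor_bits:
  fixes f g :: "nat \<Rightarrow> 'i :: repr \<Rightarrow> bool list"
  assumes "pt D f" "pt D g" "bounded_on D (\<lambda>l i. length (f l i))"
    and "\<And>l i. i \<in> D l \<Longrightarrow> length (f l i) \<le> length (g l i)"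
  shows "pt D (\<lambda>l i. xor_bits (f l i) (g l i))"
proof -
  let ?op = "\<lambda>x acc. (fst x \<noteq> snd x) # acc"
  have eq: "fold (\<lambda>x. (#) (h x)) xs acc = rev (map h xs) @ acc"
    for h :: "bool \<times> bool \<Rightarrow> bool" and xs acc
    by (induction xs arbitrary: acc) simp_all
  have test: "pt (\<lambda>_. UNIV) (\<lambda>l z :: ('i \<times> bool \<times> bool) \<times> bool list. fst (snd (fst z)))"
    "pt D' (\<lambda>l z :: ('i \<times> bool \<times> bool) \<times> bool list. snd (snd (fst z)))" for D'
    by (intro pt_fst pt_snd pt_input)+
  have "pt (\<lambda>_. UNIV) (\<lambda>l z :: ('i \<times> bool \<times> bool) \<times> bool list. if fst (snd (fst z))
      then (if snd (snd (fst z)) then False else True) else snd (snd (fst z)))"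
    by (intro pt_if pt_const test)
  then have "pt (\<lambda>_. UNIV) (\<lambda>l z :: ('i \<times> bool \<times> bool) \<times> bool list. fst (snd (fst z)) \<noteq> snd (snd (fst z)))"
    by (rule pt_cong) auto
  then have "pt (\<lambda>_. UNIV) (\<lambda>l z :: ('i \<times> bool \<times> bool) \<times> bool list. ?op (snd (fst z)) (snd z))"
    by (intro pt_Cons pt_snd pt_input)
  from pt_fold[OF pt_zip[OF assms] pt_const[of D "[]"] _ this, of "\<lambda>_ _ _ _. True"]
    bounded_on_mono[OF assms(3)]
  have "pt D (\<lambda>l i. rev (xor_bits (f l i) (g l i)))"
    by (simp add: eq xor_bits_def case_prod_unfold)
  from pt_rev[OF this] bounded_on_mono[OF assms(3)] show ?thesis by (simp add: xor_bits_def)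
qed

text \<open>The common form of encoding, of decoding and, with \<open>id\<close>, of merely
  selecting whole blocks.\<close>

definition blockwise :: "('a list \<Rightarrow> 'b list) \<Rightarrow> nat \<Rightarrow> nat \<Rightarrow> 'a list \<Rightarrow> 'b list" where
  "blockwise f m k xs = concat (map (\<lambda>j. f (take m (drop (j * m) xs))) [0..<k])"

lemma length_blockwise:
  assumes "\<And>w. length w = m \<Longrightarrow> length (f w) = m'" "k * m \<le> length xs"
  shows "length (blockwise f m k xs) = k * m'"
  using assms(2)
proof (induction k)
  case (Suc k)
  then have "length (f (take m (drop (k * m) xs))) = m'" by (intro assms(1)) simp
  with Suc show ?case by (simp add: blockwise_def)
qed (simp add: blockwise_def)

text \<open>\<open>f\<close> is available only on words of length exactly \<open>m0 l\<close>. The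
  invariant that the unread rest still contains all the blocks to come makes every
  \<open>take\<close> a full block.\<close>

lemma pt_blockwise:
  fixes f :: "nat \<Rightarrow> 'a :: repr list \<Rightarrow> 'b :: repr list"
  assumes "pt D m" "pt D k" "pt D xs" "pt (\<lambda>l. {w. length w = m0 l}) f"
    and "bounded_on D k" "polynomially_bounded m0" "polynomially_bounded m1"
    and m: "\<And>l i. i \<in> D l \<Longrightarrow> m l i = m0 l"
    and f: "\<And>l w. length w = m0 l \<Longrightarrow> length (f l w) = m1 l"
    and xs: "\<And>l i. i \<in> D l \<Longrightarrow> k l i * m0 l \<le> length (xs l i)"
  shows "pt D (\<lambda>l i. blockwise (f l) (m l i) (k l i) (xs l i))"
proof -
  let ?step = "\<lambda>m f (acc, rest). (rev (f (take m rest)) @ acc, drop m rest)"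
  have eq: "(?step m f ^^ k) ([], xs) = (rev (blockwise f m k xs), drop (k * m) xs)"
    for m f k and xs :: "'a list"
    by (induction k) (simp_all add: blockwise_def add.commute)
  let ?E = "\<lambda>l. {(i, acc :: 'b list, rest :: 'a list). i \<in> D l \<and> m0 l \<le> length rest}"
  have m': "pt ?E (\<lambda>l z. m l (fst z))"
    by (rule pt_comp[OF pt_fst[OF pt_input] assms(1)]) auto
  have bm: "bounded_on ?E (\<lambda>l z. m l (fst z))"
    by (rule bounded_on_mono[OF bounded_on_param[OF assms(6)]]) (auto simp: m)
  have "pt ?E (\<lambda>l z. take (m l (fst z)) (snd (snd z)))"
    by (intro pt_take m' bm pt_snd pt_input)
  from pt_comp[OF this assms(4)]
  have f': "pt ?E (\<lambda>l z. f l (take (m l (fst z)) (snd (snd z))))"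
    by (auto simp: m)
  have "pt ?E (\<lambda>l z. (rev (f l (take (m l (fst z)) (snd (snd z)))) @ fst (snd z),
      drop (m l (fst z)) (snd (snd z))))"
    by (intro pt_pair pt_fold_append f' pt_fst pt_snd pt_input pt_drop m' bm)
      (rule bounded_on_mono[OF bounded_on_param[OF assms(7)]], auto simp: m f)
  from pt_funpow[OF assms(2) pt_pair[OF pt_const[of D "[]"] assms(3)] assms(5) this,
      of "\<lambda>l i k s. k * m0 l \<le> length (snd s)"] xs m
  have "pt D (\<lambda>l i. (?step (m l i) (f l) ^^ k l i) ([], xs l i))"
    by (auto simp: case_prod_unfold)
  from pt_fst[OF this] have "pt D (\<lambda>l i. rev (blockwise (f l) (m l i) (k l i) (xs l i)))"
    by (simp add: eq)
  from pt_rev[OF this] bounded_on_mono[OF bounded_on_mult[OF assms(5) bounded_on_param[OF assms(7)]]]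
  show ?thesis by (simp add: m length_blockwise[OF f xs])
qed

lemma pt_list_update:
  assumes "pt D f" "pt D n" "pt D v" "bounded_on D n"
    and "\<And>l i. i \<in> D l \<Longrightarrow> n l i < length (f l i)"
  shows "pt D (\<lambda>l i. (f l i)[n l i := v l i])"
proof -
  have "pt D (\<lambda>l i. take (n l i) (f l i) @ v l i # drop (Suc (n l i)) (f l i))"
  proof (intro pt_append pt_take pt_Cons pt_drop pt_Suc assms(1-4))
    show "bounded_on D (\<lambda>l i. length (take (n l i) (f l i)))"
      by (rule bounded_on_mono[OF assms(4)]) simp
    show "bounded_on D (\<lambda>l i. Suc (n l i))"
      using bounded_on_add[OF bounded_on_const[of _ 1] assms(4)] by simp
  qed
  then show ?thesis by (rule pt_cong) (simp add: upd_conv_take_nth_drop assms(5))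
qed

text \<open>Folding over pairs of target and bit frees the loop body from looking up
  \<open>\<pi>\<close> and \<open>z\<close>.\<close>

lemma permute_eq_fold_zip:
  assumes "length \<pi> = length z"
  shows "permute \<pi> z = fold (\<lambda>x s. s[fst x := snd x]) (zip \<pi> z) (replicate (length z) False)"
proof -
  have "zip \<pi> z = map (\<lambda>i. (\<pi> ! i, z ! i)) [0..<length z]"
    using assms by (intro nth_equalityI) simp_all
  then show ?thesis by (simp add: permute_def fold_map o_def)
qed

lemma pt_permute:
  assumes f: "pt D f" and g: "pt D g" and b: "bounded_on D (\<lambda>l i. length (g l i))"
    and len: "\<And>l i. i \<in> D l \<Longrightarrow> length (f l i) = length (g l i)"
    and sub: "\<And>l i. i \<in> D l \<Longrightarrow> set (f l i) \<subseteq> {..<length (g l i)}"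
  shows "pt D (\<lambda>l i. permute (f l i) (g l i))"
proof -
  let ?E = "\<lambda>l. {((i, x :: nat \<times> bool), s :: bool list). i \<in> D l \<and> fst x < length s \<and>
    length s = length (g l i)}"
  let ?step = "\<lambda>x s. s[fst x := snd x]"
  have b': "bounded_on D (\<lambda>l i. length (f l i))"
    by (rule bounded_on_mono[OF b]) (simp add: len)
  have bE: "bounded_on ?E (\<lambda>l z. fst (snd (fst z)))"
    by (rule bounded_on_mono[OF bounded_on_comp[OF b, of ?E "\<lambda>l z. fst (fst z)"]]) auto
  have step: "pt ?E (\<lambda>l z. ?step (snd (fst z)) (snd z))"
    by (intro pt_list_update pt_fst pt_snd pt_input bE) auto
  have zip: "pt D (\<lambda>l i. zip (f l i) (g l i))"
    by (intro pt_zip f g b') (simp add: len)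
  have "pt D (\<lambda>l i. fold (\<lambda>x s. ?step (snd (fst ((i, x), s))) (snd ((i, x), s))) (zip (f l i) (g l i))
      (replicate (length (g l i)) False))"
  proof (rule pt_fold[OF zip _ _ step, where Inv = "\<lambda>l i xs s. length s = length (g l i) \<and>
      fst ` set xs \<subseteq> {..<length (g l i)}"])
    show "pt D (\<lambda>l i. replicate (length (g l i)) False)"
      by (intro pt_replicate pt_length g b)
    show "bounded_on D (\<lambda>l i. length (zip (f l i) (g l i)))"
      by (rule bounded_on_mono[OF b]) simp
    show "length (replicate (length (g l i)) False) = length (g l i) \<and>
      fst ` set (zip (f l i) (g l i)) \<subseteq> {..<length (g l i)}" if "i \<in> D l" for l i
      using sub[OF that] by (auto dest: set_zip_leftD)
  qed auto
  then show ?thesis by (rule pt_cong) (simp add: permute_eq_fold_zip len)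
qed

subsection \<open>Queries\<close>

definition ask :: "bool list \<Rightarrow> nat \<Rightarrow> bool" where
  "ask y p \<longleftrightarrow> p < length y \<and> y ! p"

text \<open>Serves the decoder, which is non-adaptive: the positions are computed before the first
  query. Their bound \<open>N\<close> is needed because a query costs the unary size of its
  position.\<close>

lemma efficient_ask_all:
  assumes ps: "pt D ps" and len: "bounded_on D (\<lambda>l i. length (ps l i))"
    and pos: "polynomially_bounded N" "\<And>l i p. i \<in> D l \<Longrightarrow> p \<in> set (ps l i) \<Longrightarrow> p \<le> N l"
  shows "efficient D (\<lambda>y l i. return_pmf (map (ask y) (ps l i), ps l i))"
proof -
  let ?E = "\<lambda>l. {((i, p), acc :: bool list). i \<in> D l \<and> p \<le> N l}"
  let ?ask = "\<lambda>y p acc. return_pmf (ask y p # acc, [p])"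
  have "efficient ?E (\<lambda>y l z. return_pmf (ask y (snd (fst z)), [snd (fst z)]))"
    unfolding ask_def
    by (intro efficient_query pt_fst pt_snd pt_input, rule bounded_onI[OF pos(1)]) auto
  from efficient_map[OF this, of "\<lambda>_. UNIV" "\<lambda>l z. snd z # snd (fst z)"]
  have step: "efficient ?E (\<lambda>y l z. ?ask y (snd (fst z)) (snd z))"
    by (simp add: pt_Cons pt_fst pt_snd pt_input)
  have "efficient D (\<lambda>y l i. wfold (\<lambda>p acc. ?ask y (snd (fst ((i, p), acc))) (snd ((i, p), acc))) (ps l i) [])"
    by (rule efficient_fold[OF ps pt_const len step, where Inv = "\<lambda>l i ps _. set ps \<subseteq> {..N l}"])
      (auto simp: pos(2))
  moreover have "wfold (\<lambda>p acc. ?ask y p acc) qs acc =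
      return_pmf (rev (map (ask y) qs) @ acc, qs)" for y qs acc
    by (induction qs arbitrary: acc) (simp_all add: wreturn_def wbind_return_pmf)
  ultimately have eff: "efficient D (\<lambda>y l i. return_pmf (rev (map (ask y) (ps l i)), ps l i))"
    by simp
  let ?F = "\<lambda>l. {(i, v :: bool list). i \<in> D l \<and> length v = length (ps l i)}"
  have "pt ?F (\<lambda>l z. rev (snd z))"
  proof (intro pt_rev pt_snd pt_input)
    show "bounded_on ?F (\<lambda>l z. length (snd z))"
      by (rule bounded_on_mono[OF bounded_on_fst[OF len]]) auto
  qed
  from efficient_map[OF eff this] show ?thesis by simp
qed

subsection \<open>Sampling\<close>

lemma finite_bit_strings: "finite {r :: bool list. length r = n}"
  using finite_lists_length_eq[of "UNIV :: bool set" n] by simp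

lemma bit_strings_nonempty: "{r :: bool list. length r = n} \<noteq> {}"
  using Ex_list_of_length[of n] by auto

lemma set_pmf_bit_strings [simp]:
  "set_pmf (pmf_of_set {r :: bool list. length r = n}) = {r. length r = n}"
  by (rule set_pmf_of_set[OF bit_strings_nonempty finite_bit_strings])

lemma pmf_of_set_bit_strings_Suc:
  "pmf_of_set {r :: bool list. length r = Suc n} =
    bind_pmf (pmf_of_set UNIV) (\<lambda>b. map_pmf ((#) b) (pmf_of_set {r. length r = n}))"
proof -
  let ?A = "{r :: bool list. length r = n}"
  note fin = finite_bit_strings and ne = bit_strings_nonempty
  have "{r :: bool list. length r = Suc n} = (\<Union>b\<in>UNIV. (#) b ` ?A)"
    by (auto simp: length_Suc_conv)
  also have "pmf_of_set \<dots> = bind_pmf (pmf_of_set UNIV) (\<lambda>b. pmf_of_set ((#) b ` ?A))"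
    by (rule pmf_of_set_UN[where n = "card ?A"])
      (use ne fin in \<open>auto simp: card_image disjoint_family_on_def\<close>)
  finally show ?thesis using ne fin by (simp add: map_pmf_of_set_inj)
qed

lemma efficient_random_bits:
  fixes n :: "nat \<Rightarrow> 'i :: repr \<Rightarrow> nat"
  assumes "pt D n" "bounded_on D n"
  shows "efficient D (\<lambda>y l i. map_pmf (\<lambda>r. (r, [])) (pmf_of_set {r :: bool list. length r = n l i}))"
proof -
  let ?step = "\<lambda>acc. map_pmf (\<lambda>b :: bool. (b # acc, [] :: nat list)) (pmf_of_set UNIV)"
  \<comment> \<open>A fair coin is a uniform number below 2, tested for being positive.\<close>
  have "bij_betw (\<lambda>k :: nat. k > 0) {..<2} (UNIV :: bool set)"
    by (rule bij_betwI[where g = "\<lambda>b. if b then 1 else 0"]) auto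
  then have bit: "map_pmf (\<lambda>k :: nat. k > 0) (pmf_of_set {..<2}) = pmf_of_set UNIV"
    by (rule map_pmf_of_set_bij_betw) (simp_all add: lessThan_empty_iff)
  have "pt (\<lambda>_. UNIV :: (('i \<times> bool list) \<times> nat) set) (\<lambda>l z. (snd z > 0) # snd (fst z))"
    by (intro pt_Cons pt_pos pt_fst pt_snd pt_input)
  from efficient_map[OF efficient_rand[OF pt_const[of "\<lambda>_. UNIV" "2 :: nat"] bounded_on_const] this]
  have "efficient (\<lambda>_. UNIV) (\<lambda>y l (z :: 'i \<times> bool list).
      map_pmf (\<lambda>k. ((k > 0) # snd z, [])) (pmf_of_set {..<2 :: nat}))"
    by (simp add: pmf.map_comp o_def)
  moreover have "map_pmf (\<lambda>k. ((k > 0) # acc, [])) (pmf_of_set {..<2 :: nat}) = ?step acc" for acc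
    unfolding bit[symmetric] by (simp add: pmf.map_comp o_def)
  ultimately have step: "efficient (\<lambda>_. UNIV) (\<lambda>y l (z :: 'i \<times> bool list). ?step (snd z))"
    by simp
  have "efficient D (\<lambda>y l i. wfold (\<lambda>_ s. ?step (snd (i, s))) (replicate (n l i) ()) [])"
    by (rule efficient_repeat[OF assms(1) pt_const assms(2) step, where Inv = "\<lambda>_ _ _ _. True"]) auto
  moreover have "wfold (\<lambda>_. ?step) (replicate k ()) acc =
      map_pmf (\<lambda>r. (rev r @ acc, [])) (pmf_of_set {r. length r = k})" for k acc
  proof (induction k arbitrary: acc)
    case 0
    have "{r :: bool list. length r = 0} = {[]}" by auto
    then show ?case by (simp add: wreturn_def pmf_of_set_singleton)
  next
    case (Suc k)
    then show ?case
      unfolding pmf_of_set_bit_strings_Suc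
      by (simp add: wbind_def bind_map_pmf map_bind_pmf pmf.map_comp o_def case_prod_unfold)
  qed
  ultimately have eff: "efficient D (\<lambda>y l i. map_pmf (\<lambda>r. (rev r, []))
      (pmf_of_set {r :: bool list. length r = n l i}))"
    by simp
  let ?F = "\<lambda>l. {(i, v :: bool list). i \<in> D l \<and> length v = n l i}"
  have rev: "pt ?F (\<lambda>l z. rev (snd z))"
  proof (intro pt_rev pt_snd pt_input)
    show "bounded_on ?F (\<lambda>l z. length (snd z))"
      by (rule bounded_on_mono[OF bounded_on_fst[OF assms(2)]]) auto
  qed
  have "efficient D (\<lambda>y l i. map_pmf (\<lambda>(v, qs). (rev (snd (i, v)), qs))
      (map_pmf (\<lambda>r. (rev r, [])) (pmf_of_set {r :: bool list. length r = n l i})))"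
    by (rule efficient_map[OF eff rev]) auto
  then show ?thesis by (simp add: pmf.map_comp o_def)
qed

text \<open>Drawing without replacement: a uniform position of the remaining list is removed and its
  entry recorded. \<open>random_permutation_of_set\<close> decomposes a uniform permutation by the
  same recursion.\<close>

lemma efficient_random_permutation:
  assumes "pt D n" "bounded_on D n"
  shows "efficient D (\<lambda>y l i. map_pmf (\<lambda>\<pi>. (\<pi>, [])) (pmf_of_set (permutations_of_set {..<n l i})))"
proof -
  let ?draw = "\<lambda>(rest, acc) k. (take k rest @ drop (Suc k) rest, rest ! k # acc)"
  let ?step = "\<lambda>s. map_pmf (\<lambda>k. (?draw s k, [] :: nat list)) (pmf_of_set {..<length (fst s)})"
  let ?E = "\<lambda>l. {(i, (rest :: nat list, acc :: nat list)). i \<in> D l \<and> rest \<noteq> [] \<and> length rest \<le> n l i}"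
  have bE: "bounded_on ?E (\<lambda>l z. length (fst (snd z)))"
    by (rule bounded_on_mono[OF bounded_on_fst[OF assms(2)]]) auto
  have "efficient ?E (\<lambda>y l z. map_pmf (\<lambda>k. (k, [])) (if length (fst (snd z)) = 0 then return_pmf 0
      else pmf_of_set {..<length (fst (snd z))}))"
    by (intro efficient_rand pt_length pt_fst pt_snd pt_input bE)
  then have rand: "efficient ?E (\<lambda>y l z. map_pmf (\<lambda>k. (k, [])) (pmf_of_set {..<length (fst (snd z))}))"
    by (rule efficient_cong) auto
  let ?F = "\<lambda>l. {(z, k). z \<in> ?E l \<and> k < length (fst (snd z))}"
  have bF: "bounded_on ?F (\<lambda>l z. snd z)" "bounded_on ?F (\<lambda>l z. Suc (snd z))"
    by (rule bounded_on_mono[OF bounded_on_fst[OF bE]], auto)+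
  have "pt ?F (\<lambda>l z. (take (snd z) (fst (snd (fst z))) @ drop (Suc (snd z)) (fst (snd (fst z))),
      fst (snd (fst z)) ! snd z # snd (snd (fst z))))"
  proof (intro pt_pair pt_append pt_take pt_drop pt_Suc pt_nth pt_Cons pt_fst pt_snd pt_input bF)
    show "bounded_on ?F (\<lambda>l z. length (take (snd z) (fst (snd (fst z)))))"
      by (rule bounded_on_mono[OF bF(1)]) simp
  qed auto
  from efficient_map[OF rand this]
  have "efficient ?E (\<lambda>y l z. map_pmf (\<lambda>(k, qs). (?draw (snd z) k, qs))
      (map_pmf (\<lambda>k. (k, [])) (pmf_of_set {..<length (fst (snd z))})))"
    by (auto simp: case_prod_unfold set_pmf_of_set lessThan_empty_iff)
  then have step: "efficient ?E (\<lambda>y l z. ?step (snd z))"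
    by (simp add: pmf.map_comp o_def)
  have walk: "efficient D (\<lambda>y l i.
      wfold (\<lambda>_ s. ?step (snd (i, s))) (replicate (n l i) ()) ([0..<n l i], []))"
  proof (rule efficient_repeat[OF assms(1) _ assms(2) step,
        where Inv = "\<lambda>l i k s. length (fst s) = k \<and> k \<le> n l i"])
    show "pt D (\<lambda>l i. ([0..<n l i], []))" by (intro pt_pair pt_upt assms pt_const)
    show "length (fst s') = k \<and> k \<le> n l i"
      if "length (fst s) = Suc k \<and> Suc k \<le> n l i" "(s', qs) \<in> set_pmf (?step (snd (i, s)))"
      for l i k s s' and qs :: "nat list"
    proof -
      have "{..<length (fst s)} \<noteq> {}" using that(1) by (auto simp: lessThan_empty_iff)
      with that show ?thesis by (auto simp: set_pmf_of_set case_prod_unfold)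
    qed
  qed auto
  have result: "wfold (\<lambda>_. ?step) (replicate k ()) (rest, acc) =
      map_pmf (\<lambda>\<pi>. (([], rev \<pi> @ acc), [])) (pmf_of_set (permutations_of_set (set rest)))"
    if "length rest = k" "distinct rest" for k rest acc
    using that
  proof (induction k arbitrary: rest acc)
    case 0
    then show ?case by (simp add: wreturn_def pmf_of_set_singleton)
  next
    case (Suc k)
    let ?rest = "\<lambda>j. take j rest @ drop (Suc j) rest"
    have rest: "length (?rest j) = k" "distinct (?rest j)" "set (?rest j) = set rest - {rest ! j}"
      if "j < length rest" for j
    proof -
      have eq: "rest = take j rest @ rest ! j # drop (Suc j) rest"
        using that by (simp add: id_take_nth_drop)
      show "length (?rest j) = k" using that Suc.prems by simp
      have "distinct (take j rest @ rest ! j # drop (Suc j) rest)"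
        using Suc.prems(2) eq by simp
      then have d: "distinct (?rest j) \<and> rest ! j \<notin> set (?rest j)" by auto
      then show "distinct (?rest j)" by simp
      have "set rest = insert (rest ! j) (set (?rest j))"
        by (subst eq) auto
      with d show "set (?rest j) = set rest - {rest ! j}" by auto
    qed
    have ne: "{..<length rest} \<noteq> {}" using Suc.prems by (auto simp: lessThan_empty_iff)
    have "bij_betw ((!) rest) {..<length rest} (set rest)"
      using Suc.prems(2) by (rule bij_betw_nth) auto
    \<comment> \<open>For a distinct list, a uniform entry is the entry at a uniform
      position.\<close>
    then have uni: "pmf_of_set (set rest) = map_pmf ((!) rest) (pmf_of_set {..<length rest})"
      using ne by (intro map_pmf_of_set_bij_betw[symmetric]) auto
    have "wfold (\<lambda>_. ?step) (replicate (Suc k) ()) (rest, acc) =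
        bind_pmf (pmf_of_set {..<length rest}) (\<lambda>j.
          wfold (\<lambda>_. ?step) (replicate k ()) (?rest j, rest ! j # acc))"
      by (simp add: wbind_def bind_map_pmf case_prod_unfold)
    also have "\<dots> = bind_pmf (pmf_of_set {..<length rest}) (\<lambda>j.
        map_pmf (\<lambda>\<pi>. (([], rev \<pi> @ rest ! j # acc), []))
          (pmf_of_set (permutations_of_set (set rest - {rest ! j}))))"
    proof (rule bind_pmf_cong[OF refl])
      fix j assume "j \<in> set_pmf (pmf_of_set {..<length rest})"
      then have "j < length rest" using ne by simp
      from Suc.IH[OF rest(1,2)[OF this]] rest(3)[OF this]
      show "wfold (\<lambda>_. ?step) (replicate k ()) (?rest j, rest ! j # acc) =
        map_pmf (\<lambda>\<pi>. (([], rev \<pi> @ rest ! j # acc), []))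
          (pmf_of_set (permutations_of_set (set rest - {rest ! j})))"
        by simp
    qed
    also have "\<dots> = map_pmf (\<lambda>\<pi>. (([], rev \<pi> @ acc), [])) (pmf_of_set (permutations_of_set (set rest)))"
      using Suc.prems by (subst random_permutation_of_set)
        (auto simp: uni map_bind_pmf bind_map_pmf map_pmf_def[symmetric] pmf.map_comp o_def)
    finally show ?case .
  qed
  have eff: "efficient D (\<lambda>y l i. map_pmf (\<lambda>\<pi>. (([] :: nat list, rev \<pi>), []))
      (pmf_of_set (permutations_of_set {..<n l i})))"
    by (rule efficient_cong[OF walk], simp only: snd_conv, subst result)
      (simp_all add: atLeast0LessThan)
  let ?G = "\<lambda>l. {(i, (v :: nat list, w :: nat list)). i \<in> D l \<and> length w = n l i}"
  have rev: "pt ?G (\<lambda>l z. rev (snd (snd z)))"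
  proof (intro pt_rev pt_snd pt_input)
    show "bounded_on ?G (\<lambda>l z. length (snd (snd z)))"
      by (rule bounded_on_mono[OF bounded_on_fst[OF assms(2)]]) auto
  qed
  have "efficient D (\<lambda>y l i. map_pmf (\<lambda>(v, qs). (rev (snd (snd (i, v))), qs))
      (map_pmf (\<lambda>\<pi>. (([] :: nat list, rev \<pi>), [])) (pmf_of_set (permutations_of_set {..<n l i}))))"
    by (rule efficient_map[OF eff rev]) (auto simp: length_finite_permutations_of_set)
  then show ?thesis by (simp add: pmf.map_comp o_def)
qed

section \<open>The decoder\<close>

lemma run_ask_list:
  "run_alg y (ask_list is f) =
    (let (v, qs) = run_alg y (f (map (ask y) is)) in (v, is @ qs))"
  by (induction "is" arbitrary: f) (simp_all add: ask_def case_prod_unfold Let_def)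

lemma run_decode_blocks:
  "run_alg y (decode_blocks m dec sk js f) =
    (let pos = (\<lambda>j. map ((!) (fst sk)) [j * m..<(j + 1) * m]);
         (v, qs) = run_alg y (f (map (\<lambda>j. dec (xor_bits (map (ask y) (pos j))
           (take m (drop (j * m) (snd sk))))) js))
     in (v, concat (map pos js) @ qs))"
proof (induction js arbitrary: f)
  case (Cons j js)
  show ?case by (simp add: run_ask_list Cons Let_def case_prod_unfold)
qed simp

section \<open>Arithmetic of the blocks that meet an interval of message positions\<close>

lemma filter_upt_interval: "k \<le> n \<Longrightarrow> filter (\<lambda>j. i \<le> j \<and> j < k) [0..<n] = [i..<k]"
  by (rule sorted_distinct_set_unique) (auto intro: sorted_wrt_filter)

text \<open>Positions count from 1 and blocks from 0, so position \<open>L\<close> lies in block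
  \<open>(L - 1) div a\<close>; the blocks meeting an interval are consecutive.\<close>

lemma relevant_blocks:
  assumes "0 < a" "1 \<le> L" "L \<le> M" "M \<le> a * B"
  shows "filter (\<lambda>j. j * a < M \<and> L \<le> (j + 1) * a) [0..<B] = [(L - 1) div a..<Suc ((M - 1) div a)]"
proof -
  have "j * a < M \<longleftrightarrow> j < Suc ((M - 1) div a)" for j
  proof -
    have "j * a < M \<longleftrightarrow> j * a \<le> M - 1" using assms by linarith
    also have "\<dots> \<longleftrightarrow> j \<le> (M - 1) div a" using assms by (simp add: less_eq_div_iff_mult_less_eq)
    finally show ?thesis by linarith
  qed
  moreover have "L \<le> (j + 1) * a \<longleftrightarrow> (L - 1) div a \<le> j" for j
  proof -
    have "L \<le> (j + 1) * a \<longleftrightarrow> L - 1 < (j + 1) * a" using assms by linarith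
    also have "\<dots> \<longleftrightarrow> (L - 1) div a < j + 1" using assms by (simp add: div_less_iff_less_mult)
    finally show ?thesis by linarith
  qed
  moreover have "Suc ((M - 1) div a) \<le> B"
  proof -
    have "M - 1 < B * a" using assms by (simp add: mult.commute)
    then show ?thesis using assms by (simp add: Suc_le_eq div_less_iff_less_mult)
  qed
  ultimately show ?thesis by (simp add: filter_upt_interval conj_commute)
qed

lemma blockwise_interval:
  assumes "i \<le> k"
  shows "concat (map (\<lambda>j. f (take m (drop (j * m) xs))) [i..<k]) =
    blockwise f m (k - i) (drop (i * m) xs)"
proof -
  have "[i..<k] = map (\<lambda>j. i + j) [0..<k - i]" using assms by (intro nth_equalityI) simp_all
  then show ?thesis by (simp add: blockwise_def o_def algebra_simps)
qed

lemma blockwise_id: "blockwise id m k xs = take (k * m) xs"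
  by (induction k) (simp_all add: blockwise_def take_add add.commute[of m])

lemma blockwise_cong:
  "(\<And>j. j < k \<Longrightarrow> f (take m (drop (j * m) xs)) = g (take m' (drop (j * m') ys))) \<Longrightarrow>
    blockwise f m k xs = blockwise g m' k ys"
  unfolding blockwise_def by (intro arg_cong[of _ _ concat] map_cong) auto

lemma map_nth_block:
  assumes "(j + 1) * m \<le> length \<pi>"
  shows "map ((!) \<pi>) [j * m..<(j + 1) * m] = take m (drop (j * m) \<pi>)"
  using assms by (intro nth_equalityI) (auto simp: algebra_simps)

definition first_block :: "nat \<Rightarrow> nat \<Rightarrow> nat" where
  "first_block a L = (L - 1) div a"

definition num_blocks :: "nat \<Rightarrow> nat \<Rightarrow> nat \<Rightarrow> nat" where
  "num_blocks a L M = Suc ((M - 1) div a) - (L - 1) div a"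

lemma first_block_add_num_blocks:
  assumes "L \<le> M"
  shows "first_block a L + num_blocks a L M = Suc ((M - 1) div a)"
proof -
  have "(L - 1) div a \<le> (M - 1) div a" using assms by (intro div_le_mono) simp
  then show ?thesis unfolding first_block_def num_blocks_def by linarith
qed

lemma first_block_add_num_blocks_le:
  assumes "0 < a" "1 \<le> L" "L \<le> M" "M \<le> a * B"
  shows "first_block a L + num_blocks a L M \<le> B"
proof -
  have "M - 1 < B * a" using assms by (simp add: mult.commute)
  then show ?thesis
    using assms(1) by (simp add: first_block_add_num_blocks[OF assms(3)] Suc_le_eq div_less_iff_less_mult)
qed

text \<open>The first selected block starts \<open>(L - 1) mod a\<close> bits before position
  \<open>L\<close>, and the last one reaches at least to \<open>M\<close>, so nothing of the segment
  is cut off.\<close>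

lemma segment_eq_blocks:
  assumes "0 < a" "1 \<le> L" "L \<le> M"
  shows "segment L M x = take (M + 1 - L) (drop ((L - 1) mod a)
    (take (num_blocks a L M * a) (drop (first_block a L * a) x)))"
proof -
  have L: "(L - 1) mod a + first_block a L * a = L - 1"
    by (simp add: first_block_def)
  have "M - 1 < Suc ((M - 1) div a) * a"
    using dividend_less_div_times[OF assms(1), of "M - 1"] by simp
  then have "M \<le> first_block a L * a + num_blocks a L M * a"
    unfolding first_block_add_num_blocks[OF assms(3), symmetric] add_mult_distrib by linarith
  then have "M + 1 - L \<le> num_blocks a L M * a - (L - 1) mod a" using L assms by linarith
  then show ?thesis using L
    by (simp add: segment_def drop_take min_absorb1)
qed

definition dec_alg :: "nat \<Rightarrow> nat \<Rightarrow> nat \<Rightarrow> (bool list \<Rightarrow> bool list) \<Rightarrow> key \<Rightarrow> nat \<Rightarrow> nat \<Rightarrow>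
    bool list oracle_alg" where
  "dec_alg a A B dec sk L M = decode_blocks A dec sk
     (filter (\<lambda>j. j * a < M \<and> L \<le> (j + 1) * a) [0..<B])
     (\<lambda>ws. Done (take (M + 1 - L) (drop ((L - 1) mod a) (concat ws))))"

lemma con_dec_eq_dec_alg:
  "con_dec a A B decC l sk L M = return_pmf (dec_alg (a l) (A l) (B l) (decC l) sk L M)"
  by (simp add: con_dec_def dec_alg_def)

text \<open>Consecutive blocks own consecutive key entries, so all the queries form a single slice
  of the permutation.\<close>

definition queried :: "nat \<Rightarrow> nat \<Rightarrow> nat list \<Rightarrow> nat \<Rightarrow> nat \<Rightarrow> nat list" where
  "queried a A \<pi> L M = take (num_blocks a L M * A) (drop (first_block a L * A) \<pi>)"

lemma take_xor_bits: "take m (xor_bits u v) = xor_bits (take m u) (take m v)"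
  by (simp add: xor_bits_def take_map take_zip)

lemma drop_xor_bits: "drop m (xor_bits u v) = xor_bits (drop m u) (drop m v)"
  by (simp add: xor_bits_def drop_map drop_zip)

text \<open>The closed form behind both efficiency and correctness of the decoder. The oracle string
  is arbitrary, as \<open>ppt_oracle\<close> quantifies over all of them.\<close>

lemma run_dec_alg:
  assumes "0 < a" "1 \<le> L" "L \<le> M" "M \<le> a * B" and \<pi>: "length \<pi> = A * B"
  shows "run_alg y (dec_alg a A B dec (\<pi>, r) L M) =
    (take (M + 1 - L) (drop ((L - 1) mod a) (blockwise dec A (num_blocks a L M)
       (xor_bits (map (ask y) (queried a A \<pi> L M)) (drop (first_block a L * A) r)))),
     queried a A \<pi> L M)"
proof -
  let ?i = "first_block a L" and ?k = "num_blocks a L M"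
  have le: "?i \<le> Suc ((M - 1) div a)" "Suc ((M - 1) div a) - ?i = ?k"
    using first_block_add_num_blocks[OF assms(3), of a] by linarith+
  have js: "filter (\<lambda>j. j * a < M \<and> L \<le> (j + 1) * a) [0..<B] = [?i..<Suc ((M - 1) div a)]"
    using relevant_blocks[OF assms(1-4)] by (simp add: first_block_def)
  have block: "map ((!) \<pi>) [j * A..<(j + 1) * A] = take A (drop (j * A) \<pi>)"
    if "j \<in> set [?i..<Suc ((M - 1) div a)]" for j
  proof (rule map_nth_block)
    have "j + 1 \<le> B"
      using that first_block_add_num_blocks_le[OF assms(1-4)] first_block_add_num_blocks[OF assms(3), of a]
      by (simp del: upt_Suc)
    from mult_le_mono1[OF this, of A] show "(j + 1) * A \<le> length \<pi>" by (simp add: \<pi> mult.commute)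
  qed
  have "concat (map (\<lambda>j. map ((!) \<pi>) [j * A..<(j + 1) * A]) [?i..<Suc ((M - 1) div a)]) =
      concat (map (\<lambda>j. id (take A (drop (j * A) \<pi>))) [?i..<Suc ((M - 1) div a)])"
    by (intro arg_cong[of _ _ concat] map_cong refl) (use block in simp)
  also have "\<dots> = queried a A \<pi> L M"
    by (simp only: blockwise_interval[OF le(1)] le(2) blockwise_id queried_def)
  finally have pos: "concat (map (\<lambda>j. map ((!) \<pi>) [j * A..<(j + 1) * A]) [?i..<Suc ((M - 1) div a)]) =
      queried a A \<pi> L M" .
  have "concat (map (\<lambda>j. dec (xor_bits (map (ask y) (map ((!) \<pi>) [j * A..<(j + 1) * A]))
        (take A (drop (j * A) r)))) [?i..<Suc ((M - 1) div a)]) =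
      concat (map (\<lambda>j. dec (take A (drop (j * A) (xor_bits (map (ask y) \<pi>) r)))) [?i..<Suc ((M - 1) div a)])"
    by (intro arg_cong[of _ _ concat] map_cong refl)
      (use block in \<open>simp add: take_xor_bits drop_xor_bits take_map drop_map\<close>)
  also have "\<dots> = blockwise dec A ?k (drop (?i * A) (xor_bits (map (ask y) \<pi>) r))"
    by (simp only: blockwise_interval[OF le(1)] le(2))
  \<comment> \<open>A block of the queried slice is a block of the whole key, shifted by
    \<open>?i\<close>.\<close>
  also have "\<dots> = blockwise dec A ?k (xor_bits (map (ask y) (queried a A \<pi> L M)) (drop (?i * A) r))"
  proof (rule blockwise_cong)
    fix j assume "j < ?k"
    then have "(j + 1) * A \<le> ?k * A" by (intro mult_le_mono1) simp
    then have "min A (?k * A - j * A) = A" by (simp add: algebra_simps)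
    then have "take A (drop (j * A) (queried a A \<pi> L M)) = take A (drop (j * A + ?i * A) \<pi>)"
      by (simp add: queried_def drop_take)
    then show "dec (take A (drop (j * A) (drop (?i * A) (xor_bits (map (ask y) \<pi>) r)))) =
        dec (take A (drop (j * A) (xor_bits (map (ask y) (queried a A \<pi> L M)) (drop (?i * A) r))))"
      by (simp add: take_xor_bits drop_xor_bits drop_map take_map)
  qed
  finally show ?thesis
    unfolding dec_alg_def js run_decode_blocks Let_def
    by (simp only: fst_conv snd_conv run_alg.simps prod.case append_Nil2 pos)
qed

section \<open>Coordinates of codewords and correctness of decoding\<close>

lemma length_fold_list_update: "length (fold (\<lambda>i y. y[f i := g i]) is y) = length y"
  by (induction "is" arbitrary: y) simp_all

lemma length_permute [simp]: "length (permute \<pi> z) = length z"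
  by (simp add: permute_def length_fold_list_update)

text \<open>Since \<open>\<pi>\<close> is injective, a position once written is never
  overwritten.\<close>

lemma nth_permute:
  assumes "distinct \<pi>" "set \<pi> = {..<length z}" "length \<pi> = length z" "i < length z"
  shows "permute \<pi> z ! (\<pi> ! i) = z ! i"
proof -
  \<comment> \<open>Generalised to the first \<open>k\<close> writes for the induction.\<close>
  have "fold (\<lambda>i y. y[\<pi> ! i := z ! i]) [0..<k] (replicate (length z) False) ! (\<pi> ! i) = z ! i"
    if "i < k" "k \<le> length z" for k
    using that
  proof (induction k)
    case (Suc k)
    have "\<pi> ! i < length z" using assms nth_mem[of i \<pi>] by auto
    with Suc show ?case
      using assms nth_eq_iff_index_eq[OF assms(1), of i k]
      by (cases "i = k") (auto simp: length_fold_list_update)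
  qed simp
  from this[OF assms(4) order_refl] show ?thesis by (simp add: permute_def)
qed

lemma length_xor_bits [simp]: "length (xor_bits u v) = min (length u) (length v)"
  by (simp add: xor_bits_def)

lemma nth_xor_bits [simp]:
  "i < length u \<Longrightarrow> i < length v \<Longrightarrow> xor_bits u v ! i \<longleftrightarrow> u ! i \<noteq> v ! i"
  by (simp add: xor_bits_def)

lemma nth_blockwise:
  assumes "\<And>w. length w = m \<Longrightarrow> length (f w) = m'" "k * m \<le> length xs" "j < k" "i < m'"
  shows "blockwise f m k xs ! (j * m' + i) = f (take m (drop (j * m) xs)) ! i"
  using assms(2,3)
proof (induction k)
  case (Suc k)
  have len: "length (blockwise f m k xs) = k * m'"
    using Suc.prems by (intro length_blockwise assms(1)) auto
  have split: "blockwise f m (Suc k) xs = blockwise f m k xs @ f (take m (drop (k * m) xs))"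
    by (simp add: blockwise_def)
  show ?case
  proof (cases "j = k")
    case False
    with Suc.prems have "j < k" by simp
    then have "(j + 1) * m' \<le> k * m'" by (intro mult_le_mono1) simp
    then have "j * m' + i < k * m'" using assms(4) by simp
    with \<open>j < k\<close> Suc show ?thesis by (simp add: split nth_append len)
  qed (simp add: split nth_append len)
qed simp

lemma nth_permute_xor_blockwise:
  assumes code: "is_code A a enc dec" and x: "length x = a * B"
    and \<pi>: "distinct \<pi>" "set \<pi> = {..<A * B}" "length \<pi> = A * B" and r: "length r = A * B"
    and ji: "j < B" "i < A"
  shows "permute \<pi> (xor_bits (blockwise enc a B x) r) ! (\<pi> ! (j * A + i)) \<longleftrightarrow>
    enc (take a (drop (j * a) x)) ! i \<noteq> r ! (j * A + i)"
proof -
  have enc: "length (enc w) = A" if "length w = a" for w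
    using code that by (simp add: is_code_def)
  have len: "length (blockwise enc a B x) = A * B"
    using length_blockwise[of a enc A B x] enc x by (simp add: mult.commute)
  have "(j + 1) * A \<le> B * A" using ji by (intro mult_le_mono1) simp
  then have lt: "j * A + i < A * B" using ji by (simp add: mult.commute)
  with nth_permute[of \<pi> "xor_bits (blockwise enc a B x) r" "j * A + i"] \<pi> r len
  have "permute \<pi> (xor_bits (blockwise enc a B x) r) ! (\<pi> ! (j * A + i)) \<longleftrightarrow>
      blockwise enc a B x ! (j * A + i) \<noteq> r ! (j * A + i)"
    by simp
  moreover have "B * a \<le> length x" by (simp add: x)
  ultimately show ?thesis using nth_blockwise[of a enc A B x j i] enc ji by simp
qed

text \<open>The pad cancels: the word given to \<open>dec\<close> differs from the encoded block at
  exactly the indices whose images under the permutation were corrupted. Its Hamming distance is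
  thus the count in \<open>errors\<close>, which is within the tolerance.\<close>

lemma decoding_correct:
  assumes code: "is_code A a enc dec" "error_tolerance A a \<delta> enc dec"
    and a: "0 < a" and LM: "1 \<le> L" "L \<le> M" "M \<le> a * B" and x: "length x = a * B"
    and \<pi>: "distinct \<pi>" "set \<pi> = {..<A * B}" "length \<pi> = A * B" and r: "length r = A * B"
    and y: "length y = A * B"
    and Y: "Y = permute \<pi> (xor_bits (blockwise enc a B x) r)"
    and errors: "\<And>j. j < B \<Longrightarrow>
      real (card {i \<in> {j * A..<(j + 1) * A}. Y ! (\<pi> ! i) \<noteq> y ! (\<pi> ! i)}) \<le> \<delta> * real A"
  shows "fst (run_alg y (dec_alg a A B dec (\<pi>, r) L M)) = segment L M x"
proof -
  let ?i = "first_block a L" and ?k = "num_blocks a L M"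
  have enc: "length (enc w) = A" if "length w = a" for w
    using code(1) that by (simp add: is_code_def)
  let ?u = "xor_bits (map (ask y) (queried a A \<pi> L M)) (drop (?i * A) r)"
  have "blockwise dec A ?k ?u = blockwise id a ?k (drop (?i * a) x)"
  proof (rule blockwise_cong)
    fix j assume j: "j < ?k"
    \<comment> \<open>The absolute index of the block; \<open>j\<close> counts from the first
      decoded block.\<close>
    define j' where "j' = ?i + j"
    have j': "j' < B" using j first_block_add_num_blocks_le[OF a LM] by (simp add: j'_def)
    have le: "(j' + 1) * m \<le> m * B" for m using mult_le_mono1[of "j' + 1" B m] j' by (simp add: mult.commute)
    have "(j + 1) * A \<le> ?k * A" using j by (intro mult_le_mono1) simp
    then have "min A (?k * A - j * A) = A" by (simp add: algebra_simps)
    then have q: "take A (drop (j * A) (queried a A \<pi> L M)) = take A (drop (j' * A) \<pi>)"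
      by (simp add: queried_def drop_take j'_def algebra_simps)
    let ?v = "take A (drop (j * A) ?u)"
    let ?w = "take a (drop (j' * a) x)"
    have v: "?v = xor_bits (map (ask y) (take A (drop (j' * A) \<pi>))) (take A (drop (j' * A) r))"
      by (simp add: take_xor_bits drop_xor_bits take_map drop_map q)
        (simp add: j'_def algebra_simps)
    have len: "length ?v = A" using le[of A] by (simp add: v \<pi> r)
    have w: "length ?w = a" using le[of a] by (simp add: x)
    have nth: "?v ! i \<longleftrightarrow> y ! (\<pi> ! (j' * A + i)) \<noteq> r ! (j' * A + i)" if "i < A" for i
    proof -
      have lt: "j' * A + i < A * B" using that le[of A] by simp
      then have "\<pi> ! (j' * A + i) < A * B" using \<pi> nth_mem[of "j' * A + i" \<pi>] by auto
      moreover have "j' * A \<le> A * B" using lt by linarith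
      ultimately show ?thesis using that lt le[of A] by (simp add: v \<pi> r y ask_def)
    qed
    let ?X = "{i. i < A \<and> Y ! (\<pi> ! (j' * A + i)) \<noteq> y ! (\<pi> ! (j' * A + i))}"
    have "enc ?w ! i \<noteq> ?v ! i \<longleftrightarrow> Y ! (\<pi> ! (j' * A + i)) \<noteq> y ! (\<pi> ! (j' * A + i))" if "i < A" for i
      using nth_permute_xor_blockwise[OF code(1) x \<pi> r j' that, folded Y] nth[OF that] by blast
    then have "hamming (enc ?w) ?v = card ?X"
      unfolding hamming_def enc[OF w] by (intro arg_cong[of _ _ card]) blast
    \<comment> \<open>Translation by the start of the block turns indices within the block into
      indices of the whole codeword, the form used in \<open>errors\<close>.\<close>
    also have "\<dots> = card ((\<lambda>i. j' * A + i) ` ?X)"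
      by (rule card_image[symmetric]) simp
    also have "(\<lambda>i. j' * A + i) ` ?X = {i \<in> {j' * A..<(j' + 1) * A}. Y ! (\<pi> ! i) \<noteq> y ! (\<pi> ! i)}"
    proof (intro equalityI subsetI)
      fix i assume i: "i \<in> {i \<in> {j' * A..<(j' + 1) * A}. Y ! (\<pi> ! i) \<noteq> y ! (\<pi> ! i)}"
      then obtain k where k: "i = j' * A + k" using le_Suc_ex[of "j' * A" i] by auto
      with i have "k \<in> ?X" by simp
      with k show "i \<in> (\<lambda>i. j' * A + i) ` ?X" by (rule image_eqI)
    qed auto
    finally have hamming: "hamming (enc ?w) ?v =
        card {i \<in> {j' * A..<(j' + 1) * A}. Y ! (\<pi> ! i) \<noteq> y ! (\<pi> ! i)}" .
    from errors[OF j', folded hamming] have "dec ?v = ?w"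
      by (rule code(2)[unfolded error_tolerance_def, rule_format, OF w len])
    then show "dec ?v = id (take a (drop (j * a) (drop (?i * a) x)))"
      by (simp add: j'_def algebra_simps)
  qed
  then show ?thesis
    using segment_eq_blocks[OF a LM(1,2), of x] by (simp add: run_dec_alg[OF a LM \<pi>(3)] blockwise_id)
qed

section \<open>The algorithms of the construction\<close>

lemma set_con_gen:
  "set_pmf (con_gen A B l) = permutations_of_set {..<A l * B l} \<times> {r. length r = A l * B l}"
  by (simp add: con_gen_def)

lemma con_genD:
  assumes "(\<pi>, r) \<in> set_pmf (con_gen A B l)"
  shows "distinct \<pi>" "set \<pi> = {..<A l * B l}" "length \<pi> = A l * B l" "length r = A l * B l"
  using assms by (auto simp: set_con_gen length_finite_permutations_of_set dest: permutations_of_setD)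

lemma con_enc_eq:
  "con_enc a B encC l (\<pi>, r) x =
    return_pmf (permute \<pi> (xor_bits (blockwise (encC l) (a l) (B l) x) r))"
  by (simp add: con_enc_def blockwise_def)

text \<open>The security parameter is part of every program input, so whatever is computable from it
  is available on every domain.\<close>

lemma pt_param:
  assumes "pt (\<lambda>l. {()}) (\<lambda>l _. n l)"
  shows "pt D (\<lambda>l i. n l)"
  by (rule pt_comp[OF pt_const[of D "()"] assms]) simp

text \<open>
  Since \<open>R\<close> is an arbitrary real, \<open>A = a / R\<close> cannot be computed from
  \<open>a\<close> alone; it is read off as the length of a codeword.
\<close>

lemma pt_codeword_length:
  fixes encC :: "nat \<Rightarrow> bool list \<Rightarrow> bool list"
  assumes a: "pt (\<lambda>l. {()}) (\<lambda>l _. a l)" "polynomially_bounded a" and "polynomially_bounded A"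
    and enc: "pt (\<lambda>l. {w. length w = a l}) encC" "\<And>l w. length w = a l \<Longrightarrow> length (encC l w) = A l"
  shows "pt (\<lambda>l. {()}) (\<lambda>l _. A l)"
proof -
  have "pt (\<lambda>l. {()}) (\<lambda>l _. encC l (replicate (a l) False))"
    by (rule pt_comp[OF pt_replicate[OF a(1) bounded_on_param[OF a(2)]] enc(1)]) simp
  then have "pt (\<lambda>l. {()}) (\<lambda>l _. length (encC l (replicate (a l) False)))"
    by (rule pt_length) (simp add: enc(2) bounded_on_param[OF assms(3)])
  then show ?thesis by (simp add: enc(2))
qed

lemma ppt_con_gen:
  assumes A: "pt (\<lambda>l. {()}) (\<lambda>l _. A l)" "polynomially_bounded A"
    and B: "pt (\<lambda>l. {()}) (\<lambda>l _. B l)" "polynomially_bounded B"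
  shows "ppt (\<lambda>l. {()}) (\<lambda>l _. con_gen A B l)"
proof -
  have pt_n: "pt D (\<lambda>l i. A l * B l)" for D :: "nat \<Rightarrow> 'i :: repr set"
    by (intro pt_mult pt_param[OF A(1)] pt_param[OF B(1)] bounded_on_param[OF A(2)] bounded_on_param[OF B(2)])
  have bounded_n: "bounded_on D (\<lambda>l i. A l * B l)" for D :: "nat \<Rightarrow> 'i set"
    by (rule bounded_on_mult[OF bounded_on_param[OF A(2)] bounded_on_param[OF B(2)]])
  let ?P = "\<lambda>l. pmf_of_set (permutations_of_set {..<A l * B l})"
  let ?R = "\<lambda>l. pmf_of_set {r :: bool list. length r = A l * B l}"
  let ?E = "\<lambda>_. UNIV :: (unit \<times> nat list) set" and ?F = "\<lambda>_. UNIV :: ((unit \<times> nat list) \<times> bool list) set"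
  have "pt ?F (\<lambda>l z. (snd (fst z), snd z))"
    by (intro pt_pair pt_fst pt_snd pt_input)
  from efficient_map[OF efficient_random_bits[OF pt_n bounded_n, of ?E] this]
  have "efficient ?E (\<lambda>y l z. map_pmf (\<lambda>r. ((snd z, r), [])) (?R l))"
    by (simp add: pmf.map_comp o_def)
  from efficient_bind[OF efficient_random_permutation[OF pt_n bounded_n, of "\<lambda>l. {()}"] this]
  show ?thesis
    by (simp add: ppt_iff_efficient con_gen_def pair_pmf_def wbind_def map_bind_pmf bind_map_pmf
        pmf.map_comp o_def map_pmf_def[symmetric] case_prod_unfold)
qed

lemma ppt_con_enc:
  assumes a: "pt (\<lambda>l. {()}) (\<lambda>l _. a l)" "polynomially_bounded a" and "polynomially_bounded A"
    and B: "pt (\<lambda>l. {()}) (\<lambda>l _. B l)" "polynomially_bounded B"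
    and enc: "pt (\<lambda>l. {w. length w = a l}) encC" "\<And>l w. length w = a l \<Longrightarrow> length (encC l w) = A l"
  shows "ppt (\<lambda>l. {(sk, x). sk \<in> set_pmf (con_gen A B l) \<and> length x = a l * B l})
    (\<lambda>l (sk, x). con_enc a B encC l sk x)"
proof -
  let ?D = "\<lambda>l. {(sk, x). sk \<in> set_pmf (con_gen A B l) \<and> length x = a l * B l}"
  let ?z = "\<lambda>l i. blockwise (encC l) (a l) (B l) (snd i)"
  have bounded_n: "bounded_on D (\<lambda>l i. A l * B l)" for D :: "nat \<Rightarrow> 'i set"
    by (rule bounded_on_mult[OF bounded_on_param[OF assms(3)] bounded_on_param[OF B(2)]])
  have len: "length (?z l i) = A l * B l" if "i \<in> ?D l" for l i
    using length_blockwise[of "a l" "encC l" "A l" "B l" "snd i"] that by (auto simp: enc(2) mult.commute)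
  have key: "length (fst (fst i)) = A l * B l" "length (snd (fst i)) = A l * B l"
    "set (fst (fst i)) = {..<A l * B l}" if "i \<in> ?D l" for l i
    using that con_genD[of "fst (fst i)" "snd (fst i)" A B l] by auto
  have z: "pt ?D ?z"
    by (rule pt_blockwise[OF pt_param[OF a(1)] pt_param[OF B(1)] pt_snd[OF pt_input] enc(1)
          bounded_on_param[OF B(2)] a(2) assms(3)])
      (auto simp: enc(2) mult.commute)
  have xor: "pt ?D (\<lambda>l i. xor_bits (?z l i) (snd (fst i)))"
    by (intro pt_xor_bits z pt_fst pt_snd pt_input, rule bounded_on_mono[OF bounded_n])
      (simp_all add: len key)
  have "pt ?D (\<lambda>l i. permute (fst (fst i)) (xor_bits (?z l i) (snd (fst i))))"
  proof (rule pt_permute[OF pt_fst[OF pt_fst[OF pt_input]] xor])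
    show "bounded_on ?D (\<lambda>l i. length (xor_bits (?z l i) (snd (fst i))))"
      by (rule bounded_on_mono[OF bounded_n]) (simp add: len)
  qed (simp_all add: len key)
  then show ?thesis
    by (auto simp: ppt_iff_efficient pt_def wreturn_def con_enc_eq elim!: efficient_cong)
qed

text \<open>Two stages suffice because no query depends on an earlier answer: all positions are
  computed and asked first, then the answers are processed deterministically.\<close>

lemma ppt_con_dec:
  assumes a: "pt (\<lambda>l. {()}) (\<lambda>l _. a l)" "polynomially_bounded a"
    and A: "pt (\<lambda>l. {()}) (\<lambda>l _. A l)" "polynomially_bounded A" and B: "polynomially_bounded B"
    and dec: "pt (\<lambda>l. {v. length v = A l}) decC" "\<And>l v. length v = A l \<Longrightarrow> length (decC l v) = a l"
  shows "ppt_oracle (\<lambda>l. {(sk, L, M). sk \<in> set_pmf (con_gen A B l) \<and> 1 \<le> L \<and> L \<le> M \<and> M \<le> a l * B l})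
    (\<lambda>l (sk, L, M). con_dec a A B decC l sk L M)"
proof -
  let ?D = "\<lambda>l. {(sk, L, M). sk \<in> set_pmf (con_gen A B l) \<and> 1 \<le> L \<and> L \<le> M \<and> M \<le> a l * B l}"
  note pt_a = pt_param[OF a(1)] and pt_A = pt_param[OF A(1)]
  note bounded_a = bounded_on_param[OF a(2)] and bounded_A = bounded_on_param[OF A(2)]
    and bounded_B = bounded_on_param[OF B]
  define \<pi> where "\<pi> l i = fst (fst i)" for l :: nat and i :: "key \<times> nat \<times> nat"
  define r where "r l i = snd (fst i)" for l :: nat and i :: "key \<times> nat \<times> nat"
  define L where "L l i = fst (snd i)" for l :: nat and i :: "key \<times> nat \<times> nat"
  define M where "M l i = snd (snd i)" for l :: nat and i :: "key \<times> nat \<times> nat"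
  define fb where "fb l i = first_block (a l) (L l i)" for l i
  define nb where "nb l i = num_blocks (a l) (L l i) (M l i)" for l i
  \<comment> \<open>A nonempty interval below \<open>a l * B l\<close> forces \<open>a l\<close> to
    be positive, so division by it is legitimate.\<close>
  have D: "(\<pi> l i, r l i) \<in> set_pmf (con_gen A B l)" "1 \<le> L l i" "L l i \<le> M l i" "M l i \<le> a l * B l"
    "0 < a l" if "i \<in> ?D l" for l i
    using that by (auto simp: \<pi>_def r_def L_def M_def intro!: gr0I)
  have blocks: "fb l i + nb l i \<le> B l" if "i \<in> ?D l" for l i
    using first_block_add_num_blocks_le[OF D(5,2,3,4)[OF that]] by (simp add: fb_def nb_def)
  note key = con_genD[OF D(1)]
  have pt_key: "pt ?D \<pi>" "pt ?D r" and pt_L: "pt ?D L" and pt_M: "pt ?D M"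
    unfolding \<pi>_def r_def L_def M_def by (intro pt_fst pt_snd pt_input)+
  have bounded_M: "bounded_on ?D (\<lambda>l i. M l i)"
    by (rule bounded_on_mono[OF bounded_on_mult[OF bounded_a bounded_B] D(4)])
  have bounded_L: "bounded_on ?D (\<lambda>l i. L l i)"
    by (rule bounded_on_mono[OF bounded_M D(3)])
  have bounded_pred: "bounded_on ?D (\<lambda>l i. L l i - 1)" "bounded_on ?D (\<lambda>l i. M l i - 1)"
    by (rule bounded_on_mono[OF bounded_L] bounded_on_mono[OF bounded_M], simp)+
  have bounded_blocks: "bounded_on ?D fb" "bounded_on ?D nb"
    by (rule bounded_on_mono[OF bounded_B], drule blocks, simp)+
  have div: "pt ?D (\<lambda>l i. (L l i - 1) div a l)" "pt ?D (\<lambda>l i. (M l i - 1) div a l)"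
    and skip: "pt ?D (\<lambda>l i. (L l i - 1) mod a l)"
    using D(5) by (intro pt_div_mod pt_pred pt_L pt_M pt_a bounded_a bounded_pred; blast)+
  have fb: "pt ?D fb" using div(1) by (simp add: fb_def[abs_def] first_block_def)
  have nb: "pt ?D nb"
    unfolding nb_def[abs_def] num_blocks_def using bounded_blocks(1)
    by (intro pt_diff pt_Suc div) (simp add: fb_def[abs_def] first_block_def)
  have start: "pt ?D (\<lambda>l i. fb l i * A l)" "bounded_on ?D (\<lambda>l i. fb l i * A l)"
    by (intro pt_mult fb pt_A bounded_on_mult bounded_blocks bounded_A)+
  have amount: "pt ?D (\<lambda>l i. nb l i * A l)" "bounded_on ?D (\<lambda>l i. nb l i * A l)"
    by (intro pt_mult nb pt_A bounded_on_mult bounded_blocks bounded_A)+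
  have width: "pt ?D (\<lambda>l i. Suc (M l i) - L l i)" "bounded_on ?D (\<lambda>l i. Suc (M l i) - L l i)"
    by (intro pt_diff pt_Suc pt_L pt_M bounded_L, rule bounded_on_mono[OF bounded_M])
      (use D(2) in fastforce)
  have bounded_skip: "bounded_on ?D (\<lambda>l i. (L l i - 1) mod a l)"
    by (rule bounded_on_mono[OF bounded_pred(1)]) simp
  define ps where "ps l i = queried (a l) (A l) (\<pi> l i) (L l i) (M l i)" for l i
  have ps: "pt ?D ps"
    unfolding ps_def[abs_def] queried_def fb_def[symmetric] nb_def[symmetric]
    by (intro pt_take pt_drop start amount pt_key)
  have len_ps: "length (ps l i) = nb l i * A l" if "i \<in> ?D l" for l i
  proof -
    have "(fb l i + nb l i) * A l \<le> B l * A l" by (rule mult_le_mono1[OF blocks[OF that]])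
    then show ?thesis
      unfolding ps_def queried_def fb_def[symmetric] nb_def[symmetric]
      by (simp add: key(3)[OF that] algebra_simps)
  qed
  \<comment> \<open>With a shorter pad the exclusive or would be truncated, and the last block would
    leave the domain of \<open>decC\<close>.\<close>
  have len_r: "nb l i * A l \<le> length (drop (fb l i * A l) (r l i))" if "i \<in> ?D l" for l i
  proof -
    have "(fb l i + nb l i) * A l \<le> B l * A l" by (rule mult_le_mono1[OF blocks[OF that]])
    then show ?thesis by (simp add: key(4)[OF that] algebra_simps)
  qed
  obtain N where N: "polynomially_bounded N" "\<And>l. A l * B l \<le> N l"
    using polynomially_bounded_mult[OF A(2) B] by blast
  have answers: "efficient ?D (\<lambda>y l i. return_pmf (map (ask y) (ps l i), ps l i))"
  proof (rule efficient_ask_all[OF ps _ N(1)])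
    show "bounded_on ?D (\<lambda>l i. length (ps l i))"
      by (rule bounded_on_mono[OF amount(2)]) (simp add: len_ps)
    show "p \<le> N l" if "i \<in> ?D l" "p \<in> set (ps l i)" for l i p
    proof -
      have "p \<in> set (\<pi> l i)"
        using that(2) unfolding ps_def queried_def by (meson in_set_takeD in_set_dropD)
      then show ?thesis using key(2)[OF that(1)] N(2)[of l] by auto
    qed
  qed
  let ?E = "\<lambda>l. {(i, v :: bool list). i \<in> ?D l \<and> length v = nb l i * A l}"
  \<comment> \<open>The processing of the answers \<open>snd z\<close>, in the form given by
    \<open>run_dec_alg\<close>.\<close>
  define g where "g l z = take (Suc (M l (fst z)) - L l (fst z)) (drop ((L l (fst z) - 1) mod a l)
    (blockwise (decC l) (A l) (nb l (fst z))
      (xor_bits (snd z) (drop (fb l (fst z) * A l) (r l (fst z))))))" for l and z :: "_ \<times> bool list"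
  have lift: "pt ?E (\<lambda>l z. f l (fst z))" if "pt ?D f" for f :: "nat \<Rightarrow> key \<times> nat \<times> nat \<Rightarrow> 'z :: repr"
    by (rule pt_comp[OF pt_fst[OF pt_input] that]) auto
  have blift: "bounded_on ?E (\<lambda>l z. f l (fst z))" if "bounded_on ?D f" for f
    by (rule bounded_on_fst[OF that]) auto
  have bv: "bounded_on ?E (\<lambda>l z. length (snd z))"
    by (rule bounded_on_mono[OF blift[OF amount(2)]]) auto
  have xor: "pt ?E (\<lambda>l z. xor_bits (snd z) (drop (fb l (fst z) * A l) (r l (fst z))))"
    using len_r by (intro pt_xor_bits pt_snd pt_input pt_drop lift[OF start(1)] blift[OF start(2)]
        lift[OF pt_key(2)] bv) auto
  have "pt ?E (\<lambda>l z. blockwise (decC l) (A l) (nb l (fst z))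
      (xor_bits (snd z) (drop (fb l (fst z) * A l) (r l (fst z)))))"
    by (rule pt_blockwise[OF pt_A lift[OF nb] xor dec(1) blift[OF bounded_blocks(2)] A(2) a(2)])
      (use len_r in \<open>auto simp: dec(2)\<close>)
  then have "pt ?E g"
    unfolding g_def[abs_def]
    by (intro pt_take pt_drop lift[OF width(1)] lift[OF skip] blift[OF width(2)] blift[OF bounded_skip])
  then have "efficient ?D (\<lambda>y l i. map_pmf (\<lambda>(v, qs). (g l (i, v), qs))
      (return_pmf (map (ask y) (ps l i), ps l i)))"
    by (rule efficient_map[OF answers]) (auto simp: len_ps)
  then have "efficient ?D (\<lambda>y l i. map_pmf (run_alg y) (case i of (sk, L, M) \<Rightarrow> con_dec a A B decC l sk L M))"
  proof (rule efficient_cong)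
    fix y l i assume i: "i \<in> ?D l"
    have "(case i of (sk, L, M) \<Rightarrow> con_dec a A B decC l sk L M) =
        con_dec a A B decC l (\<pi> l i, r l i) (L l i) (M l i)"
      by (simp add: case_prod_unfold \<pi>_def r_def L_def M_def)
    then show "map_pmf (\<lambda>(v, qs). (g l (i, v), qs)) (return_pmf (map (ask y) (ps l i), ps l i)) =
        map_pmf (run_alg y) (case i of (sk, L, M) \<Rightarrow> con_dec a A B decC l sk L M)"
      by (simp add: con_dec_eq_dec_alg run_dec_alg[OF D(5,2,3,4)[OF i] key(3)[OF i]]
          g_def ps_def fb_def nb_def)
  qed
  then show ?thesis by (simp add: efficient_iff_ppt_oracle)
qed

section \<open>Hypergeometric probabilities and the union bound over blocks\<close>

section \<open>Random permutations\<close>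

text \<open>The entries at the positions in \<open>T\<close> form a uniform set of size
  \<open>card T\<close>. The induction draws the first entry \<open>x\<close>; the rest is a uniform
  permutation of \<open>U - {x}\<close>, with the positions shifted down by one. If position 0 is in
  \<open>T\<close>, only \<open>x\<close> in \<open>S\<close> contributes; otherwise
  \<open>x\<close> inside and outside of \<open>S\<close> contribute different binomial
  coefficients.\<close>

lemma prob_permutation_hits:
  assumes "finite U" "card U = n" "S \<subseteq> U" "T \<subseteq> {..<n}"
  shows "pmf (map_pmf (\<lambda>\<pi>. \<forall>i\<in>T. \<pi> ! i \<in> S) (pmf_of_set (permutations_of_set U))) True =
    real (card S choose card T) / real (n choose card T)"
  using assms
proof (induction n arbitrary: U S T)
  case 0
  then show ?case by (simp add: pmf_of_set_singleton)
next
  case (Suc n)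
  let ?T = "{i. Suc i \<in> T}"
  have T: "?T \<subseteq> {..<n}" using Suc.prems by auto
  \<comment> \<open>The common end of both cases: \<open>x * m = y * k\<close> is an absorption
    identity for binomial coefficients.\<close>
  have frac: "k * c / x / m = c / y" if "x * m = y * k" "0 < k" for c k m x y :: real
    using that by (simp add: divide_divide_eq_left)
  have finT: "finite T" using Suc.prems(4) finite_subset by blast
  have finS: "finite S" using Suc.prems finite_subset by blast
  have ne: "U \<noteq> {}" using Suc.prems by auto
  let ?hits = "\<lambda>T S U. map_pmf (\<lambda>\<pi>. \<forall>i\<in>T. \<pi> ! i \<in> S) (pmf_of_set (permutations_of_set U))"
  \<comment> \<open>The tail never contains \<open>x\<close>, so \<open>S\<close> can be shrunk to a
    subset of \<open>U - {x}\<close>, as the induction hypothesis requires.\<close>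
  have tail: "?hits ?T S (U - {x}) = ?hits ?T (S - {x}) (U - {x})" for x
  proof (rule map_pmf_cong[OF refl])
    fix \<pi> assume "\<pi> \<in> set_pmf (pmf_of_set (permutations_of_set (U - {x})))"
    then have \<pi>: "\<pi> \<in> permutations_of_set (U - {x})" using Suc.prems(1) by simp
    have "\<pi> ! i \<noteq> x" if "i \<in> ?T" "x \<in> U" for i
    proof -
      have "length \<pi> = n"
        using length_finite_permutations_of_set[OF \<pi>] Suc.prems(2) that by simp
      then have "\<pi> ! i \<in> set \<pi>" using that T by (intro nth_mem) auto
      then show ?thesis using permutations_of_setD(1)[OF \<pi>] by auto
    qed
    then show "(\<forall>i\<in>?T. \<pi> ! i \<in> S) = (\<forall>i\<in>?T. \<pi> ! i \<in> S - {x})"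
      using Suc.prems(3) by blast
  qed
  have IH: "pmf (?hits ?T S (U - {x})) True = real (card (S - {x}) choose card ?T) / real (n choose card ?T)"
    if "x \<in> U" for x
    unfolding tail using Suc.prems that T by (intro Suc.IH) auto
  have all: "(\<forall>i\<in>T. (x # \<pi>) ! i \<in> S) \<longleftrightarrow> (0 \<in> T \<longrightarrow> x \<in> S) \<and> (\<forall>i\<in>?T. \<pi> ! i \<in> S)" for x \<pi>
  proof -
    have "(\<forall>i. Q i) \<longleftrightarrow> Q 0 \<and> (\<forall>i. Q (Suc i))" for Q :: "nat \<Rightarrow> bool"
      by (metis not0_implies_Suc)
    from this[of "\<lambda>i. i \<in> T \<longrightarrow> (x # \<pi>) ! i \<in> S"] show ?thesis by (simp add: Ball_def)
  qed
  have "?hits T S U = bind_pmf (pmf_of_set U) (\<lambda>x.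
      map_pmf (\<lambda>\<pi>. (0 \<in> T \<longrightarrow> x \<in> S) \<and> (\<forall>i\<in>?T. \<pi> ! i \<in> S)) (pmf_of_set (permutations_of_set (U - {x}))))"
    by (subst random_permutation_of_set[OF Suc.prems(1) ne])
      (simp add: map_bind_pmf map_pmf_def[symmetric] pmf.map_comp o_def all)
  then have "pmf (?hits T S U) True = (\<Sum>x\<in>U. pmf (map_pmf (\<lambda>\<pi>. (0 \<in> T \<longrightarrow> x \<in> S) \<and>
      (\<forall>i\<in>?T. \<pi> ! i \<in> S)) (pmf_of_set (permutations_of_set (U - {x})))) True) / real (Suc n)"
    using Suc.prems by (simp only: pmf_bind_pmf_of_set[OF ne Suc.prems(1)])
  also have "\<dots> = (\<Sum>x\<in>U. if 0 \<in> T \<longrightarrow> x \<in> S then real (card (S - {x}) choose card ?T) / real (n choose card ?T)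
      else 0) / real (Suc n)"
  proof (intro arg_cong2[of _ _ _ _ "(/)"] sum.cong refl)
    fix x assume x: "x \<in> U"
    show "pmf (map_pmf (\<lambda>\<pi>. (0 \<in> T \<longrightarrow> x \<in> S) \<and> (\<forall>i\<in>?T. \<pi> ! i \<in> S))
        (pmf_of_set (permutations_of_set (U - {x})))) True =
      (if 0 \<in> T \<longrightarrow> x \<in> S then real (card (S - {x}) choose card ?T) / real (n choose card ?T) else 0)"
    proof (cases "0 \<in> T \<longrightarrow> x \<in> S")
      case True
      then have eq: "(0 \<in> T \<longrightarrow> x \<in> S) = True" by simp
      show ?thesis unfolding eq simp_thms if_True by (rule IH[OF x])
    next
      case False
      then show ?thesis by simp
    qed
  qed
  also have "\<dots> = real (card S choose card T) / real (Suc n choose card T)"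
  proof (cases "0 \<in> T")
    case True
    have "T = insert 0 (Suc ` ?T)"
      using True by (auto simp: image_iff) (metis not0_implies_Suc)
    then have cT: "card T = Suc (card ?T)"
      using finT by (metis (no_types, lifting) card_image card_insert_disjoint finite_insert
          imageE inj_Suc nat.distinct(1))
    have "(\<Sum>x\<in>U. if 0 \<in> T \<longrightarrow> x \<in> S then real (card (S - {x}) choose card ?T) / real (n choose card ?T) else 0) =
        (\<Sum>x\<in>S. real (card (S - {x}) choose card ?T) / real (n choose card ?T))"
      using True Suc.prems(1,3) by (intro sum.mono_neutral_cong_right) auto
    also have "\<dots> = real (card S * ((card S - 1) choose card ?T)) / real (n choose card ?T)"
      using finS by simp
    also have "card S * ((card S - 1) choose card ?T) = Suc (card ?T) * (card S choose Suc (card ?T))"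
      by (simp only: binomial_absorption)
    finally have *: "(\<Sum>x\<in>U. if 0 \<in> T \<longrightarrow> x \<in> S then real (card (S - {x}) choose card ?T) / real (n choose card ?T) else 0) =
      real (Suc (card ?T) * (card S choose Suc (card ?T))) / real (n choose card ?T)" .
    have "real (n choose card ?T) * real (Suc n) = real (Suc n choose card T) * real (Suc (card ?T))"
      unfolding cT of_nat_mult[symmetric] Suc_times_binomial_eq[symmetric] by (simp add: mult.commute)
    from frac[OF this] show ?thesis unfolding * of_nat_mult cT by (simp del: binomial_Suc_Suc)
  next
    case False
    have "T = Suc ` ?T"
      using False by (auto simp: image_iff) (metis not0_implies_Suc)
    then have cT: "card T = card ?T" by (metis card_image inj_Suc)
    have le: "card ?T \<le> n" using card_mono[OF _ T] by simp
    let ?t = "card ?T" and ?s = "card S"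
    have sle: "?s \<le> Suc n" using Suc.prems card_mono by metis
    have "(\<Sum>x\<in>U. real (card (S - {x}) choose ?t)) =
        (\<Sum>x\<in>S. real (card (S - {x}) choose ?t)) + (\<Sum>x\<in>U - S. real (card (S - {x}) choose ?t))"
      using Suc.prems by (simp add: sum.subset_diff add.commute)
    also have "\<dots> = real (?s * ((?s - 1) choose ?t)) + real (Suc n - ?s) * real (?s choose ?t)"
      using Suc.prems finS by (simp add: card_Diff_subset)
    also have "?s * ((?s - 1) choose ?t) = (?s - ?t) * (?s choose ?t)"
      by (simp only: binomial_absorb_comp)
    \<comment> \<open>Truncated subtraction does no harm: for \<open>?t > ?s\<close> the binomial
      coefficient vanishes.\<close>
    also have "real ((?s - ?t) * (?s choose ?t)) + real (Suc n - ?s) * real (?s choose ?t) =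
        real (Suc n - ?t) * real (?s choose ?t)"
      using sle by (cases "?t \<le> ?s") (auto simp: of_nat_diff algebra_simps binomial_eq_0)
    finally have sum: "(\<Sum>x\<in>U. real (card (S - {x}) choose ?t)) =
        real (Suc n - ?t) * real (?s choose ?t)" .
    have absorb: "real (Suc n - ?t) * real (Suc n choose ?t) = real (Suc n) * real (n choose ?t)"
      using binomial_absorb_comp[of "Suc n" ?t] by (metis diff_Suc_1 of_nat_mult)
    have "real (Suc n - ?t) * real (?s choose ?t) / real (n choose ?t) / real (Suc n) =
        real (?s choose ?t) / real (Suc n choose ?t)"
      using absorb le by (intro frac) (simp_all add: mult.commute)
    then show ?thesis using False by (simp add: sum cT flip: sum_divide_distrib)
  qed
  finally show ?case .
qed

text \<open>The ratio of the binomial coefficients is a product of factors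
  \<open>(s - i) / (n - i)\<close>, each at most \<open>s / n\<close>. The form without division
  avoids zero denominators and lets the induction multiply one factor at a time.\<close>

lemma binomial_ratio_le: "s \<le> n \<Longrightarrow> (s choose t) * n ^ t \<le> s ^ t * (n choose t)"
proof (induction t)
  case (Suc t)
  have step: "Suc t * (m choose Suc t) = (m - t) * (m choose t)" for m
    by (simp only: binomial_absorption binomial_absorb_comp)
  have "Suc t * ((s choose Suc t) * n ^ Suc t) = (Suc t * (s choose Suc t)) * n ^ Suc t"
    by (simp only: mult.assoc)
  also have "\<dots> = ((s - t) * n) * ((s choose t) * n ^ t)"
    by (simp only: step power_Suc ac_simps)
  also have "\<dots> \<le> (s * (n - t)) * (s ^ t * (n choose t))"
  proof (rule mult_le_mono[OF _ Suc.IH[OF Suc.prems]])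
    \<comment> \<open>Less is subtracted on the right, since
      \<open>t * s \<le> t * n\<close>.\<close>
    have "s * n - t * n \<le> s * n - t * s" using Suc.prems by (intro diff_le_mono2 mult_le_mono2)
    then show "(s - t) * n \<le> s * (n - t)" by (simp add: algebra_simps)
  qed
  also have "\<dots> = s ^ Suc t * ((n - t) * (n choose t))" by (simp only: power_Suc ac_simps)
  also have "\<dots> = Suc t * (s ^ Suc t * (n choose Suc t))" by (simp only: step[of n, symmetric] mult.left_commute)
  finally show ?case by (simp del: mult_Suc power_Suc)
qed simp

lemma prob_permutation_hits_le:
  assumes "S \<subseteq> {..<n}" "T \<subseteq> {..<n}" and S: "real (card S) \<le> \<delta> * real n" and "0 \<le> \<delta>"
  shows "measure_pmf.prob (pmf_of_set (permutations_of_set {..<n})) {\<pi>. \<forall>i\<in>T. \<pi> ! i \<in> S} \<le> \<delta> ^ card T"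
proof -
  have s: "card S \<le> n" and t: "card T \<le> n"
    using card_mono[of "{..<n}" S] card_mono[of "{..<n}" T] assms by simp_all
  have "measure_pmf.prob (pmf_of_set (permutations_of_set {..<n})) {\<pi>. \<forall>i\<in>T. \<pi> ! i \<in> S} =
      real (card S choose card T) / real (n choose card T)"
    using prob_permutation_hits[of "{..<n}" n S T] assms by (simp add: pmf_map vimage_def)
  also have "\<dots> \<le> \<delta> ^ card T"
  proof (cases "n = 0")
    case False
    have "real (card S choose card T) * real n ^ card T \<le> real (card S) ^ card T * real (n choose card T)"
      using binomial_ratio_le[OF s, of "card T"] by (metis of_nat_le_iff of_nat_mult of_nat_power)
    also have "\<dots> \<le> (\<delta> * real n) ^ card T * real (n choose card T)"
      using S by (intro mult_right_mono power_mono) simp_all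
    finally have "real (card S choose card T) * real n ^ card T \<le>
        (\<delta> ^ card T * real (n choose card T)) * real n ^ card T"
      by (simp add: power_mult_distrib algebra_simps)
    then have "real (card S choose card T) \<le> \<delta> ^ card T * real (n choose card T)"
      using False by (simp add: mult_le_cancel_right)
    then show ?thesis using t by (simp add: divide_le_eq)
  qed (use s t in simp)
  finally show ?thesis .
qed

text \<open>\<open>S\<close> will be the set of corrupted coordinates of the permuted codeword, so
  the cardinality is the number of errors that land in block \<open>j\<close>.\<close>

definition overfull :: "nat \<Rightarrow> nat \<Rightarrow> real \<Rightarrow> nat set \<Rightarrow> nat list \<Rightarrow> bool" where
  "overfull A B \<theta> S \<pi> \<longleftrightarrow>
    (\<exists>j<B. \<theta> < real (card {i \<in> {j * A..<(j + 1) * A}. \<pi> ! i \<in> S}))"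

lemma prob_overfull_le:
  assumes S: "S \<subseteq> {..<A * B}" "real (card S) \<le> \<delta> * real (A * B)" and \<delta>: "0 < \<delta>" "\<delta> \<le> 1"
  shows "measure_pmf.prob (pmf_of_set (permutations_of_set {..<A * B})) {\<pi>. overfull A B \<theta> S \<pi>} \<le>
    real B * 2 ^ A * \<delta> powr \<theta>"
proof -
  let ?P = "measure_pmf.prob (pmf_of_set (permutations_of_set {..<A * B}))"
  let ?I = "\<lambda>j. {j * A..<(j + 1) * A}"
  let ?\<T> = "\<lambda>j. {T \<in> Pow (?I j). \<theta> < real (card T)}"
  have "{\<pi>. overfull A B \<theta> S \<pi>} \<subseteq> (\<Union>j\<in>{..<B}. \<Union>T\<in>?\<T> j. {\<pi>. \<forall>i\<in>T. \<pi> ! i \<in> S})"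
  proof
    fix \<pi> assume "\<pi> \<in> {\<pi>. overfull A B \<theta> S \<pi>}"
    then obtain j where "j < B" "\<theta> < real (card {i \<in> ?I j. \<pi> ! i \<in> S})"
      unfolding overfull_def by blast
    then show "\<pi> \<in> (\<Union>j\<in>{..<B}. \<Union>T\<in>?\<T> j. {\<pi>. \<forall>i\<in>T. \<pi> ! i \<in> S})"
      \<comment> \<open>The set of all hit indices of an overfull block is itself one of the sets in
        the union.\<close>
      by (intro UN_I[of j] UN_I[of "{i \<in> ?I j. \<pi> ! i \<in> S}"]) auto
  qed
  then have "?P {\<pi>. overfull A B \<theta> S \<pi>} \<le> ?P (\<Union>j\<in>{..<B}. \<Union>T\<in>?\<T> j. {\<pi>. \<forall>i\<in>T. \<pi> ! i \<in> S})"
    by (intro measure_pmf.finite_measure_mono) auto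
  also have "\<dots> \<le> (\<Sum>j<B. ?P (\<Union>T\<in>?\<T> j. {\<pi>. \<forall>i\<in>T. \<pi> ! i \<in> S}))"
    by (intro measure_pmf.finite_measure_subadditive_finite) auto
  also have "\<dots> \<le> (\<Sum>j<B. 2 ^ A * \<delta> powr \<theta>)"
  proof (rule sum_mono)
    fix j assume "j \<in> {..<B}"
    then have "(j + 1) * A \<le> B * A" by (intro mult_le_mono1) simp
    then have I: "?I j \<subseteq> {..<A * B}" by (auto simp: mult.commute)
    have "?P (\<Union>T\<in>?\<T> j. {\<pi>. \<forall>i\<in>T. \<pi> ! i \<in> S}) \<le> (\<Sum>T\<in>?\<T> j. ?P {\<pi>. \<forall>i\<in>T. \<pi> ! i \<in> S})"
      by (intro measure_pmf.finite_measure_subadditive_finite) auto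
    also have "\<dots> \<le> (\<Sum>T\<in>?\<T> j. \<delta> powr \<theta>)"
    proof (rule sum_mono)
      fix T assume T: "T \<in> ?\<T> j"
      have "?P {\<pi>. \<forall>i\<in>T. \<pi> ! i \<in> S} \<le> \<delta> ^ card T"
        using T I S \<delta> by (intro prob_permutation_hits_le) auto
      also have "\<dots> = \<delta> powr real (card T)" using \<delta> by (simp add: powr_realpow)
      also have "\<dots> \<le> \<delta> powr \<theta>" using T \<delta> by (intro powr_mono') auto
      finally show "?P {\<pi>. \<forall>i\<in>T. \<pi> ! i \<in> S} \<le> \<delta> powr \<theta>" .
    qed
    also have "\<dots> = real (card (?\<T> j)) * \<delta> powr \<theta>" by simp
    also have "\<dots> \<le> 2 ^ A * \<delta> powr \<theta>"
    proof (rule mult_right_mono)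
      have "card (?\<T> j) \<le> card (Pow (?I j))" by (intro card_mono) auto
      also have "\<dots> = 2 ^ A" by (simp add: card_Pow)
      finally have "real (card (?\<T> j)) \<le> real (2 ^ A)" by (rule of_nat_mono)
      then show "real (card (?\<T> j)) \<le> 2 ^ A" by simp
    qed simp
    finally show "?P (\<Union>T\<in>?\<T> j. {\<pi>. \<forall>i\<in>T. \<pi> ! i \<in> S}) \<le> 2 ^ A * \<delta> powr \<theta>" .
  qed
  also have "\<dots> = real B * 2 ^ A * \<delta> powr \<theta>" by simp
  finally show ?thesis .
qed

section \<open>The security game\<close>

lemma integrable_pmf_at: "integrable (measure_pmf M) (\<lambda>z. pmf (f z) x)"
  by (rule measure_pmf.integrable_const_bound[where B = 1]) (simp_all add: pmf_le_1)

lemma pmf_bind_le: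
  assumes "\<And>z. z \<in> set_pmf M \<Longrightarrow> pmf (f z) x \<le> c"
  shows "pmf (bind_pmf M f) x \<le> c"
  unfolding pmf_bind
  by (intro measure_pmf.integral_le_const integrable_pmf_at) (simp add: AE_measure_pmf_iff assms)

lemma pmf_bind_mono:
  assumes "\<And>z. z \<in> set_pmf M \<Longrightarrow> pmf (f z) x \<le> pmf (g z) x"
  shows "pmf (bind_pmf M f) x \<le> pmf (bind_pmf M g) x"
  unfolding pmf_bind
  by (intro integral_mono_AE integrable_pmf_at) (simp add: AE_measure_pmf_iff assms)

lemma pmf_return_mono: "(P \<Longrightarrow> Q) \<Longrightarrow> pmf (return_pmf P) True \<le> pmf (return_pmf Q) True"
  by (cases P; cases Q) simp_all

text \<open>For fixed permutation and message, the pad can be read off from the result; an injection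
  of a finite set into itself is a bijection and preserves the uniform distribution.\<close>

lemma one_time_pad_uniform:
  assumes \<pi>: "\<pi> \<in> permutations_of_set {..<n}" and z: "length z = n"
  shows "map_pmf (\<lambda>r. permute \<pi> (xor_bits z r)) (pmf_of_set {r. length r = n}) =
    pmf_of_set {r. length r = n}"
proof -
  let ?R = "{r :: bool list. length r = n}" and ?f = "\<lambda>r. permute \<pi> (xor_bits z r)"
  note fin = finite_bit_strings and ne = bit_strings_nonempty
  note \<pi>' = permutations_of_setD[OF \<pi>] length_finite_permutations_of_set[OF \<pi>]
  have inj: "inj_on ?f ?R"
  proof (rule inj_onI)
    fix r s assume rs: "r \<in> ?R" "s \<in> ?R" and eq: "?f r = ?f s"
    show "r = s"
    proof (rule nth_equalityI)
      fix i assume i: "i < length r"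
      have "?f u ! (\<pi> ! i) = (z ! i \<noteq> u ! i)" if "u \<in> ?R" for u
        using nth_permute[of \<pi> "xor_bits z u" i] \<pi>' that i rs z by simp
      from this[OF rs(1)] this[OF rs(2)] eq show "r ! i = s ! i" by auto
    qed (use rs in simp)
  qed
  have "?f ` ?R = ?R" by (rule endo_inj_surj[OF fin _ inj]) (auto simp: z)
  then show ?thesis using map_pmf_of_set_inj[OF inj ne fin] by simp
qed

text \<open>The contrapositive of \<open>decoding_correct\<close>. The decoder is deterministic, so
  its failure probability is 0 as soon as it decodes correctly, which no
  \<open>\<epsilon> \<ge> 0\<close> allows to exceed.\<close>

lemma decoding_fails_imp_overfull:
  fixes \<delta>C :: real
  assumes code: "is_code (A l) (a l) (encC l) (decC l)"
    and tol: "error_tolerance (A l) (a l) \<delta>C (encC l) (decC l)" and "0 \<le> \<epsilon>"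
    and key: "(\<pi>, r) \<in> set_pmf (con_gen A B l)"
    and x: "length x = a l * B l" and y: "length y = A l * B l"
    and fails: "decoding_fails \<alpha> \<kappa> \<epsilon> (a l * B l) (con_dec a A B decC l (\<pi>, r)) x y"
  defines "Y \<equiv> permute \<pi> (xor_bits (blockwise (encC l) (a l) (B l) x) r)"
  shows "overfull (A l) (B l) (\<delta>C * real (A l)) {p. p < A l * B l \<and> Y ! p \<noteq> y ! p} \<pi>"
proof (rule ccontr)
  let ?S = "{p. p < A l * B l \<and> Y ! p \<noteq> y ! p}"
  assume no: "\<not> overfull (A l) (B l) (\<delta>C * real (A l)) ?S \<pi>"
  note \<pi> = con_genD[OF key]
  have errors: "real (card {i \<in> {j * A l..<(j + 1) * A l}. Y ! (\<pi> ! i) \<noteq> y ! (\<pi> ! i)}) \<le> \<delta>C * real (A l)"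
    if "j < B l" for j
  proof -
    have "(j + 1) * A l \<le> B l * A l" using that by (intro mult_le_mono1) simp
    then have "\<pi> ! i < A l * B l" if "i < (j + 1) * A l" for i
      using \<pi> that nth_mem[of i \<pi>] by (auto simp: mult.commute)
    then have eq: "{i \<in> {j * A l..<(j + 1) * A l}. Y ! (\<pi> ! i) \<noteq> y ! (\<pi> ! i)} =
        {i \<in> {j * A l..<(j + 1) * A l}. \<pi> ! i \<in> ?S}" by auto
    from no that have "\<not> \<delta>C * real (A l) < real (card {i \<in> {j * A l..<(j + 1) * A l}. \<pi> ! i \<in> ?S})"
      unfolding overfull_def by blast
    then show ?thesis unfolding eq by (rule leI)
  qed
  from fails obtain L M where LM: "1 \<le> L" "L \<le> M" "M \<le> a l * B l"
    and bad: "measure_pmf.prob (con_dec a A B decC l (\<pi>, r) L M) {g. fst (run_alg y g) \<noteq> segment L M x} > \<epsilon>"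
    unfolding decoding_fails_def by blast
  have "0 < a l" using LM by (auto intro!: gr0I)
  from decoding_correct[OF code tol this LM x \<pi>(1-4) y Y_def[THEN meta_eq_to_obj_eq] errors]
  have "fst (run_alg y (dec_alg (a l) (A l) (B l) (decC l) (\<pi>, r) L M)) = segment L M x" .
  with bad assms(3) show False by (simp add: con_dec_eq_dec_alg)
qed

text \<open>The random choices are reordered until the permutation is drawn last, after the codeword
  and its corruption; then \<open>prob_overfull_le\<close> applies for each fixed codeword and
  corruption.\<close>

lemma game_le:
  fixes \<delta>C \<delta> \<epsilon> :: real
  assumes code: "is_code (A l) (a l) (encC l) (decC l)"
    and tol: "error_tolerance (A l) (a l) \<delta>C (encC l) (decC l)"
    and \<epsilon>: "0 \<le> \<epsilon>" and \<delta>: "0 < \<delta>" "\<delta> \<le> 1"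
  shows "pmf (paLDC_sec_game \<alpha> \<kappa> \<delta> \<epsilon> 1 (A l * B l) (a l * B l) (con_gen A B l)
      (con_enc a B encC l) (con_dec a A B decC l) ch co) True \<le>
    real (B l) * 2 ^ A l * \<delta> powr (\<delta>C * real (A l))"
proof -
  let ?n = "A l * B l" and ?k = "a l * B l" and ?c = "real (B l) * 2 ^ A l * \<delta> powr (\<delta>C * real (A l))"
  let ?perms = "pmf_of_set (permutations_of_set {..<?n})"
  let ?pads = "pmf_of_set {r :: bool list. length r = ?n}"
  let ?legal = "\<lambda>Y y'. length y' = ?n \<and> real (hamming Y y') \<le> \<delta> * real ?n"
  let ?S = "\<lambda>Y y'. {p. p < ?n \<and> Y ! p \<noteq> y' ! p}"
  let ?over = "\<lambda>\<pi> Y y'. overfull (A l) (B l) (\<delta>C * real (A l)) (?S Y y') \<pi>"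
  \<comment> \<open>The only round collapsed to one Boolean: an illegal move and a surviving decoder
    both yield \<open>False\<close>.\<close>
  define move where "move sk x s' Y = bind_pmf (co s' Y) (\<lambda>(y', s''). return_pmf
    (?legal Y y' \<and> decoding_fails \<alpha> \<kappa> \<epsilon> ?k (con_dec a A B decC l sk) x y'))" for sk x s' Y
  \<comment> \<open>Here message and pad enter only through the codeword \<open>Y\<close>, so that
    the pad can be averaged out.\<close>
  define ideal where "ideal \<pi> s' Y = bind_pmf (co s' Y) (\<lambda>(y', s''). return_pmf
    (?legal Y y' \<and> ?over \<pi> Y y'))" for \<pi> s' Y
  have c: "0 \<le> ?c" by simp
  have "paLDC_sec_game \<alpha> \<kappa> \<delta> \<epsilon> 1 ?n ?k (con_gen A B l) (con_enc a B encC l) (con_dec a A B decC l) ch co =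
      bind_pmf (con_gen A B l) (\<lambda>sk. bind_pmf (ch Atom) (\<lambda>(x, s').
        if length x \<noteq> ?k then return_pmf False else bind_pmf (con_enc a B encC l sk x) (move sk x s')))"
    unfolding paLDC_sec_game_def One_nat_def paLDC_rounds.simps move_def[abs_def]
    by (intro bind_pmf_cong refl)
      (auto intro!: bind_pmf_cong simp: not_le not_less split: if_splits)
  \<comment> \<open>The adversary commits to its message without seeing the key, so message and
    memory can be fixed first.\<close>
  also have "\<dots> = bind_pmf (ch Atom) (\<lambda>(x, s'). bind_pmf (con_gen A B l) (\<lambda>sk.
        if length x \<noteq> ?k then return_pmf False else bind_pmf (con_enc a B encC l sk x) (move sk x s')))"
    unfolding case_prod_unfold by (rule bind_commute_pmf)
  also have "pmf \<dots> True \<le> ?c"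
  proof (rule pmf_bind_le)
    fix z assume "z \<in> set_pmf (ch Atom)"
    obtain x s' where z: "z = (x, s')" by (cases z)
    have "pmf (bind_pmf (con_gen A B l) (\<lambda>sk. bind_pmf (con_enc a B encC l sk x) (move sk x s'))) True \<le> ?c"
      if x: "length x = ?k"
    proof -
      let ?z = "blockwise (encC l) (a l) (B l) x"
      let ?Y = "\<lambda>\<pi> r. permute \<pi> (xor_bits ?z r)"
      have len: "length ?z = ?n"
        using length_blockwise[of "a l" "encC l" "A l" "B l" x] x code
        by (simp add: is_code_def mult.commute)
      have "pmf (bind_pmf (con_gen A B l) (\<lambda>sk. bind_pmf (con_enc a B encC l sk x) (move sk x s'))) True \<le>
          pmf (bind_pmf (con_gen A B l) (\<lambda>(\<pi>, r). ideal \<pi> s' (?Y \<pi> r))) True"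
      proof (rule pmf_bind_mono)
        fix sk assume sk: "sk \<in> set_pmf (con_gen A B l)"
        obtain \<pi> r where \<pi>r: "sk = (\<pi>, r)" by (cases sk)
        have "pmf (move sk x s' (?Y \<pi> r)) True \<le> pmf (ideal \<pi> s' (?Y \<pi> r)) True"
          unfolding move_def ideal_def
        proof (rule pmf_bind_mono, clarify)
          fix y' s''
          show "pmf (return_pmf (?legal (?Y \<pi> r) y' \<and>
              decoding_fails \<alpha> \<kappa> \<epsilon> ?k (con_dec a A B decC l sk) x y')) True \<le>
            pmf (return_pmf (?legal (?Y \<pi> r) y' \<and> ?over \<pi> (?Y \<pi> r) y')) True"
            using decoding_fails_imp_overfull[where a = a and A = A and B = B and l = l and y = y'
                and encC = encC and decC = decC, OF code tol \<epsilon> _ x] sk \<pi>r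
            by (intro pmf_return_mono) blast
        qed
        then show "pmf (bind_pmf (con_enc a B encC l sk x) (move sk x s')) True \<le>
            pmf (case sk of (\<pi>, r) \<Rightarrow> ideal \<pi> s' (?Y \<pi> r)) True"
          by (simp add: \<pi>r con_enc_eq bind_return_pmf)
      qed
      also have "bind_pmf (con_gen A B l) (\<lambda>(\<pi>, r). ideal \<pi> s' (?Y \<pi> r)) =
          bind_pmf ?perms (\<lambda>\<pi>. bind_pmf (map_pmf (?Y \<pi>) ?pads) (ideal \<pi> s'))"
        by (simp add: con_gen_def pair_pmf_def bind_assoc_pmf bind_return_pmf bind_map_pmf)
      also have "\<dots> = bind_pmf ?perms (\<lambda>\<pi>. bind_pmf ?pads (ideal \<pi> s'))"
        by (intro bind_pmf_cong refl) (simp add: one_time_pad_uniform[OF _ len])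
      \<comment> \<open>By now \<open>Y\<close> is uniform whatever the permutation is. The
        permutation can be drawn after \<open>Y\<close> and, since \<open>co\<close> sees only
        \<open>Y\<close> and its memory, after the corruption as well.\<close>
      also have "\<dots> = bind_pmf ?pads (\<lambda>Y. bind_pmf ?perms (\<lambda>\<pi>. ideal \<pi> s' Y))"
        by (rule bind_commute_pmf)
      also have "\<dots> = bind_pmf ?pads (\<lambda>Y. bind_pmf (co s' Y) (\<lambda>(y', s'').
          map_pmf (\<lambda>\<pi>. ?legal Y y' \<and> ?over \<pi> Y y') ?perms))"
        unfolding ideal_def map_pmf_def case_prod_unfold
        by (subst bind_commute_pmf) (rule refl)
      also have "pmf \<dots> True \<le> ?c"
      proof (rule pmf_bind_le, rule pmf_bind_le, clarify)
        fix Y y' s'' assume "Y \<in> set_pmf ?pads"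
        then have Y: "length Y = ?n" by simp
        show "pmf (map_pmf (\<lambda>\<pi>. ?legal Y y' \<and> ?over \<pi> Y y') ?perms) True \<le> ?c"
        proof (cases "?legal Y y'")
          case True
          \<comment> \<open>The set of corrupted positions has \<open>hamming Y y'\<close> elements,
            which a legal move keeps below the bound.\<close>
          have "measure_pmf.prob ?perms {\<pi>. ?over \<pi> Y y'} \<le> ?c"
            using True Y \<delta> by (intro prob_overfull_le) (auto simp: hamming_def)
          then show ?thesis using True by (simp add: pmf_map vimage_def)
        qed (use c in \<open>auto simp: pmf_return\<close>)
      qed
      finally show ?thesis .
    qed
    then show "pmf (case z of (x, s') \<Rightarrow> bind_pmf (con_gen A B l) (\<lambda>sk. if length x \<noteq> ?k
        then return_pmf False else bind_pmf (con_enc a B encC l sk x) (move sk x s'))) True \<le> ?c"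
      using c by (cases "length x = ?k") (simp_all add: z)
  qed
  finally show ?thesis .
qed

section \<open>Negligibility and correctness\<close>

text \<open>The coefficients are natural numbers with sum \<open>poly P 1\<close>, and every power
  of \<open>l\<close> is at most the leading one.\<close>

lemma poly_nat_le: "1 \<le> l \<Longrightarrow> poly P l \<le> poly P 1 * l ^ degree P" for P :: "nat poly" and l :: nat
  unfolding poly_altdef sum_distrib_right
  by (intro sum_mono) (simp add: power_increasing)

text \<open>Superlogarithmic growth of \<open>a\<close> makes \<open>2 ^ A\<close> eventually larger
  than any fixed power of \<open>l\<close>; a suitable power absorbs both the polynomial bound on
  \<open>B\<close> and the target \<open>1 / l ^ c\<close>.\<close>

lemma negligible_exponential:
  assumes a: "(\<lambda>l. real (a l)) \<in> \<omega>(\<lambda>l. ln (real l))" and "polynomially_bounded B"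
    and "0 < R" and A: "\<And>l. real (A l) = real (a l) / R"
  shows "negligible (\<lambda>l. real (B l) * (1 / 2) ^ A l)"
  unfolding negligible_def
proof
  fix c :: nat
  obtain P where P: "\<And>l. B l \<le> poly P l" using assms(2) unfolding polynomially_bounded_def by blast
  define d where "d = degree P"
  \<comment> \<open>\<open>d\<close> pays for \<open>B\<close> and \<open>c\<close> for the target;
    the additional 1 makes \<open>K\<close> positive.\<close>
  define m where "m = c + d + 1"
  \<comment> \<open>Chosen so that \<open>K * ln l \<le> a l\<close> amounts to
    \<open>l ^ m \<le> 2 ^ A l\<close>, using \<open>A l = a l / R\<close>.\<close>
  define K where "K = real m * R / ln 2"
  have "0 < K" using assms(3) by (simp add: K_def m_def)
  from landau_omega.smallD[OF a this]
  have "eventually (\<lambda>l. K * \<bar>ln (real l)\<bar> \<le> real (a l)) at_top" by simp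
  moreover have "eventually (\<lambda>l :: nat. 1 \<le> l) at_top" by (rule eventually_ge_at_top)
  ultimately have "eventually (\<lambda>l. norm (real (B l) * (1 / 2) ^ A l) \<le>
      real (poly P 1) * norm (1 / real l ^ c)) at_top"
  proof eventually_elim
    case (elim l)
    then have l: "1 \<le> real l" by simp
    have "real m * ln (real l) = K * \<bar>ln (real l)\<bar> / R * ln 2" using l assms(3) by (simp add: K_def)
    also have "\<dots> \<le> real (a l) / R * ln 2"
      using elim(1) assms(3) by (intro mult_right_mono divide_right_mono) simp_all
    finally have "real m * ln (real l) \<le> real (A l) * ln 2" by (simp add: A)
    then have "ln (real l ^ m) \<le> ln (2 ^ A l)" using l by (simp add: ln_realpow)
    then have exp: "real l ^ m \<le> 2 ^ A l" using l by (subst (asm) ln_le_cancel_iff) simp_all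
    have "real (B l) \<le> real (poly P 1 * l ^ d)"
      using P[of l] poly_nat_le[OF elim(2), of P] unfolding d_def of_nat_le_iff by linarith
    then have B: "real (B l) \<le> real (poly P 1) * real l ^ d" by simp
    have "real (B l) * real l ^ c \<le> real (poly P 1) * real l ^ d * real l ^ c"
      using B by (intro mult_right_mono) simp_all
    also have "\<dots> = real (poly P 1) * real l ^ (c + d)" by (simp add: power_add)
    also have "\<dots> \<le> real (poly P 1) * real l ^ m"
      using l by (intro mult_left_mono power_increasing) (simp_all add: m_def)
    also have "\<dots> \<le> real (poly P 1) * 2 ^ A l" using exp by (intro mult_left_mono) simp_all
    finally have "real (B l) * real l ^ c \<le> real (poly P 1) * 2 ^ A l" .
    then have "real (B l) / 2 ^ A l \<le> real (poly P 1) / real l ^ c"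
      using l by (simp add: field_simps)
    then show ?case by (simp add: power_one_over)
  qed
  then show "(\<lambda>l. real (B l) * (1 / 2) ^ A l) \<in> O(\<lambda>l. 1 / real l ^ c)" by (rule bigoI)
qed

text \<open>\<open>decoding_correct\<close> with the codeword itself as received word: there are no
  errors, which a nonnegative tolerance admits.\<close>

lemma is_local_code_construction:
  fixes \<delta>C :: real
  assumes code: "is_code (A l) (a l) (encC l) (decC l)"
    and tol: "error_tolerance (A l) (a l) \<delta>C (encC l) (decC l)" and "0 \<le> \<delta>C"
    and sk: "sk \<in> set_pmf (con_gen A B l)"
  shows "is_local_code (A l * B l) (a l * B l) (con_enc a B encC l sk) (con_dec a A B decC l sk)"
proof -
  obtain \<pi> r where sk_eq: "sk = (\<pi>, r)" by (cases sk)
  note \<pi> = con_genD[OF sk[unfolded sk_eq]]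
  show ?thesis unfolding is_local_code_def
  proof (intro allI impI ballI conjI)
    fix x y assume x: "length x = a l * B l" and "y \<in> set_pmf (con_enc a B encC l sk x)"
    then have y: "y = permute \<pi> (xor_bits (blockwise (encC l) (a l) (B l) x) r)"
      by (simp add: sk_eq con_enc_eq)
    have "length (blockwise (encC l) (a l) (B l) x) = A l * B l"
      using length_blockwise[of "a l" "encC l" "A l" "B l" x] x code
      by (simp add: is_code_def mult.commute)
    then show len: "length y = A l * B l" by (simp add: y \<pi>)
    fix L M g assume LM: "1 \<le> L \<and> L \<le> M \<and> M \<le> a l * B l"
      and g: "g \<in> set_pmf (con_dec a A B decC l sk L M)"
    have "0 < a l" using LM by (auto intro!: gr0I)
    then show "fst (run_alg y g) = segment L M x"
      using decoding_correct[OF code tol _ _ _ _ x \<pi> len y] LM g assms(3)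
      by (simp add: con_dec_eq_dec_alg sk_eq)
  qed
qed

theorem theorem4:
  fixes a A B :: "nat \<Rightarrow> nat"
    and encC decC :: "nat \<Rightarrow> bool list \<Rightarrow> bool list"
    and R \<delta>C :: real
  assumes "(\<lambda>l. real (a l)) \<in> \<omega>(\<lambda>l. ln (real l))"
    and "polynomially_bounded a" and "polynomially_bounded B"
    and "poly_time (\<lambda>l. {()}) (\<lambda>l _. a l)" and "poly_time (\<lambda>l. {()}) (\<lambda>l _. B l)"
    and "\<And>l. is_code (A l) (a l) (encC l) (decC l)"
    and "0 < R" and "\<And>l. real (A l) = real (a l) / R"
    and "0 < \<delta>C" and "\<And>l. error_tolerance (A l) (a l) \<delta>C (encC l) (decC l)"
    and "poly_time (\<lambda>l. {w. length w = a l}) encC"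
    and "poly_time (\<lambda>l. {v. length v = A l}) decC"
  shows "\<exists>\<delta> \<epsilon>. 0 < \<delta> \<and> 0 < \<epsilon> \<and> \<epsilon> < 1 \<and>
    paLDC (\<lambda>l. A l * B l) (\<lambda>l. a l * B l)
      (con_gen A B) (con_enc a B encC) (con_dec a A B decC)
      (2 / R) a \<delta> (\<lambda>_. \<epsilon>) 1"
proof -
  have "A l \<le> nat \<lceil>1 / R\<rceil> * a l" for l
  proof -
    have "real (A l) = 1 / R * real (a l)" by (simp add: assms(8))
    also have "\<dots> \<le> real (nat \<lceil>1 / R\<rceil>) * real (a l)"
      by (intro mult_right_mono real_nat_ceiling_ge) simp
    finally show ?thesis by (simp flip: of_nat_mult)
  qed
  then have poly_A: "polynomially_bounded A"
    by (rule polynomially_bounded_mono[rotated])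
      (intro polynomially_bounded_mult polynomially_bounded_const assms(2))
  note compute = assms(4,5,11,12)[unfolded poly_time_iff_pt]
  have len: "length (encC l w) = A l" if "length w = a l" for l w
    using assms(6)[of l] that by (simp add: is_code_def)
  have len': "length (decC l v) = a l" if "length v = A l" for l v
    using assms(6)[of l] that by (simp add: is_code_def)
  have compute_A: "pt (\<lambda>l. {()}) (\<lambda>l _. A l)"
    by (rule pt_codeword_length[OF compute(1) assms(2) poly_A compute(3) len])
  note algorithms = ppt_con_gen[OF compute_A poly_A compute(2) assms(3)]
    ppt_con_enc[OF compute(1) assms(2) poly_A compute(2) assms(3) compute(3) len]
    ppt_con_dec[OF compute(1) assms(2) compute_A poly_A assms(3) compute(4) len']
  define \<delta> where "\<delta> = 4 powr (- (1 / \<delta>C))"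
  have \<delta>: "0 < \<delta>" "\<delta> \<le> 1"
    using assms(9) powr_mono[of "- (1 / \<delta>C)" 0 "4 :: real"] by (simp_all add: \<delta>_def)
  have "\<delta> powr (\<delta>C * real (A l)) = (1 / 4) ^ A l" for l
  proof -
    have "\<delta> powr (\<delta>C * real (A l)) = 4 powr (- real (A l))"
      unfolding \<delta>_def powr_powr using assms(9) by simp
    then show ?thesis by (simp add: powr_minus powr_realpow power_one_over inverse_eq_divide)
  qed
  then have bound: "real (B l) * 2 ^ A l * \<delta> powr (\<delta>C * real (A l)) = real (B l) * (1 / 2) ^ A l" for l
    by (simp add: mult.assoc flip: power_mult_distrib)
  \<comment> \<open>The decoder being deterministic, every constant strictly between 0 and 1 could
    stand for the failure threshold 1 / 2.\<close>
  have secure: "\<exists>\<mu>. negligible \<mu> \<and> (\<forall>l. pmf (paLDC_sec_game (2 / R) (a l) \<delta> (1 / 2) 1 (A l * B l)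
      (a l * B l) (con_gen A B l) (con_enc a B encC l) (con_dec a A B decC l) (ch l) (co l)) True \<le> \<mu> l)"
    for ch co
  proof (intro exI conjI allI)
    show "negligible (\<lambda>l. real (B l) * (1 / 2) ^ A l)"
      by (rule negligible_exponential[OF assms(1,3,7,8)])
    show "pmf (paLDC_sec_game (2 / R) (a l) \<delta> (1 / 2) 1 (A l * B l) (a l * B l) (con_gen A B l)
        (con_enc a B encC l) (con_dec a A B decC l) (ch l) (co l)) True \<le> real (B l) * (1 / 2) ^ A l" for l
      unfolding bound[symmetric] by (rule game_le) (use assms(6,10) \<delta> in simp_all)
  qed
  have local_code: "is_local_code (A l * B l) (a l * B l) (con_enc a B encC l sk) (con_dec a A B decC l sk)"
    if "sk \<in> set_pmf (con_gen A B l)" for l sk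
    by (rule is_local_code_construction) (use assms(6,10) less_imp_le[OF assms(9)] that in simp_all)
  have "paLDC (\<lambda>l. A l * B l) (\<lambda>l. a l * B l) (con_gen A B) (con_enc a B encC) (con_dec a A B decC)
      (2 / R) a \<delta> (\<lambda>_. 1 / 2) 1"
    unfolding paLDC_def
    using algorithms local_code secure
    by simp
  with \<delta> show ?thesis by (intro exI[of _ \<delta>] exI[of _ "1 / 2"]) simp
qed

end
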